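(* The MAPFCC problem is fixed-parameter tractable when parameterized by $k+\Delta+d$, where $k=|A|$ is the number of agents, $\Delta$ is the maximum degree of the input graph $G$, and $d$ is the communication range.
   Context: MAPFCC is the following decision problem. Input: a finite simple undirected graph $G=(V,E)$, a finite set $A$ of agents, injective maps $s_0\colon A\to V$ (start positions) and $t\colon A\to V$ (target positions), a positive integer $d$ (communication range) and a positive integer $\ell$ (makespan bound). For $W\subseteq V$, say $W$ is $d$-connected if the graph $D[W]$ is connected, where $D$ is the graph on vertex set $V$ in which $u\neq v$ are adjacent iff $\mathrm{dist}_G(u,v)\le d$. A feasible solution of makespan $\mu$ is a sequence of maps $s_1,\dots,s_\mu\colon A\to V$ such that: (1) for every $a\in A$ and $i\in\{1,\dots,\mu\}$, $s_i(a)$ equals or is adjacent in $G$ to $s_{i-1}(a)$; (2) each $s_i$ is injective; (3) no swaps: there are no $i$ and distinct $a,b$ with $s_i(a)=s_{i-1}(b)$ and $s_i(b)=s_{i-1}(a)$; (4) for every $i\in\{1,\dots,\mu\}$ the set $\{s_i(a): a\in A\}$ is $d$-connected; (5) $s_\mu(a)=t(a)$ for all $a\in A$. The question is whether a feasible solution of makespan $\mu\le\ell$ exists. Fixed-parameter tractable (FPT) in parameter $p$ means solvable in time $f(p)\cdot\mathrm{poly}(n)$ for a computable $f$, where $n$ is the input size. *)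

theory Defs
  imports
    "Graph_Theory.Graph_Theory"
    "HOL-Library.Log_Nat"
    "HOL-Computational_Algebra.Polynomial"
begin

section \<open>Random access machines\<close>

text \<open>
  The machine model is the usual RAM with unit cost per instruction and registers holding natural
  numbers, indexed by natural numbers.  There is deliberately no multiplication: addition lengthens
  numbers by at most one bit per step, so a RAM and a Turing machine simulate each other with
  polynomial overhead, measured against the bit length of the input.  Subtraction is truncated.
\<close>

datatype instr =
    Const nat nat        \<comment> \<open>\<open>R\<^sub>i := c\<close>\<close>
  | Copy nat nat         \<comment> \<open>\<open>R\<^sub>i := R\<^sub>j\<close>\<close>
  | Load nat nat         \<comment> \<open>\<open>R\<^sub>i := R[R\<^sub>j]\<close>\<close>
  | Store nat nat        \<comment> \<open>\<open>R[R\<^sub>i] := R\<^sub>j\<close>\<close>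
  | Add nat nat nat      \<comment> \<open>\<open>R\<^sub>i := R\<^sub>j + R\<^sub>k\<close>\<close>
  | Sub nat nat nat      \<comment> \<open>\<open>R\<^sub>i := max 0 (R\<^sub>j - R\<^sub>k)\<close>\<close>
  | Half nat nat         \<comment> \<open>\<open>R\<^sub>i := \<lfloor>R\<^sub>j / 2\<rfloor>\<close>\<close>
  | Jump nat
  | JumpZero nat nat     \<comment> \<open>if \<open>R\<^sub>i = 0\<close>, jump to the given position\<close>

type_synonym ram_config = "nat \<times> (nat \<Rightarrow> nat)"

fun ram_exec :: "instr \<Rightarrow> ram_config \<Rightarrow> ram_config" where
  "ram_exec (Const i c) (pc, R) = (Suc pc, R(i := c))"
| "ram_exec (Copy i j) (pc, R) = (Suc pc, R(i := R j))"
| "ram_exec (Load i j) (pc, R) = (Suc pc, R(i := R (R j)))"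
| "ram_exec (Store i j) (pc, R) = (Suc pc, R(R i := R j))"
| "ram_exec (Add i j k) (pc, R) = (Suc pc, R(i := R j + R k))"
| "ram_exec (Sub i j k) (pc, R) = (Suc pc, R(i := R j - R k))"
| "ram_exec (Half i j) (pc, R) = (Suc pc, R(i := R j div 2))"
| "ram_exec (Jump l) (pc, R) = (l, R)"
| "ram_exec (JumpZero i l) (pc, R) = (if R i = 0 then l else Suc pc, R)"

text \<open>The machine halts by leaving the program text; a halted configuration no longer changes.\<close>

definition ram_step :: "instr list \<Rightarrow> ram_config \<Rightarrow> ram_config" where
  "ram_step P c = (if fst c < length P then ram_exec (P ! fst c) c else c)"

definition ram_init :: "nat list \<Rightarrow> ram_config" where
  "ram_init xs =
     (0, \<lambda>r. if r = 0 then length xs else if r \<le> length xs then xs ! (r - 1) else 0)"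

text \<open>On input \<open>xs\<close> program \<open>P\<close> halts after at most \<open>t\<close> steps with result \<open>y\<close> in register 0.\<close>

definition ram_outputs :: "instr list \<Rightarrow> nat list \<Rightarrow> nat \<Rightarrow> nat \<Rightarrow> bool" where
  "ram_outputs P xs t y \<longleftrightarrow>
     (case (ram_step P ^^ t) (ram_init xs) of (pc, R) \<Rightarrow> length P \<le> pc \<and> R 0 = y)"

definition computable :: "(nat \<Rightarrow> nat) \<Rightarrow> bool" where
  "computable f \<longleftrightarrow> (\<exists>P. \<forall>n. \<exists>t. ram_outputs P [n] t (f n))"

text \<open>Every number is charged its binary length plus one symbol, so that zeros are counted.\<close>

definition input_size :: "nat list \<Rightarrow> nat" where
  "input_size xs = (\<Sum>x\<leftarrow>xs. floorlog 2 x + 1)"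


section \<open>Fixed-parameter tractability\<close>

text \<open>
  A parameterized decision problem is given by its instances, an encoding relation (an instance may
  have several encodings), its yes-instances and the parameter.
\<close>

definition fixed_parameter_tractable ::
  "('i \<Rightarrow> bool) \<Rightarrow> ('i \<Rightarrow> nat list \<Rightarrow> bool) \<Rightarrow> ('i \<Rightarrow> bool) \<Rightarrow> ('i \<Rightarrow> nat) \<Rightarrow> bool" where
  "fixed_parameter_tractable is_inst encodes yes par \<longleftrightarrow>
     (\<exists>P f (q :: nat poly). computable f \<and>
        (\<forall>I xs. is_inst I \<and> encodes I xs \<longrightarrow>
           (\<exists>t \<le> f (par I) * poly q (input_size xs).
              ram_outputs P xs t (if yes I then 1 else 0))))"


section \<open>Multiagent path finding with communication constraint\<close>

text \<open>
  A finite simple undirected graph is a \<^const>\<open>pair_graph\<close>: a finite loop-free symmetric digraph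
  without parallel arcs.
\<close>

record ('v, 'a) mapfcc =
  graph :: "'v pair_pre_digraph"
  agents :: "'a set"
  start :: "'a \<Rightarrow> 'v"
  target :: "'a \<Rightarrow> 'v"
  comm_range :: nat
  makespan_bound :: nat

definition mapfcc_instance :: "('v, 'a) mapfcc \<Rightarrow> bool" where
  "mapfcc_instance I \<longleftrightarrow>
     pair_graph (graph I) \<and> finite (agents I) \<and>
     start I ` agents I \<subseteq> pverts (graph I) \<and> inj_on (start I) (agents I) \<and>
     target I ` agents I \<subseteq> pverts (graph I) \<and> inj_on (target I) (agents I) \<and>
     0 < comm_range I \<and> 0 < makespan_bound I"

text \<open>The shortest-path distance with unit arc weights; it is infinite between components.\<close>

definition graph_dist :: "'v pair_pre_digraph \<Rightarrow> 'v \<Rightarrow> 'v \<Rightarrow> ereal" where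
  "graph_dist G u v = wf_digraph.\<mu> (with_proj G) (\<lambda>_. 1) u v"

definition comm_graph :: "'v pair_pre_digraph \<Rightarrow> nat \<Rightarrow> 'v pair_pre_digraph" where
  "comm_graph G d =
     \<lparr> pverts = pverts G,
       parcs = {(u, v). u \<in> pverts G \<and> v \<in> pverts G \<and> u \<noteq> v \<and> graph_dist G u v \<le> ereal (real d)} \<rparr>"

definition d_connected :: "'v pair_pre_digraph \<Rightarrow> nat \<Rightarrow> 'v set \<Rightarrow> bool" where
  "d_connected G d W \<longleftrightarrow> connected (with_proj (comm_graph G d) \<restriction> W)"

text \<open>
  \<open>s i\<close> is the configuration at time \<open>i\<close>; \<open>s 0\<close> is pinned to the start configuration, which itself
  need not be connected, and only \<open>s 1, \<dots>, s m\<close> are constrained.  The empty sequence (\<open>m = 0\<close>) is a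
  solution when starts and targets coincide.
\<close>

definition feasible_solution ::
  "('v, 'a) mapfcc \<Rightarrow> nat \<Rightarrow> (nat \<Rightarrow> 'a \<Rightarrow> 'v) \<Rightarrow> bool" where
  "feasible_solution I m s \<longleftrightarrow>
     (\<forall>a \<in> agents I. s 0 a = start I a) \<and>
     (\<forall>i \<in> {1..m}. s i ` agents I \<subseteq> pverts (graph I)) \<and>
     (\<forall>i \<in> {1..m}. \<forall>a \<in> agents I.
        s i a = s (i - 1) a \<or> (s (i - 1) a, s i a) \<in> parcs (graph I)) \<and>
     (\<forall>i \<in> {1..m}. inj_on (s i) (agents I)) \<and>
     (\<forall>i \<in> {1..m}. \<not> (\<exists>a \<in> agents I. \<exists>b \<in> agents I.
        a \<noteq> b \<and> s i a = s (i - 1) b \<and> s i b = s (i - 1) a)) \<and>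
     (\<forall>i \<in> {1..m}. d_connected (graph I) (comm_range I) (s i ` agents I)) \<and>
     (\<forall>a \<in> agents I. s m a = target I a)"

definition mapfcc_yes :: "('v, 'a) mapfcc \<Rightarrow> bool" where
  "mapfcc_yes I \<longleftrightarrow> (\<exists>m \<le> makespan_bound I. \<exists>s. feasible_solution I m s)"

text \<open>
  An instance is written down by numbering its vertices and agents in any order: the numbers of
  vertices and agents, communication range and makespan bound (in binary, as all numbers), start and
  target vertices of the agents, and the adjacency matrix row by row.
\<close>

definition position :: "'b list \<Rightarrow> 'b \<Rightarrow> nat" where
  "position xs x = length (takeWhile (\<lambda>y. y \<noteq> x) xs)"

definition mapfcc_encodes :: "('v, 'a) mapfcc \<Rightarrow> nat list \<Rightarrow> bool" where
  "mapfcc_encodes I xs \<longleftrightarrow>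
     (\<exists>vs as. distinct vs \<and> set vs = pverts (graph I) \<and> distinct as \<and> set as = agents I \<and>
        xs = [length vs, length as, comm_range I, makespan_bound I] @
             map (\<lambda>a. position vs (start I a)) as @
             map (\<lambda>a. position vs (target I a)) as @
             concat (map (\<lambda>u. map (\<lambda>v. if (u, v) \<in> parcs (graph I) then 1 else 0) vs) vs))"

definition max_degree :: "'v pair_pre_digraph \<Rightarrow> nat" where
  "max_degree G = Max (insert 0 (out_degree (with_proj G) ` pverts G))"

definition mapfcc_parameter :: "('v, 'a) mapfcc \<Rightarrow> nat" where
  "mapfcc_parameter I = card (agents I) + max_degree (graph I) + comm_range I"

end

theory Submission
  imports Defs
begin

text \<open>
  A configuration in which the \<open>k\<close> agents are connected lies in a ball of bounded radius around the
  first agent, so in a graph of maximum degree \<open>\<Delta>\<close> with \<open>n\<close> vertices there are at most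
  \<open>n \<cdot> (\<Delta> + 1)^(k^3 d)\<close> of them, and each has at most \<open>2^(k \<Delta>)\<close> candidate successors.  Only the
  start configuration may be disconnected.  Breadth-first search over the configurations therefore runs
  in FPT time; the makespan bound, given in binary, costs nothing, as the search also stops once a
  round discovers no new configuration.  As every loop is iterated at most \<open>B\<close> times for one common
  \<open>B\<close>, the running time is a fixed polynomial in \<open>B\<close> that can be read off the program text.
\<close>

section \<open>A structured language on the RAM\<close>

text \<open>The theorem asks for one RAM program with a step count, so the search cannot stay an
  abstract algorithm. The obstacle is the machine: it has no multiplication, and the input sits in
  the low registers that a program needs for itself. Addresses are therefore obtained by repeated
  addition: matrix rows and queue entries have tabulated offsets, and eight arrays share the
  registers so that three doublings scale an index. The bound \<open>B\<close> never occurs in the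
  program; it lives only in the analysis. Hence nothing has to be fast: the queue is scanned
  linearly for duplicates, and each round expands old entries again, at the price of a polynomial in
  \<open>B\<close>. The exponent \<open>k^3 d\<close> is crude: a chain linking two agents is
  bounded by the number \<open>k * k\<close> of pairs, each link costs \<open>d\<close>, and there
  are \<open>k\<close> agents to place. With \<open>p\<close> the parameter this gives at most
  \<open>p ^ 5\<close> in base 2, and \<open>p ^ 5 + p ^ 2 \<le> 2 * 32 ^ p\<close>, a function that
  additions alone can compute.\<close>

datatype aexp = N nat | V nat | Plus aexp aexp | Minus aexp aexp | Hlf aexp | Idx nat aexp

text \<open>There are no Boolean expressions: a condition holds when its value is non-zero, and
  since subtraction is truncated, \<open>Minus a b\<close> tests \<open>b < a\<close>.\<close>

datatype com =
    Assign nat aexp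
  | Put nat aexp aexp
  | Seq com com
  | If aexp com com
  | While aexp com

record st =
  vr :: "nat \<Rightarrow> nat"
  ar :: "nat \<Rightarrow> nat \<Rightarrow> nat"

fun aval :: "aexp \<Rightarrow> st \<Rightarrow> nat" where
  "aval (N c) \<sigma> = c"
| "aval (V x) \<sigma> = vr \<sigma> x"
| "aval (Plus a b) \<sigma> = aval a \<sigma> + aval b \<sigma>"
| "aval (Minus a b) \<sigma> = aval a \<sigma> - aval b \<sigma>"
| "aval (Hlf a) \<sigma> = aval a \<sigma> div 2"
| "aval (Idx A a) \<sigma> = ar \<sigma> A (aval a \<sigma>)"

definition setv :: "nat \<Rightarrow> nat \<Rightarrow> st \<Rightarrow> st" where
  "setv x v \<sigma> = \<sigma>\<lparr>vr := (vr \<sigma>)(x := v)\<rparr>"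

definition seta :: "nat \<Rightarrow> nat \<Rightarrow> nat \<Rightarrow> st \<Rightarrow> st" where
  "seta A i v \<sigma> = \<sigma>\<lparr>ar := (ar \<sigma>)(A := (ar \<sigma> A)(i := v))\<rparr>"

lemma setv_sel [simp]:
  "vr (setv x v \<sigma>) = (vr \<sigma>)(x := v)" "ar (setv x v \<sigma>) = ar \<sigma>"
  by (simp_all add: setv_def)

lemma seta_sel [simp]:
  "ar (seta A i v \<sigma>) = (ar \<sigma>)(A := (ar \<sigma> A)(i := v))" "vr (seta A i v \<sigma>) = vr \<sigma>"
  by (simp_all add: seta_def)

text \<open>The registers from \<open>r\<close> upwards act as an evaluation stack: the value ends
  up in \<open>r\<close> and nothing below \<open>r\<close> is touched, so a second operand can be
  computed from \<open>Suc r\<close> on. The three doublings multiply the index by 8, the number of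
  interleaved arrays.\<close>

fun cexp :: "nat \<Rightarrow> aexp \<Rightarrow> instr list" where
  "cexp r (N c) = [Const r c]"
| "cexp r (V x) = [Copy r x]"
| "cexp r (Plus a b) = cexp r a @ cexp (Suc r) b @ [Add r r (Suc r)]"
| "cexp r (Minus a b) = cexp r a @ cexp (Suc r) b @ [Sub r r (Suc r)]"
| "cexp r (Hlf a) = cexp r a @ [Half r r]"
| "cexp r (Idx A a) = cexp r a @
     [Add r r r, Add r r r, Add r r r, Const (Suc r) (64 + A), Add r r (Suc r), Load r r]"

fun elen :: "aexp \<Rightarrow> nat" where
  "elen (N c) = 1"
| "elen (V x) = 1"
| "elen (Plus a b) = elen a + elen b + 1"
| "elen (Minus a b) = elen a + elen b + 1"
| "elen (Hlf a) = elen a + 1"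
| "elen (Idx A a) = elen a + 6"

text \<open>Nesting depth is limited because the evaluation stack must stay below 64, where the
  arrays begin; array access needs one extra scratch register.\<close>

fun wfe :: "nat \<Rightarrow> aexp \<Rightarrow> bool" where
  "wfe r (N c) \<longleftrightarrow> r < 64"
| "wfe r (V x) \<longleftrightarrow> r < 64 \<and> x < 48"
| "wfe r (Plus a b) \<longleftrightarrow> r < 64 \<and> wfe r a \<and> wfe (Suc r) b"
| "wfe r (Minus a b) \<longleftrightarrow> r < 64 \<and> wfe r a \<and> wfe (Suc r) b"
| "wfe r (Hlf a) \<longleftrightarrow> r < 64 \<and> wfe r a"
| "wfe r (Idx A a) \<longleftrightarrow> Suc r < 64 \<and> A < 8 \<and> wfe r a"

lemma length_cexp [simp]: "length (cexp r e) = elen e"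
  by (induction e arbitrary: r) auto

section \<open>Runs of jump-free code\<close>

definition eff :: "instr \<Rightarrow> (nat \<Rightarrow> nat) \<Rightarrow> (nat \<Rightarrow> nat)" where
  "eff i R = snd (ram_exec i (0, R))"

lemma eff_simps [simp]:
  "eff (Const i c) R = R(i := c)"
  "eff (Copy i j) R = R(i := R j)"
  "eff (Load i j) R = R(i := R (R j))"
  "eff (Store i j) R = R(R i := R j)"
  "eff (Add i j k) R = R(i := R j + R k)"
  "eff (Sub i j k) R = R(i := R j - R k)"
  "eff (Half i j) R = R(i := R j div 2)"
  by (simp_all add: eff_def)

fun straight :: "instr \<Rightarrow> bool" where
  "straight (Jump l) = False"
| "straight (JumpZero i l) = False"
| "straight _ = True"

lemma straight_cexp [simp]: "list_all straight (cexp r e)"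
  by (induction e arbitrary: r) auto

lemma ram_exec_straight: "straight i \<Longrightarrow> ram_exec i (pc, R) = (Suc pc, eff i R)"
  by (cases i) auto

definition code_at :: "instr list \<Rightarrow> nat \<Rightarrow> instr list \<Rightarrow> bool" where
  "code_at P pos is \<longleftrightarrow> (\<exists>A C. P = A @ is @ C \<and> length A = pos)"

lemma code_at_append:
  "code_at P pos (xs @ ys) \<Longrightarrow> code_at P pos xs \<and> code_at P (pos + length xs) ys"
  unfolding code_at_def by (metis append.assoc length_append)

lemma code_at_Cons:
  "code_at P pos (x # ys) \<Longrightarrow> pos < length P \<and> P ! pos = x \<and> code_at P (Suc pos) ys"
proof -
  assume a: "code_at P pos (x # ys)"
  then have "code_at P (Suc pos) ys"
    using code_at_append[of P pos "[x]" ys] by simp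
  moreover have "pos < length P \<and> P ! pos = x"
    using a by (auto simp: code_at_def nth_append)
  ultimately show ?thesis by simp
qed

lemma code_at_whole: "code_at (xs @ ys) (length xs) ys"
  unfolding code_at_def by (intro exI[of _ xs] exI[of _ "[]"]) simp

definition steps :: "instr list \<Rightarrow> nat \<Rightarrow> ram_config \<Rightarrow> ram_config \<Rightarrow> bool" where
  "steps P t c c' \<longleftrightarrow> (ram_step P ^^ t) c = c'"

lemma steps_0: "steps P 0 c c"
  by (simp add: steps_def)

lemma steps_trans: "steps P t c c' \<Longrightarrow> steps P t' c' c'' \<Longrightarrow> steps P (t + t') c c''"
  by (auto simp: steps_def funpow_add add.commute[of t])

lemma steps_1: "pc < length P \<Longrightarrow> steps P 1 (pc, R) (ram_exec (P ! pc) (pc, R))"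
  by (simp add: steps_def ram_step_def)

text \<open>Without jumps the program counter just advances, so a block acts on the registers as a
  \<open>fold\<close> of \<open>eff\<close> and can be evaluated by rewriting.\<close>

lemma steps_straight:
  "code_at P pos is \<Longrightarrow> list_all straight is \<Longrightarrow>
     steps P (length is) (pos, R) (pos + length is, fold eff is R)"
proof (induction "is" arbitrary: pos R)
  case Nil
  then show ?case by (simp add: steps_0)
next
  case (Cons i "is")
  from code_at_Cons[OF Cons.prems(1)]
  have *: "pos < length P" "P ! pos = i" "code_at P (Suc pos) is" by auto
  have "steps P 1 (pos, R) (Suc pos, eff i R)"
    using steps_1[OF *(1), of R] Cons.prems(2) by (simp add: *(2) ram_exec_straight)
  moreover have "steps P (length is) (Suc pos, eff i R) (Suc pos + length is, fold eff is (eff i R))"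
    using Cons.IH[OF *(3)] Cons.prems(2) by simp
  ultimately show ?case using steps_trans by fastforce
qed

text \<open>
  Variables are registers below 48, registers 48 to 63 hold temporaries, and the eight arrays are
  interleaved in the remaining registers, so that they never overlap.
\<close>

definition rel :: "st \<Rightarrow> (nat \<Rightarrow> nat) \<Rightarrow> bool" where
  "rel \<sigma> R \<longleftrightarrow> (\<forall>x < 48. R x = vr \<sigma> x) \<and> (\<forall>A < 8. \<forall>i. R (64 + 8 * i + A) = ar \<sigma> A i)"

lemma rel_cong:
  assumes "rel \<sigma> R" "\<And>x. x < 48 \<or> 64 \<le> x \<Longrightarrow> R' x = R x"
  shows "rel \<sigma> R'"
  using assms by (auto simp: rel_def)

text \<open>\<open>r\<close> and \<open>R\<close> vary in the induction, since the right operand is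
  compiled one register higher and runs on the registers left by the left one. Registers between
  \<open>r\<close> and 63 may hold garbage afterwards; for \<open>48 \<le> r\<close> the relation
  \<open>rel\<close> ignores them.\<close>

lemma cexp_correct:
  assumes "rel \<sigma> R" "48 \<le> r" "wfe r e"
  defines "R' \<equiv> fold eff (cexp r e) R"
  shows "R' r = aval e \<sigma> \<and> (\<forall>x. x < r \<or> 64 \<le> x \<longrightarrow> R' x = R x)"
  using assms(1-3) unfolding R'_def
proof (induction e arbitrary: r R)
  case (Plus a b)
  let ?R1 = "fold eff (cexp r a) R"
  have 1: "?R1 r = aval a \<sigma>" "\<And>x. x < r \<or> 64 \<le> x \<Longrightarrow> ?R1 x = R x"
    using Plus.IH(1)[of R r] Plus.prems by auto
  have "rel \<sigma> ?R1" using Plus.prems by (auto intro!: rel_cong[of \<sigma> R] 1(2))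
  then show ?case using Plus.IH(2)[of ?R1 "Suc r"] Plus.prems 1 by auto
next
  case (Minus a b)
  let ?R1 = "fold eff (cexp r a) R"
  have 1: "?R1 r = aval a \<sigma>" "\<And>x. x < r \<or> 64 \<le> x \<Longrightarrow> ?R1 x = R x"
    using Minus.IH(1)[of R r] Minus.prems by auto
  have "rel \<sigma> ?R1" using Minus.prems by (auto intro!: rel_cong[of \<sigma> R] 1(2))
  then show ?case using Minus.IH(2)[of ?R1 "Suc r"] Minus.prems 1 by auto
next
  case (Idx A a)
  let ?R1 = "fold eff (cexp r a) R"
  have 1: "?R1 r = aval a \<sigma>" "\<And>x. x < r \<or> 64 \<le> x \<Longrightarrow> ?R1 x = R x"
    using Idx.IH[of R r] Idx.prems by auto
  have e: "aval a \<sigma> + aval a \<sigma> + (aval a \<sigma> + aval a \<sigma>) +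
        (aval a \<sigma> + aval a \<sigma> + (aval a \<sigma> + aval a \<sigma>)) + (64 + A) = 64 + 8 * aval a \<sigma> + A"
    by simp
  have "?R1 (64 + 8 * aval a \<sigma> + A) = ar \<sigma> A (aval a \<sigma>)"
    using 1(2) Idx.prems by (auto simp: rel_def)
  then show ?case using 1 Idx.prems by (simp add: e)
qed (auto simp: rel_def)

section \<open>Compilation of commands\<close>

fun clen :: "com \<Rightarrow> nat" where
  "clen (Assign x e) = elen e + 1"
| "clen (Put A e1 e2) = elen e1 + elen e2 + 6"
| "clen (Seq c1 c2) = clen c1 + clen c2"
| "clen (If e c1 c2) = elen e + clen c1 + clen c2 + 2"
| "clen (While e c) = elen e + clen c + 2"

fun ccom :: "nat \<Rightarrow> com \<Rightarrow> instr list" where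
  "ccom pos (Assign x e) = cexp 48 e @ [Copy x 48]"
| "ccom pos (Put A e1 e2) =
     (cexp 48 e1 @ [Add 48 48 48, Add 48 48 48, Add 48 48 48, Const 49 (64 + A), Add 48 48 49]) @
     cexp 49 e2 @ [Store 48 49]"
| "ccom pos (Seq c1 c2) = ccom pos c1 @ ccom (pos + clen c1) c2"
| "ccom pos (If e c1 c2) =
     cexp 48 e @ [JumpZero 48 (pos + elen e + clen c1 + 2)] @ ccom (pos + elen e + 1) c1 @
     [Jump (pos + elen e + clen c1 + clen c2 + 2)] @ ccom (pos + elen e + clen c1 + 2) c2"
| "ccom pos (While e c) =
     cexp 48 e @ [JumpZero 48 (pos + elen e + clen c + 2)] @ ccom (pos + elen e + 1) c @ [Jump pos]"

fun wfc :: "com \<Rightarrow> bool" where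
  "wfc (Assign x e) \<longleftrightarrow> x < 48 \<and> wfe 48 e"
| "wfc (Put A e1 e2) \<longleftrightarrow> A < 8 \<and> wfe 48 e1 \<and> wfe 49 e2"
| "wfc (Seq c1 c2) \<longleftrightarrow> wfc c1 \<and> wfc c2"
| "wfc (If e c1 c2) \<longleftrightarrow> wfe 48 e \<and> wfc c1 \<and> wfc c2"
| "wfc (While e c) \<longleftrightarrow> wfe 48 e \<and> wfc c"

lemma length_ccom [simp]: "length (ccom pos c) = clen c"
  by (induction c arbitrary: pos) auto

text \<open>\<open>bs c \<sigma> t \<sigma>'\<close>: \<open>t\<close> is the exact number of machine steps of the compiled command.\<close>

inductive bs :: "com \<Rightarrow> st \<Rightarrow> nat \<Rightarrow> st \<Rightarrow> bool" where
  bsAssign: "bs (Assign x e) \<sigma> (elen e + 1) (setv x (aval e \<sigma>) \<sigma>)"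
| bsPut: "bs (Put A e1 e2) \<sigma> (elen e1 + elen e2 + 6) (seta A (aval e1 \<sigma>) (aval e2 \<sigma>) \<sigma>)"
| bsSeq: "bs c1 \<sigma> t1 \<sigma>1 \<Longrightarrow> bs c2 \<sigma>1 t2 \<sigma>2 \<Longrightarrow> bs (Seq c1 c2) \<sigma> (t1 + t2) \<sigma>2"
| bsIfT: "aval e \<sigma> \<noteq> 0 \<Longrightarrow> bs c1 \<sigma> t \<sigma>' \<Longrightarrow> bs (If e c1 c2) \<sigma> (elen e + 1 + (t + 1)) \<sigma>'"
| bsIfF: "aval e \<sigma> = 0 \<Longrightarrow> bs c2 \<sigma> t \<sigma>' \<Longrightarrow> bs (If e c1 c2) \<sigma> (elen e + 1 + t) \<sigma>'"
| bsWhileF: "aval e \<sigma> = 0 \<Longrightarrow> bs (While e c) \<sigma> (elen e + 1) \<sigma>"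
| bsWhileT: "aval e \<sigma> \<noteq> 0 \<Longrightarrow> bs c \<sigma> t \<sigma>1 \<Longrightarrow> bs (While e c) \<sigma>1 t' \<sigma>2 \<Longrightarrow>
    bs (While e c) \<sigma> (elen e + 1 + (t + 1) + t') \<sigma>2"

text \<open>The test is the common head of the code for \<open>If\<close> and \<open>While\<close>;
  the two variants that follow fix its outcome, so that the main induction sees no case
  distinction.\<close>

lemma cond_steps:
  assumes "rel \<sigma> R" "wfe 48 e" "code_at P pos (cexp 48 e @ [JumpZero 48 l] @ cs)"
  obtains R' where "rel \<sigma> R'"
    "steps P (elen e + 1) (pos, R) (if aval e \<sigma> = 0 then l else pos + elen e + 1, R')"
    "code_at P (pos + elen e + 1) cs"
proof -
  let ?R = "fold eff (cexp 48 e) R"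
  note ca = code_at_append[OF assms(3)]
  note cc = code_at_Cons[OF conjunct2[OF ca, simplified]]
  have 1: "steps P (elen e) (pos, R) (pos + elen e, ?R)"
    using steps_straight[OF conjunct1[OF ca]] by simp
  have 2: "?R 48 = aval e \<sigma>" "\<And>x. x < 48 \<or> 64 \<le> x \<Longrightarrow> ?R x = R x"
    using cexp_correct[OF assms(1) _ assms(2)] by auto
  have 3: "steps P 1 (pos + elen e, ?R) (if aval e \<sigma> = 0 then l else pos + elen e + 1, ?R)"
    using steps_1[of "pos + elen e" P ?R] cc 2 by (cases "aval e \<sigma> = 0") auto
  show thesis
    using that[OF rel_cong[OF assms(1) 2(2)] steps_trans[OF 1 3]] cc by simp
qed

lemma cond_stepsT:
  assumes "rel \<sigma> R" "wfe 48 e" "code_at P pos (cexp 48 e @ [JumpZero 48 l] @ cs)" "aval e \<sigma> \<noteq> 0"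
  obtains R' where "rel \<sigma> R'" "steps P (elen e + 1) (pos, R) (pos + elen e + 1, R')"
    "code_at P (pos + elen e + 1) cs"
  by (rule cond_steps[OF assms(1-3)], rule that) (simp_all only: assms(4) if_False)

lemma cond_stepsF:
  assumes "rel \<sigma> R" "wfe 48 e" "code_at P pos (cexp 48 e @ [JumpZero 48 l] @ cs)" "aval e \<sigma> = 0"
  obtains R' where "rel \<sigma> R'" "steps P (elen e + 1) (pos, R) (l, R')"
    "code_at P (pos + elen e + 1) cs"
  by (rule cond_steps[OF assms(1-3)], rule that) (simp_all only: assms(4) if_True simp_thms)

lemma jump_steps:
  assumes "code_at P pos (Jump l # cs)"
  shows "steps P 1 (pos, R) (l, R)"
  using code_at_Cons[OF assms] steps_1[of pos P R] by simp

text \<open>Forward simulation by induction on the run, not on the command: the rest of a loop is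
  again a run of the whole loop, compiled at the same position but started with other registers.
  Hence \<open>R\<close> and \<open>pos\<close> are arbitrary.\<close>

theorem ccom_correct:
  assumes "bs c \<sigma> t \<sigma>'" "wfc c" "rel \<sigma> R" "code_at P pos (ccom pos c)"
  shows "\<exists>R'. rel \<sigma>' R' \<and> steps P t (pos, R) (pos + clen c, R')"
  using assms
proof (induction arbitrary: R pos rule: bs.induct)
  case (bsAssign x e \<sigma>)
  let ?R = "fold eff (cexp 48 e) R"
  have 2: "?R 48 = aval e \<sigma>" "\<And>x. x < 48 \<or> 64 \<le> x \<Longrightarrow> ?R x = R x"
    using cexp_correct[OF bsAssign.prems(2)] bsAssign.prems(1) by auto
  have "steps P (elen e + 1) (pos, R) (pos + elen e + 1, ?R(x := ?R 48))"
    using steps_straight[OF bsAssign.prems(3)] by simp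
  moreover have "rel (setv x (aval e \<sigma>) \<sigma>) (?R(x := ?R 48))"
    using bsAssign.prems(1,2) 2 by (auto simp: rel_def)
  ultimately show ?case by auto
next
  case (bsPut A e1 e2 \<sigma>)
  let ?ad = "64 + 8 * aval e1 \<sigma> + A"
  let ?R1 = "fold eff (cexp 48 e1) R"
  have 1: "?R1 48 = aval e1 \<sigma>" "\<And>x. x < 48 \<or> 64 \<le> x \<Longrightarrow> ?R1 x = R x"
    using cexp_correct[OF bsPut.prems(2), of 48 e1] bsPut.prems(1) by auto
  define R2 where "R2 = fold eff [Add 48 48 48, Add 48 48 48, Add 48 48 48, Const 49 (64 + A), Add 48 48 49] ?R1"
  have 2: "R2 48 = ?ad" "\<And>x. x < 48 \<or> 64 \<le> x \<Longrightarrow> R2 x = R x"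
    using 1 by (auto simp: R2_def)
  let ?R3 = "fold eff (cexp 49 e2) R2"
  have r2: "rel \<sigma> R2" using rel_cong[OF bsPut.prems(2)] 2 by blast
  have 3: "?R3 49 = aval e2 \<sigma>" "?R3 48 = ?ad" "\<And>x. x < 48 \<or> 64 \<le> x \<Longrightarrow> ?R3 x = R x"
    using cexp_correct[OF r2, of 49 e2] bsPut.prems(1) 2 by auto
  have "fold eff (ccom pos (Put A e1 e2)) R = ?R3(?ad := aval e2 \<sigma>)"
    using 3 by (simp add: R2_def)
  then have "steps P (elen e1 + elen e2 + 6) (pos, R) (pos + (elen e1 + elen e2 + 6), ?R3(?ad := aval e2 \<sigma>))"
    using steps_straight[OF bsPut.prems(3), of R] unfolding length_ccom clen.simps by simp
  moreover have "rel (seta A (aval e1 \<sigma>) (aval e2 \<sigma>) \<sigma>) (?R3(?ad := aval e2 \<sigma>))"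
    unfolding rel_def
  proof (intro conjI allI impI)
    fix B i assume B: "B < (8::nat)"
    have A: "A < 8" using bsPut.prems by simp
    \<comment> \<open>Remainder and quotient by 8 recover the array and the index from an
      address.\<close>
    have "64 + 8 * i + B = ?ad \<longleftrightarrow> B = A \<and> i = aval e1 \<sigma>" using A B by presburger
    then show "(?R3(?ad := aval e2 \<sigma>)) (64 + 8 * i + B) = ar (seta A (aval e1 \<sigma>) (aval e2 \<sigma>) \<sigma>) B i"
      using 3(3) bsPut.prems(2) B by (auto simp: rel_def)
  qed (use 3(3) bsPut.prems(2) in \<open>auto simp: rel_def\<close>)
  ultimately show ?case by auto
next
  case (bsSeq c1 \<sigma> t1 \<sigma>1 c2 t2 \<sigma>2)
  have ca: "code_at P pos (ccom pos c1)" "code_at P (pos + clen c1) (ccom (pos + clen c1) c2)"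
    using code_at_append[of P pos "ccom pos c1"] bsSeq.prems(3) by auto
  obtain R1 where R1: "rel \<sigma>1 R1" "steps P t1 (pos, R) (pos + clen c1, R1)"
    using bsSeq.IH(1)[OF _ bsSeq.prems(2) ca(1)] bsSeq.prems(1) by auto
  obtain R2 where R2: "rel \<sigma>2 R2" "steps P t2 (pos + clen c1, R1) (pos + clen c1 + clen c2, R2)"
    using bsSeq.IH(2)[OF _ R1(1) ca(2)] bsSeq.prems(1) by auto
  show ?case using R2(1) steps_trans[OF R1(2) R2(2)] by (auto simp: add.assoc)
next
  case (bsIfT e \<sigma> c1 t \<sigma>' c2)
  have w: "wfe 48 e" using bsIfT.prems(1) by simp
  obtain R1 where R1: "rel \<sigma> R1" "steps P (elen e + 1) (pos, R) (pos + elen e + 1, R1)"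
    "code_at P (pos + elen e + 1) (ccom (pos + elen e + 1) c1 @
     [Jump (pos + elen e + clen c1 + clen c2 + 2)] @ ccom (pos + elen e + clen c1 + 2) c2)"
    by (rule cond_stepsT[OF bsIfT.prems(2) w bsIfT.prems(3)[unfolded ccom.simps] bsIfT.hyps(1)])
  note ca = code_at_append[OF R1(3)]
  obtain R2 where R2: "rel \<sigma>' R2" "steps P t (pos + elen e + 1, R1) (pos + elen e + 1 + clen c1, R2)"
    using bsIfT.IH[OF _ R1(1) conjunct1[OF ca]] bsIfT.prems(1) by auto
  have "steps P 1 (pos + elen e + 1 + clen c1, R2) (pos + elen e + clen c1 + clen c2 + 2, R2)"
    using jump_steps conjunct2[OF ca] by simp
  from steps_trans[OF R1(2) steps_trans[OF R2(2) this]] R2(1) show ?case by (auto simp: algebra_simps)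
next
  case (bsIfF e \<sigma> c2 t \<sigma>' c1)
  have w: "wfe 48 e" using bsIfF.prems(1) by simp
  obtain R1 where R1: "rel \<sigma> R1" "steps P (elen e + 1) (pos, R) (pos + elen e + clen c1 + 2, R1)"
    "code_at P (pos + elen e + 1) (ccom (pos + elen e + 1) c1 @
     [Jump (pos + elen e + clen c1 + clen c2 + 2)] @ ccom (pos + elen e + clen c1 + 2) c2)"
    by (rule cond_stepsF[OF bsIfF.prems(2) w bsIfF.prems(3)[unfolded ccom.simps] bsIfF.hyps(1)])
  have ca: "code_at P (pos + elen e + clen c1 + 2) (ccom (pos + elen e + clen c1 + 2) c2)"
    using code_at_append[OF conjunct2[OF code_at_append[OF R1(3)]]] by (simp add: algebra_simps)
  obtain R2 where R2: "rel \<sigma>' R2" "steps P t (pos + elen e + clen c1 + 2, R1) (pos + elen e + clen c1 + 2 + clen c2, R2)"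
    using bsIfF.IH[OF _ R1(1) ca] bsIfF.prems(1) by auto
  from steps_trans[OF R1(2) R2(2)] R2(1) show ?case by (auto simp: algebra_simps)
next
  case (bsWhileF e \<sigma> c)
  have w: "wfe 48 e" using bsWhileF.prems(1) by simp
  obtain R1 where R1: "rel \<sigma> R1" "steps P (elen e + 1) (pos, R) (pos + elen e + clen c + 2, R1)"
    by (rule cond_stepsF[OF bsWhileF.prems(2) w bsWhileF.prems(3)[unfolded ccom.simps] bsWhileF.hyps(1)])
  then show ?case by (auto simp: algebra_simps)
next
  case (bsWhileT e \<sigma> c t \<sigma>1 t' \<sigma>2)
  have w: "wfe 48 e" using bsWhileT.prems(1) by simp
  obtain R1 where R1: "rel \<sigma> R1" "steps P (elen e + 1) (pos, R) (pos + elen e + 1, R1)"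
    "code_at P (pos + elen e + 1) (ccom (pos + elen e + 1) c @ [Jump pos])"
    by (rule cond_stepsT[OF bsWhileT.prems(2) w bsWhileT.prems(3)[unfolded ccom.simps] bsWhileT.hyps(1)])
  note ca = code_at_append[OF R1(3)]
  obtain R2 where R2: "rel \<sigma>1 R2" "steps P t (pos + elen e + 1, R1) (pos + elen e + 1 + clen c, R2)"
    using bsWhileT.IH(1)[OF _ R1(1) conjunct1[OF ca]] bsWhileT.prems(1) by auto
  have 3: "steps P 1 (pos + elen e + 1 + clen c, R2) (pos, R2)"
    using jump_steps conjunct2[OF ca] by simp
  obtain R3 where R3: "rel \<sigma>2 R3" "steps P t' (pos, R2) (pos + clen (While e c), R3)"
    using bsWhileT.IH(2)[OF _ R2(1)] bsWhileT.prems by auto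
  from steps_trans[OF steps_trans[OF R1(2) steps_trans[OF R2(2) 3]] R3(2)] R3(1)
  show ?case by (auto simp: algebra_simps)
qed


section \<open>Loading the input and reasoning about running times\<close>

lemma steps_straight':
  assumes "code_at P pos is" "list_all straight is" "length is = m" "fold eff is R = R'" "pos + m = pos'"
  shows "steps P m (pos, R) (pos', R')"
  using steps_straight[OF assms(1,2), of R] assms(3-5) by simp

text \<open>The input occupies registers 1 upwards and must move to 64, 72, 80, ..., while the mover
  itself needs registers 0 to 5. With \<open>n\<close> words, the contents of registers 1 to 5 are
  first parked at \<open>128 * n\<close> to \<open>128 * n + 4\<close>, beyond every source and
  target. The other words are copied from the last one downwards, so that the target
  \<open>8 * p + 56 > p\<close> of register \<open>p\<close> hits no word still to be read. The
  parked words come back at the end.\<close>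

definition prelude :: "instr list" where
  "prelude =
     [Add 0 0 0, Add 0 0 0, Add 0 0 0, Add 0 0 0, Add 0 0 0, Add 0 0 0, Add 0 0 0] @
     [Store 0 1, Const 1 1, Add 0 0 1, Store 0 2, Add 0 0 1, Store 0 3, Add 0 0 1, Store 0 4,
      Add 0 0 1, Store 0 5, Copy 2 0] @ [Half 2 2, Half 2 2, Half 2 2, Half 2 2, Half 2 2, Half 2 2, Half 2 2] @
     [Const 3 5, Sub 3 2 3] @ [JumpZero 3 37] @
     [Load 4 2, Add 5 2 2, Add 5 5 5, Add 5 5 5, Const 3 56, Add 5 5 3, Store 5 4, Sub 2 2 1] @
     [Jump 25] @
     [Load 96 0, Sub 0 0 1, Load 88 0, Sub 0 0 1, Load 80 0, Sub 0 0 1, Load 72 0, Sub 0 0 1, Load 64 0]"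

lemma length_prelude: "length prelude = 46"
  by (simp add: prelude_def)

text \<open>The three quantified clauses describe the parked words, those already moved and those
  still waiting in place.\<close>

definition pre_inv :: "nat list \<Rightarrow> nat \<Rightarrow> (nat \<Rightarrow> nat) \<Rightarrow> bool" where
  "pre_inv xs p R \<longleftrightarrow> p \<le> length xs \<and> R 0 = 128 * length xs + 4 \<and> R 1 = 1 \<and> R 2 = p \<and>
     (\<forall>j < 5. j < length xs \<longrightarrow> R (128 * length xs + j) = xs ! j) \<and>
     (\<forall>i. p \<le> i \<and> 5 \<le> i \<and> i < length xs \<longrightarrow> R (64 + 8 * i) = xs ! i) \<and>
     (\<forall>q. 6 \<le> q \<and> q \<le> p \<longrightarrow> R q = xs ! (q - 1))"

text \<open>The positions are the offsets of the blocks in \<open>prelude\<close>. A pass takes 2 +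
  1 + 8 + 1 steps, the final test 3; the exit comes once \<open>p \<le> 5\<close>, as the first five
  words are parked.\<close>

lemma prelude_loop:
  assumes c1: "code_at P 25 [Const 3 5, Sub 3 2 3]" and c2: "code_at P 27 [JumpZero 3 37]"
    and c3: "code_at P 28 [Load 4 2, Add 5 2 2, Add 5 5 5, Add 5 5 5, Const 3 56, Add 5 5 3, Store 5 4, Sub 2 2 1]"
    and c4: "code_at P 36 [Jump 25]"
    and "pre_inv xs p R"
  shows "\<exists>R' t p'. t \<le> 12 * p + 3 \<and> p' \<le> 5 \<and> pre_inv xs p' R' \<and> steps P t (25, R) (37, R')"
  using assms(5)
proof (induction p arbitrary: R)
  case 0
  have s1: "steps P 2 (25, R) (27, R(3 := 0))"
    by (rule steps_straight'[OF c1]) (use 0 in \<open>simp_all add: pre_inv_def\<close>)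
  have s2: "steps P 1 (27, R(3 := 0)) (37, R(3 := 0))"
    using steps_1[of 27 P "R(3 := 0)"] code_at_Cons[OF c2] by simp
  have "steps P (2 + 1) (25, R) (37, R(3 := 0))" by (rule steps_trans[OF s1 s2])
  moreover have "pre_inv xs 0 (R(3 := 0))" using 0 by (auto simp: pre_inv_def)
  ultimately show ?case
    by - (rule exI[of _ "R(3 := 0)"], rule exI[of _ "2 + 1"], rule exI[of _ 0], simp add: fun_upd_def)
next
  case (Suc p)
  let ?R1 = "R(3 := Suc p - 5)"
  have s1: "steps P 2 (25, R) (27, ?R1)"
    by (rule steps_straight'[OF c1]) (use Suc.prems in \<open>simp_all add: pre_inv_def\<close>)
  have s2: "steps P 1 (27, ?R1) (if Suc p \<le> 5 then 37 else 28, ?R1)"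
    using steps_1[of 27 P ?R1] code_at_Cons[OF c2] by (cases "p \<le> 4") simp_all
  show ?case
  proof (cases "Suc p \<le> 5")
    case True
    have "steps P (2 + 1) (25, R) (37, ?R1)" using steps_trans[OF s1 s2] True by simp
    moreover have "pre_inv xs (Suc p) ?R1" using Suc.prems by (auto simp: pre_inv_def)
    ultimately show ?thesis
      using True by - (rule exI[of _ ?R1], rule exI[of _ "2 + 1"], rule exI[of _ "Suc p"], simp add: fun_upd_def)
  next
    case False
    define R2 where "R2 = ?R1(4 := R (Suc p), 5 := 8 * Suc p + 56, 3 := 56, 8 * Suc p + 56 := R (Suc p), 2 := p)"
    have "R 2 = Suc p" "R (Suc 0) = 1" using Suc.prems by (auto simp: pre_inv_def)
    then have "fold eff [Load 4 2, Add 5 2 2, Add 5 5 5, Add 5 5 5, Const 3 56, Add 5 5 3, Store 5 4, Sub 2 2 1] ?R1 = R2"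
      using False by (auto simp: R2_def fun_eq_iff)
    then have s3: "steps P 8 (28, ?R1) (36, R2)"
    by (intro steps_straight'[OF c3]) simp_all
    have s4: "steps P 1 (36, R2) (25, R2)" by (rule jump_steps[OF c4])
    have s: "steps P (2 + 1 + 8 + 1) (25, R) (25, R2)"
      using steps_trans[OF steps_trans[OF steps_trans[OF s1 s2] _] s4, of 8] s3 False by simp
    have "pre_inv xs p R2"
      unfolding pre_inv_def
    proof (intro conjI allI impI)
      fix i assume i: "p \<le> i \<and> 5 \<le> i \<and> i < length xs"
      show "R2 (64 + 8 * i) = xs ! i"
      proof (cases "i = p")
        case True
        then show ?thesis using False Suc.prems by (auto simp: R2_def pre_inv_def)
      next
        case F: False
        then have "R2 (64 + 8 * i) = R (64 + 8 * i)" using i by (auto simp: R2_def)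
        then show ?thesis using i F Suc.prems by (auto simp: pre_inv_def)
      qed
    next
      fix j :: nat assume "j < 5" "j < length xs"
      then show "R2 (128 * length xs + j) = xs ! j"
        using Suc.prems by (auto simp: R2_def pre_inv_def)
    qed (use Suc.prems False in \<open>auto simp: R2_def pre_inv_def\<close>)
    from Suc.IH[OF this] obtain R' t p' where
      "t \<le> 12 * p + 3" "p' \<le> 5" "pre_inv xs p' R'" "steps P t (25, R2) (37, R')" by blast
    with steps_trans[OF s this(4)] show ?thesis
      by - (rule exI[of _ R'], rule exI[of _ "2 + 1 + 8 + 1 + t"], rule exI[of _ p'], simp)
  qed
qed

text \<open>By \<open>128 \<le> M\<close> the parked words lie above the targets 64 to 96, so no
  restored word overwrites a parked one that is still to be read.\<close>

lemma restore_correct: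
  assumes "R 0 = M + 4" "R (Suc 0) = 1" "128 \<le> M"
  shows "fold eff [Load 96 0, Sub 0 0 1, Load 88 0, Sub 0 0 1, Load 80 0, Sub 0 0 1, Load 72 0,
      Sub 0 0 1, Load 64 0] R =
    R(96 := R (M + 4), 88 := R (M + 3), 80 := R (M + 2), 72 := R (M + 1), 64 := R M, 0 := M)"
proof -
  have ne: "M + 3 \<noteq> 96" "M + 2 \<noteq> 96" "M + 1 \<noteq> 96" "M \<noteq> 96" "M + 2 \<noteq> 88" "M + 1 \<noteq> 88" "M \<noteq> 88"
    "M + 1 \<noteq> 80" "M \<noteq> 80" "M \<noteq> 72" "M + 3 \<noteq> 0" "M + 2 \<noteq> 0" "M + 1 \<noteq> 0" "M \<noteq> 0"
    using assms(3) by simp_all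
  have d: "M + 4 - 1 = M + 3" "M + 3 - 1 = M + 2" "M + 2 - 1 = M + 1" "M + 1 - 1 = M" by simp_all
  define R1 where "R1 = R(96 := R (M + 4), 0 := M + 3)"
  define R2 where "R2 = R1(88 := R (M + 3), 0 := M + 2)"
  define R3 where "R3 = R2(80 := R (M + 2), 0 := M + 1)"
  define R4 where "R4 = R3(72 := R (M + 1), 0 := M)"
  have "fold eff [Load 96 0, Sub 0 0 1] R = R1"
    unfolding R1_def using assms by (simp add: fun_eq_iff)
  moreover have "fold eff [Load 88 0, Sub 0 0 1] R1 = R2"
    unfolding R2_def using assms ne by (simp add: fun_eq_iff R1_def)
  moreover have "fold eff [Load 80 0, Sub 0 0 1] R2 = R3"
    unfolding R3_def using assms ne by (simp add: fun_eq_iff R1_def R2_def)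
  moreover have "fold eff [Load 72 0, Sub 0 0 1] R3 = R4"
    unfolding R4_def using assms ne by (simp add: fun_eq_iff R1_def R2_def R3_def)
  moreover have "fold eff [Load 64 0] R4 =
      R(96 := R (M + 4), 88 := R (M + 3), 80 := R (M + 2), 72 := R (M + 1), 64 := R M, 0 := M)"
    using assms ne by (simp add: fun_eq_iff R1_def R2_def R3_def R4_def)
  ultimately show ?thesis by simp
qed

lemma prelude_correct:
  assumes "xs \<noteq> []"
  shows "\<exists>t R. t \<le> 12 * length xs + 40 \<and> steps (prelude @ ys) t (ram_init xs) (46, R) \<and>
    (\<forall>i < length xs. R (64 + 8 * i) = xs ! i)"
proof -
  let ?P = "prelude @ ys"
  define A where "A = [Add 0 0 0, Add 0 0 0, Add 0 0 0, Add 0 0 0, Add 0 0 0, Add 0 0 0, Add 0 0 0] @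
     [Store 0 1, Const 1 1, Add 0 0 1, Store 0 2, Add 0 0 1, Store 0 3, Add 0 0 1, Store 0 4,
      Add 0 0 1, Store 0 5, Copy 2 0] @ [Half 2 2, Half 2 2, Half 2 2, Half 2 2, Half 2 2, Half 2 2, Half 2 2]"
  define L1 where "L1 = [Const 3 5, Sub 3 2 3]"
  define L2 where "L2 = [JumpZero 3 37]"
  define L3 where "L3 = [Load 4 2, Add 5 2 2, Add 5 5 5, Add 5 5 5, Const 3 56, Add 5 5 3, Store 5 4, Sub 2 2 1]"
  define L4 where "L4 = [Jump 25]"
  define C where "C = [Load 96 0, Sub 0 0 1, Load 88 0, Sub 0 0 1, Load 80 0, Sub 0 0 1, Load 72 0, Sub 0 0 1, Load 64 0]"
  have P: "?P = A @ L1 @ L2 @ L3 @ L4 @ C @ ys"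
    by (simp add: prelude_def A_def L1_def L2_def L3_def L4_def C_def)
  have l: "length A = 25" "length L1 = 2" "length L2 = 1" "length L3 = 8" "length L4 = 1" "length C = 9"
    by (simp_all add: A_def L1_def L2_def L3_def L4_def C_def)
  have ca: "code_at ?P 0 A" "code_at ?P 25 L1" "code_at ?P 27 L2" "code_at ?P 28 L3" "code_at ?P 36 L4"
    "code_at ?P 37 C"
  proof -
    have "code_at ?P 0 (A @ L1 @ L2 @ L3 @ L4 @ C @ ys)"
      unfolding P using code_at_whole[of "[]"] by simp
    note 1 = code_at_append[OF this]
    note 2 = code_at_append[OF conjunct2[OF 1]]
    note 3 = code_at_append[OF conjunct2[OF 2]]
    note 4 = code_at_append[OF conjunct2[OF 3]]
    note 5 = code_at_append[OF conjunct2[OF 4]]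
    note 6 = code_at_append[OF conjunct2[OF 5]]
    show "code_at ?P 0 A" "code_at ?P 25 L1" "code_at ?P 27 L2" "code_at ?P 28 L3" "code_at ?P 36 L4"
      "code_at ?P 37 C"
      using 1 2 3 4 5 6 by (simp_all add: l)
  qed
  obtain R0 where R0: "ram_init xs = (0, R0)" "R0 = (\<lambda>r. if r = 0 then length xs else if r \<le> length xs then xs ! (r - 1) else 0)"
    by (simp add: ram_init_def)
  let ?n = "length xs"
  have n: "0 < ?n" using assms by simp
  define R1 where "R1 = R0(128 * ?n := R0 1, 128 * ?n + 1 := R0 2, 128 * ?n + 2 := R0 3,
      128 * ?n + 3 := R0 4, 128 * ?n + 4 := R0 5, 0 := 128 * ?n + 4, 1 := 1, 2 := ?n)"
  have R00: "R0 0 = ?n" by (simp add: R0(2))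
  have e1: "fold eff [Add 0 0 0, Add 0 0 0, Add 0 0 0, Add 0 0 0, Add 0 0 0, Add 0 0 0, Add 0 0 0] R0 = R0(0 := 128 * ?n)"
    using R00 by (auto simp: fun_eq_iff)
  have ne: "128 * ?n \<noteq> 3" "128 * ?n \<noteq> 5" by presburger+
  let ?S = "[Store 0 1, Const 1 1, Add 0 0 1, Store 0 2, Add 0 0 1, Store 0 3, Add 0 0 1, Store 0 4,
      Add 0 0 1, Store 0 5, Copy 2 0]"
  have e2: "fold eff ?S (R0(0 := 128 * ?n)) = R1(2 := 128 * ?n + 4)"
    using n ne by (auto simp: fun_eq_iff R1_def)
  \<comment> \<open>Seven halvings undo the factor 128; the offset 4 of the last parked address
    vanishes on the way.\<close>
  have "(128 * ?n + 4) div 2 = 64 * ?n + 2" "(64 * ?n + 2) div 2 = 32 * ?n + 1"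
    "(32 * ?n + 1) div 2 = 16 * ?n" "16 * ?n div 2 = 8 * ?n" "8 * ?n div 2 = 4 * ?n"
    "4 * ?n div 2 = 2 * ?n" "2 * ?n div 2 = ?n"
    by presburger+
  note h = this
  have e3: "fold eff [Half 2 2, Half 2 2, Half 2 2, Half 2 2, Half 2 2, Half 2 2, Half 2 2] (R1(2 := 128 * ?n + 4)) = R1"
    by (rule ext) (simp add: R1_def h)
  have sA: "list_all straight A" and sC: "list_all straight C" by (simp_all add: A_def C_def)
  have fA: "fold eff A R0 = R1"
    unfolding A_def fold_append comp_def e1 e2 e3 ..
  have s1: "steps ?P 25 (0, R0) (25, R1)"
    by (rule steps_straight'[OF ca(1) sA l(1) fA]) simp
  have "pre_inv xs ?n R1"
    unfolding pre_inv_def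
  proof (intro conjI allI impI)
    fix j :: nat assume j: "j < 5" "j < ?n"
    then consider "j = 0" | "j = 1" | "j = 2" | "j = 3" | "j = 4" by linarith
    then show "R1 (128 * ?n + j) = xs ! j"
      by cases (use j n in \<open>auto simp: R1_def R0(2) Suc_le_eq\<close>)
  next
    fix q assume q: "6 \<le> q \<and> q \<le> ?n"
    with n have "q \<noteq> 128 * ?n" "q \<noteq> 128 * ?n + 1" "q \<noteq> 128 * ?n + 2" "q \<noteq> 128 * ?n + 3"
      "q \<noteq> 128 * ?n + 4" "q \<noteq> 0" "q \<noteq> 1" "q \<noteq> 2" by linarith+
    then have "R1 q = R0 q" by (simp add: R1_def)
    then show "R1 q = xs ! (q - 1)" using q by (simp add: R0(2))
  qed (auto simp: R1_def)
  from prelude_loop[OF ca(2-5)[unfolded L1_def L2_def L3_def L4_def] this]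
  obtain R2 t p where 2: "t \<le> 12 * ?n + 3" "p \<le> 5" "pre_inv xs p R2" "steps ?P t (25, R1) (37, R2)"
    by blast
  define R3 where "R3 = R2(96 := R2 (128 * ?n + 4), 88 := R2 (128 * ?n + 3), 80 := R2 (128 * ?n + 2),
     72 := R2 (128 * ?n + 1), 64 := R2 (128 * ?n), 0 := 128 * ?n)"
  have "R2 0 = 128 * ?n + 4" "R2 1 = 1" using 2(3) by (auto simp: pre_inv_def)
  then have fC: "fold eff C R2 = R3"
    unfolding C_def R3_def by (intro restore_correct) (use n in \<open>simp_all add: Suc_le_eq\<close>)
  have s3: "steps ?P 9 (37, R2) (46, R3)"
    by (rule steps_straight'[OF ca(6) sC l(6) fC]) simp
  have "\<forall>i < ?n. R3 (64 + 8 * i) = xs ! i"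
  proof (intro allI impI)
    fix i assume i: "i < ?n"
    show "R3 (64 + 8 * i) = xs ! i"
    proof (cases "i < 5")
      case True
      have s: "R2 (128 * ?n + j) = xs ! j" if "j < 5" "j < ?n" for j
        using 2(3) that by (simp add: pre_inv_def)
      from True consider "i = 0" | "i = 1" | "i = 2" | "i = 3" | "i = 4" by linarith
      then show ?thesis
        by cases (use i s[of 0] s[of 1] s[of 2] s[of 3] s[of 4] in \<open>simp_all add: R3_def\<close>)
    next
      case False
      then have "R3 (64 + 8 * i) = R2 (64 + 8 * i)" by (simp add: R3_def)
      moreover have "\<forall>i. p \<le> i \<and> 5 \<le> i \<and> i < ?n \<longrightarrow> R2 (64 + 8 * i) = xs ! i"
        using 2(3) by (simp add: pre_inv_def)
      ultimately show ?thesis using i 2(2) False by simp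
    qed
  qed
  \<comment> \<open>25 steps of set-up, at most 12 per word and 3 more in the loop, 9 to restore;
    the constant 40 rounds this up.\<close>
  moreover have "steps ?P (25 + t + 9) (ram_init xs) (46, R3)"
    unfolding R0(1) by (intro steps_trans[OF _ s3] steps_trans[OF s1] 2)
  ultimately show ?thesis using 2(1) by (intro exI[of _ "25 + t + 9"] exI[of _ R3]) simp
qed

section \<open>Frame conditions and time bounds\<close>

fun mv :: "com \<Rightarrow> nat set" where
  "mv (Assign x e) = {x}"
| "mv (Put A e1 e2) = {}"
| "mv (Seq c1 c2) = mv c1 \<union> mv c2"
| "mv (If e c1 c2) = mv c1 \<union> mv c2"
| "mv (While e c) = mv c"

fun ma :: "com \<Rightarrow> nat set" where
  "ma (Assign x e) = {}"
| "ma (Put A e1 e2) = {A}"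
| "ma (Seq c1 c2) = ma c1 \<union> ma c2"
| "ma (If e c1 c2) = ma c1 \<union> ma c2"
| "ma (While e c) = ma c"

definition frame :: "nat set \<Rightarrow> nat set \<Rightarrow> st \<Rightarrow> st \<Rightarrow> bool" where
  "frame X Y \<sigma> \<tau> \<longleftrightarrow> (\<forall>x. x \<notin> X \<longrightarrow> vr \<tau> x = vr \<sigma> x) \<and> (\<forall>A. A \<notin> Y \<longrightarrow> ar \<tau> A = ar \<sigma> A)"

lemma frame_trans:
  "frame X Y \<sigma> \<tau> \<Longrightarrow> frame X' Y' \<tau> \<upsilon> \<Longrightarrow> X \<subseteq> Z \<Longrightarrow> X' \<subseteq> Z \<Longrightarrow> Y \<subseteq> W \<Longrightarrow> Y' \<subseteq> W \<Longrightarrow> frame Z W \<sigma> \<upsilon>"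
  unfolding frame_def by (metis subsetD)

text \<open>What a command may write is read off its text, so that later loop invariants need only
  mention what changes.\<close>

lemma bs_frame: "bs c \<sigma> t \<tau> \<Longrightarrow> frame (mv c) (ma c) \<sigma> \<tau>"
proof (induction rule: bs.induct)
  case bsSeq
  then show ?case by (auto intro: frame_trans)
next
  case bsWhileT
  then show ?case by (auto intro: frame_trans)
qed (auto simp: frame_def)

text \<open>\<open>tb B c\<close> bounds the running time of \<open>c\<close> if no loop is iterated more than \<open>B\<close> times.\<close>

fun tb :: "nat \<Rightarrow> com \<Rightarrow> nat" where
  "tb B (Assign x e) = elen e + 1"
| "tb B (Put A e1 e2) = elen e1 + elen e2 + 6"
| "tb B (Seq c1 c2) = tb B c1 + tb B c2"
| "tb B (If e c1 c2) = elen e + 2 + tb B c1 + tb B c2"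
| "tb B (While e c) = elen e + 1 + B * (elen e + 2 + tb B c)"

text \<open>Each loop contributes one factor \<open>B + 1\<close>, and exponents of parts are simply
  added, as any polynomial will do. \<open>C\<close> and \<open>D\<close> depend on the program text
  only, so they can be fixed before the instance is known.\<close>

lemma tb_poly: "\<exists>C D. \<forall>B. tb B c \<le> C * (B + 1) ^ D"
proof (induction c)
  case (Assign x e)
  show ?case by (rule exI[of _ "elen e + 1"], rule exI[of _ 0]) simp
next
  case (Put A e1 e2)
  show ?case by (rule exI[of _ "elen e1 + elen e2 + 6"], rule exI[of _ 0]) simp
next
  case (Seq c1 c2)
  then obtain C1 D1 C2 D2 where
    *: "\<And>B. tb B c1 \<le> C1 * (B + 1) ^ D1" "\<And>B. tb B c2 \<le> C2 * (B + 1) ^ D2" by blast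
  have "tb B (Seq c1 c2) \<le> (C1 + C2) * (B + 1) ^ (D1 + D2)" for B
  proof -
    have "C1 * (B + 1) ^ D1 \<le> C1 * (B + 1) ^ (D1 + D2)" "C2 * (B + 1) ^ D2 \<le> C2 * (B + 1) ^ (D1 + D2)"
      by (intro mult_left_mono power_increasing; simp)+
    then show ?thesis using *(1)[of B] *(2)[of B] unfolding tb.simps distrib_right by linarith
  qed
  then show ?case by blast
next
  case (If e c1 c2)
  then obtain C1 D1 C2 D2 where
    *: "\<And>B. tb B c1 \<le> C1 * (B + 1) ^ D1" "\<And>B. tb B c2 \<le> C2 * (B + 1) ^ D2" by blast
  have "tb B (If e c1 c2) \<le> (elen e + 2 + C1 + C2) * (B + 1) ^ (D1 + D2)" for B
  proof -
    have "C1 * (B + 1) ^ D1 \<le> C1 * (B + 1) ^ (D1 + D2)" "C2 * (B + 1) ^ D2 \<le> C2 * (B + 1) ^ (D1 + D2)"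
      "(elen e + 2) * 1 \<le> (elen e + 2) * (B + 1) ^ (D1 + D2)"
      by (intro mult_left_mono power_increasing one_le_power; simp)+
    then show ?thesis using *(1)[of B] *(2)[of B] by (simp only: distrib_right tb.simps mult_1_right)
  qed
  then show ?case by blast
next
  case (While e c)
  then obtain C D where *: "\<And>B. tb B c \<le> C * (B + 1) ^ D" by blast
  have "tb B (While e c) \<le> (2 * elen e + 3 + C) * (B + 1) ^ (D + 1)" for B
  proof -
    have "1 \<le> (B + 1) ^ D" by simp
    then have "elen e + 2 + tb B c \<le> (elen e + 2) * (B + 1) ^ D + C * (B + 1) ^ D"
      using *[of B] by (metis add_mono mult.right_neutral mult_le_mono2)
    then have "B * (elen e + 2 + tb B c) \<le> (B + 1) * ((elen e + 2 + C) * (B + 1) ^ D)"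
      by (intro mult_mono) (auto simp: distrib_right)
    moreover have "(elen e + 1) * 1 \<le> (elen e + 1) * (B + 1) ^ (D + 1)"
      by (intro mult_left_mono one_le_power; simp)
    ultimately show ?thesis by (simp add: algebra_simps)
  qed
  then show ?case by blast
qed

text \<open>Total correctness with the time bound built into the judgement: the rules carry it
  along, and no later proof about a command counts steps.\<close>

definition runs :: "nat \<Rightarrow> com \<Rightarrow> st \<Rightarrow> (st \<Rightarrow> bool) \<Rightarrow> bool" where
  "runs B c \<sigma> Q \<longleftrightarrow> (\<exists>t \<tau>. bs c \<sigma> t \<tau> \<and> t \<le> tb B c \<and> Q \<tau>)"

lemma runs_conseq:
  assumes "runs B c \<sigma> P" "\<And>\<tau>. P \<tau> \<Longrightarrow> frame (mv c) (ma c) \<sigma> \<tau> \<Longrightarrow> Q \<tau>"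
  shows "runs B c \<sigma> Q"
  using assms bs_frame unfolding runs_def by blast

lemma runs_Assign: "Q (setv x (aval e \<sigma>) \<sigma>) \<Longrightarrow> runs B (Assign x e) \<sigma> Q"
  unfolding runs_def using bsAssign by fastforce

lemma runs_Put: "Q (seta A (aval e1 \<sigma>) (aval e2 \<sigma>) \<sigma>) \<Longrightarrow> runs B (Put A e1 e2) \<sigma> Q"
  unfolding runs_def using bsPut by fastforce

lemma runs_Seq: "runs B c1 \<sigma> (\<lambda>\<tau>. runs B c2 \<tau> Q) \<Longrightarrow> runs B (Seq c1 c2) \<sigma> Q"
  unfolding runs_def using bsSeq by (metis add_mono tb.simps(3))

lemma runs_If:
  assumes "aval e \<sigma> \<noteq> 0 \<Longrightarrow> runs B c1 \<sigma> Q" "aval e \<sigma> = 0 \<Longrightarrow> runs B c2 \<sigma> Q"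
  shows "runs B (If e c1 c2) \<sigma> Q"
proof (cases "aval e \<sigma> = 0")
  case True
  with assms(2) obtain t \<tau> where "bs c2 \<sigma> t \<tau>" "t \<le> tb B c2" "Q \<tau>" by (auto simp: runs_def)
  with bsIfF[OF True this(1), of c1] show ?thesis by (fastforce simp: runs_def)
next
  case False
  with assms(1) obtain t \<tau> where "bs c1 \<sigma> t \<tau>" "t \<le> tb B c1" "Q \<tau>" by (auto simp: runs_def)
  with bsIfT[OF False this(1), of c2] show ?thesis by (fastforce simp: runs_def)
qed

text \<open>One measure does double duty: it decreases, so the loop terminates, and its initial
  value, at most \<open>B\<close>, bounds the number of passes.\<close>

lemma runs_While:
  assumes "I \<sigma>" "m \<sigma> \<le> B"
    and step: "\<And>\<tau>. I \<tau> \<Longrightarrow> aval e \<tau> \<noteq> 0 \<Longrightarrow> runs B c \<tau> (\<lambda>\<tau>'. I \<tau>' \<and> m \<tau>' < (m \<tau> :: nat))"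
    and "\<And>\<tau>. I \<tau> \<Longrightarrow> aval e \<tau> = 0 \<Longrightarrow> Q \<tau>"
  shows "runs B (While e c) \<sigma> Q"
proof -
  have "\<exists>t \<tau>. bs (While e c) \<sigma> t \<tau> \<and> t \<le> elen e + 1 + m \<sigma> * (elen e + 2 + tb B c) \<and> I \<tau> \<and> aval e \<tau> = 0"
    using assms(1)
  proof (induction "m \<sigma>" arbitrary: \<sigma> rule: less_induct)
    case less
    show ?case
    proof (cases "aval e \<sigma> = 0")
      case True
      then show ?thesis using bsWhileF[OF True, of c] less.prems by fastforce
    next
      case False
      from step[OF less.prems False] obtain t \<tau> where
        1: "bs c \<sigma> t \<tau>" "t \<le> tb B c" "I \<tau>" "m \<tau> < m \<sigma>" by (auto simp: runs_def)
      from less.hyps[OF 1(4,3)] obtain t' \<upsilon> where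
        2: "bs (While e c) \<tau> t' \<upsilon>" "t' \<le> elen e + 1 + m \<tau> * (elen e + 2 + tb B c)" "I \<upsilon>" "aval e \<upsilon> = 0"
        by blast
      have "Suc (m \<tau>) * (elen e + 2 + tb B c) \<le> m \<sigma> * (elen e + 2 + tb B c)"
        by (rule mult_right_mono) (use 1(4) in auto)
      then show ?thesis using bsWhileT[OF False 1(1) 2(1)] 1(2) 2(2-4) by fastforce
    qed
  qed
  then obtain t \<tau> where *: "bs (While e c) \<sigma> t \<tau>" "t \<le> elen e + 1 + m \<sigma> * (elen e + 2 + tb B c)" "I \<tau>" "aval e \<tau> = 0"
    by blast
  have "m \<sigma> * (elen e + 2 + tb B c) \<le> B * (elen e + 2 + tb B c)"
    by (rule mult_right_mono) (use assms(2) in auto)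
  then show ?thesis using * assms(4) unfolding runs_def by fastforce
qed

section \<open>Counting loops and loop-free bodies\<close>

definition For :: "nat \<Rightarrow> nat \<Rightarrow> com \<Rightarrow> com" where
  "For x y c = Seq (Assign x (N 0)) (While (Minus (V y) (V x)) (Seq c (Assign x (Plus (V x) (N 1)))))"

lemma For_simps [simp]:
  "mv (For x y c) = insert x (mv c)" "ma (For x y c) = ma c"
  "wfc (For x y c) \<longleftrightarrow> x < 48 \<and> y < 48 \<and> wfc c"
  by (auto simp: For_def)

text \<open>\<open>I i\<close> speaks about the state in which the counter already has the value
  \<open>i\<close>, hence the \<open>setv\<close>. The frame facts handed to both obligations spare
  the invariant all that the body leaves alone.\<close>

lemma runs_For:
  assumes "x \<notin> mv c" "y \<notin> mv c" "x \<noteq> y" "vr \<sigma> y \<le> B" "I 0 (setv x 0 \<sigma>)"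
    and step: "\<And>i \<tau>. i < vr \<sigma> y \<Longrightarrow> I i \<tau> \<Longrightarrow> vr \<tau> x = i \<Longrightarrow> frame (insert x (mv c)) (ma c) \<sigma> \<tau> \<Longrightarrow>
       runs B c \<tau> (\<lambda>\<tau>'. I (Suc i) (setv x (Suc i) \<tau>'))"
    and post: "\<And>\<tau>. I (vr \<sigma> y) \<tau> \<Longrightarrow> frame (insert x (mv c)) (ma c) \<sigma> \<tau> \<Longrightarrow> Q \<tau>"
  shows "runs B (For x y c) \<sigma> Q"
  unfolding For_def
proof (rule runs_Seq, rule runs_Assign)
  let ?J = "\<lambda>\<tau>. vr \<tau> x \<le> vr \<sigma> y \<and> I (vr \<tau> x) \<tau> \<and> frame (insert x (mv c)) (ma c) \<sigma> \<tau>"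
  show "runs B (While (Minus (V y) (V x)) (Seq c (Assign x (Plus (V x) (N 1))))) (setv x (aval (N 0) \<sigma>) \<sigma>) Q"
  proof (rule runs_While[where I = ?J and m = "\<lambda>\<tau>. vr \<sigma> y - vr \<tau> x"])
    show "?J (setv x (aval (N 0) \<sigma>) \<sigma>)"
      using assms(5) by (auto simp: frame_def)
    show "vr \<sigma> y - vr (setv x (aval (N 0) \<sigma>) \<sigma>) x \<le> B" using assms(4) by simp
  next
    fix \<tau> assume J: "?J \<tau>" and ne: "aval (Minus (V y) (V x)) \<tau> \<noteq> 0"
    have y: "vr \<tau> y = vr \<sigma> y" using J assms(2,3) by (auto simp: frame_def)
    with ne have lt: "vr \<tau> x < vr \<sigma> y" by simp
    have "runs B c \<tau> (\<lambda>\<tau>'. I (Suc (vr \<tau> x)) (setv x (Suc (vr \<tau> x)) \<tau>'))"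
      using step[OF lt] J by simp
    then show "runs B (Seq c (Assign x (Plus (V x) (N 1)))) \<tau> (\<lambda>\<tau>'. ?J \<tau>' \<and> vr \<sigma> y - vr \<tau>' x < vr \<sigma> y - vr \<tau> x)"
    proof (intro runs_Seq, elim runs_conseq, intro runs_Assign)
      fix \<tau>' assume 1: "I (Suc (vr \<tau> x)) (setv x (Suc (vr \<tau> x)) \<tau>')" and fr: "frame (mv c) (ma c) \<tau> \<tau>'"
      have x: "vr \<tau>' x = vr \<tau> x" using fr assms(1) by (auto simp: frame_def)
      have "frame (insert x (mv c)) (ma c) \<sigma> \<tau>'"
        by (rule frame_trans[OF conjunct2[OF conjunct2[OF J]] fr]) auto
      then have "frame (insert x (mv c)) (ma c) \<sigma> (setv x (Suc (vr \<tau> x)) \<tau>')"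
        by (auto simp: frame_def)
      then show "?J (setv x (aval (Plus (V x) (N 1)) \<tau>') \<tau>') \<and>
         vr \<sigma> y - vr (setv x (aval (Plus (V x) (N 1)) \<tau>') \<tau>') x < vr \<sigma> y - vr \<tau> x"
        using 1 x lt by simp
    qed
  next
    fix \<tau> assume J: "?J \<tau>" and e: "aval (Minus (V y) (V x)) \<tau> = 0"
    have "vr \<tau> y = vr \<sigma> y" using J assms(2,3) by (auto simp: frame_def)
    with e J have "vr \<tau> x = vr \<sigma> y" by simp
    with J post show "Q \<tau>" by simp
  qed
qed

fun loopfree :: "com \<Rightarrow> bool" where
  "loopfree (Seq c1 c2) \<longleftrightarrow> loopfree c1 \<and> loopfree c2"
| "loopfree (If e c1 c2) \<longleftrightarrow> loopfree c1 \<and> loopfree c2"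
| "loopfree (While e c) \<longleftrightarrow> False"
| "loopfree _ \<longleftrightarrow> True"

fun exec :: "com \<Rightarrow> st \<Rightarrow> st" where
  "exec (Assign x e) \<sigma> = setv x (aval e \<sigma>) \<sigma>"
| "exec (Put A e1 e2) \<sigma> = seta A (aval e1 \<sigma>) (aval e2 \<sigma>) \<sigma>"
| "exec (Seq c1 c2) \<sigma> = exec c2 (exec c1 \<sigma>)"
| "exec (If e c1 c2) \<sigma> = (if aval e \<sigma> \<noteq> 0 then exec c1 \<sigma> else exec c2 \<sigma>)"
| "exec (While e c) \<sigma> = \<sigma>"

text \<open>Loop-free code can be evaluated symbolically by the simplifier; the \<open>While\<close>
  equation of \<open>exec\<close> is a dummy that \<open>loopfree\<close> excludes.\<close>

lemma runs_exec: "loopfree c \<Longrightarrow> Q (exec c \<sigma>) \<Longrightarrow> runs B c \<sigma> Q"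
proof (induction c arbitrary: \<sigma> Q)
  case (Seq c1 c2)
  then show ?case by (auto intro!: runs_Seq)
next
  case (If e c1 c2)
  then show ?case by (auto intro!: runs_If)
qed (auto intro: runs_Assign runs_Put)

section \<open>From commands to machine programs\<close>

lemma runs_steps:
  assumes "runs B c \<sigma> Q" "wfc c" "rel \<sigma> R"
  shows "\<exists>\<tau> R' t. t \<le> tb B c \<and> Q \<tau> \<and> rel \<tau> R' \<and>
    steps (xs @ ccom (length xs) c) t (length xs, R) (length (xs @ ccom (length xs) c), R')"
  using assms ccom_correct[OF _ assms(2,3) code_at_whole] unfolding runs_def by fastforce

definition state_of :: "(nat \<Rightarrow> nat) \<Rightarrow> st" where
  "state_of R = \<lparr>vr = R, ar = (\<lambda>A i. R (64 + 8 * i + A))\<rparr>"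

lemma rel_state_of: "rel (state_of R) R"
  by (simp add: rel_def state_of_def)

text \<open>Only array 0 is constrained: variables and other arrays contain whatever the machine and
  \<open>prelude\<close> left there, which \<open>state_of\<close> reads as a legitimate
  state.\<close>

theorem com_ram_outputs:
  assumes "wfc c" "xs \<noteq> []"
    and "\<And>\<sigma>. (\<And>i. i < length xs \<Longrightarrow> ar \<sigma> 0 i = xs ! i) \<Longrightarrow> runs B c \<sigma> (\<lambda>\<tau>. vr \<tau> 0 = y)"
  shows "\<exists>t \<le> 12 * length xs + 40 + tb B c. ram_outputs (prelude @ ccom 46 c) xs t y"
proof -
  obtain t R where 1: "t \<le> 12 * length xs + 40" "steps (prelude @ ccom 46 c) t (ram_init xs) (46, R)"
    "\<forall>i < length xs. R (64 + 8 * i) = xs ! i" using prelude_correct[OF assms(2)] by blast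
  have "runs B c (state_of R) (\<lambda>\<tau>. vr \<tau> 0 = y)"
    by (rule assms(3)) (use 1(3) in \<open>simp add: state_of_def\<close>)
  from runs_steps[OF this assms(1) rel_state_of, of prelude] obtain \<tau> R' t' where
    2: "t' \<le> tb B c" "vr \<tau> 0 = y" "rel \<tau> R'"
    "steps (prelude @ ccom 46 c) t' (46, R) (length (prelude @ ccom 46 c), R')"
    by (auto simp: length_prelude)
  have "ram_outputs (prelude @ ccom 46 c) xs (t + t') y"
    using steps_trans[OF 1(2) 2(4)] 2(2,3) by (auto simp: steps_def ram_outputs_def rel_def)
  then show ?thesis using 1(1) 2(1) by (intro exI[of _ "t + t'"]) simp
qed

text \<open>Here the program runs without \<open>prelude\<close> and finds its argument in register
  1, that is, in variable 1. \<open>B\<close> may depend on \<open>n\<close>, because only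
  termination counts.\<close>

theorem com_computable:
  assumes "wfc c" "\<And>n \<sigma>. vr \<sigma> 1 = n \<Longrightarrow> \<exists>B. runs B c \<sigma> (\<lambda>\<tau>. vr \<tau> 0 = f n)"
  shows "computable f"
  unfolding computable_def
proof (intro exI[of _ "ccom 0 c"] allI)
  fix n
  let ?R = "snd (ram_init [n])"
  have "vr (state_of ?R) 1 = n" by (simp add: state_of_def ram_init_def)
  from assms(2)[OF this] obtain B where "runs B c (state_of ?R) (\<lambda>\<tau>. vr \<tau> 0 = f n)" by blast
  from runs_steps[OF this assms(1) rel_state_of, of "[]"] obtain \<tau> R' t' where
    2: "vr \<tau> 0 = f n" "rel \<tau> R'" "steps (ccom 0 c) t' (0, ?R) (length (ccom 0 c), R')"
    by auto
  then show "\<exists>t. ram_outputs (ccom 0 c) [n] t (f n)"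
    by (intro exI[of _ t']) (auto simp: steps_def ram_outputs_def rel_def ram_init_def)
qed


section \<open>Reading the graph\<close>

text \<open>Variable 0 is the output register and array 0 the input laid out by
  \<open>prelude\<close>. \<open>aROW\<close> tabulates the row starts of the matrix and
  \<open>aQO\<close> the starts of the queue entries in \<open>aQ\<close>, replacing products; the
  budget matrix \<open>aDM\<close> shares its layout with the adjacency matrix.\<close>

abbreviation (input) "vANS \<equiv> 0 :: nat"
abbreviation (input) "vN \<equiv> 2 :: nat"
abbreviation (input) "vK \<equiv> 3 :: nat"
abbreviation (input) "vD \<equiv> 4 :: nat"
abbreviation (input) "vL \<equiv> 5 :: nat"
abbreviation (input) "vU \<equiv> 6 :: nat"
abbreviation (input) "vV \<equiv> 7 :: nat"
abbreviation (input) "vW \<equiv> 8 :: nat"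
abbreviation (input) "vR \<equiv> 9 :: nat"
abbreviation (input) "vI \<equiv> 10 :: nat"
abbreviation (input) "vJ \<equiv> 11 :: nat"
abbreviation (input) "vG \<equiv> 12 :: nat"
abbreviation (input) "vGG \<equiv> 13 :: nat"
abbreviation (input) "vX \<equiv> 14 :: nat"
abbreviation (input) "vOK \<equiv> 15 :: nat"
abbreviation (input) "vLEN \<equiv> 16 :: nat"
abbreviation (input) "vLEN0 \<equiv> 17 :: nat"
abbreviation (input) "vH \<equiv> 18 :: nat"
abbreviation (input) "vFP \<equiv> 19 :: nat"
abbreviation (input) "vP \<equiv> 20 :: nat"
abbreviation (input) "vQ \<equiv> 21 :: nat"
abbreviation (input) "vEQ \<equiv> 22 :: nat"
abbreviation (input) "vGO \<equiv> 23 :: nat"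
abbreviation (input) "vROW \<equiv> 24 :: nat"
abbreviation (input) "vSKIP \<equiv> 25 :: nat"
abbreviation (input) "vT \<equiv> 26 :: nat"

abbreviation (input) "aIN \<equiv> 0 :: nat"
abbreviation (input) "aMARK \<equiv> 1 :: nat"
abbreviation (input) "aROW \<equiv> 2 :: nat"
abbreviation (input) "aDM \<equiv> 3 :: nat"
abbreviation (input) "aQ \<equiv> 4 :: nat"
abbreviation (input) "aQO \<equiv> 5 :: nat"
abbreviation (input) "aCUR \<equiv> 6 :: nat"
abbreviation (input) "aNEW \<equiv> 7 :: nat"

abbreviation "When e c \<equiv> com.If e c (Assign vSKIP (N 0))"
abbreviation "Unless e c \<equiv> com.If e (Assign vSKIP (N 0)) c"
abbreviation "Adj u v \<equiv> Idx aIN (Plus (Idx aROW u) v)"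
abbreviation "Near u v \<equiv> Idx aDM (Plus (Idx aROW u) v)"

notation Seq (infixr ";;" 60)

text \<open>With truncated differences the inner sum is the absolute difference.\<close>

definition Eq :: "aexp \<Rightarrow> aexp \<Rightarrow> aexp" where
  "Eq a b = Minus (N 1) (Plus (Minus a b) (Minus b a))"

lemma aval_Eq [simp]: "aval (Eq a b) \<sigma> = (if aval a \<sigma> = aval b \<sigma> then 1 else 0)"
  by (auto simp: Eq_def)

lemma runs_Seq':
  assumes "runs B c1 \<sigma> P" "\<And>\<tau>. P \<tau> \<Longrightarrow> frame (mv c1) (ma c1) \<sigma> \<tau> \<Longrightarrow> runs B c2 \<tau> Q"
  shows "runs B (Seq c1 c2) \<sigma> Q"
  by (rule runs_Seq, rule runs_conseq[OF assms(1)], rule assms(2))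

lemma runs_exec': "exec c \<sigma> = \<tau> \<Longrightarrow> loopfree c \<Longrightarrow> Q \<tau> \<Longrightarrow> runs B c \<sigma> Q"
  by (rule runs_exec) auto

text \<open>The matrix starts behind four header words and \<open>2 * k\<close> positions; this is
  the first row address.\<close>

definition c_init :: com where
  "c_init =
     Assign vN (Idx aIN (N 0)) ;; Assign vK (Idx aIN (N 1)) ;;
     Assign vD (Idx aIN (N 2)) ;; Assign vL (Idx aIN (N 3)) ;;
     Assign vROW (Plus (N 4) (Plus (V vK) (V vK)))"

definition c_rows :: com where
  "c_rows = For vU vN (Put aROW (V vU) (V vROW) ;; Assign vROW (Plus (V vROW) (V vN)))"

text \<open>
  Bellman-Ford with budgets: the entry for \<open>v\<close> is \<open>d + 1\<close> minus the length of some walk from the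
  source \<open>u\<close> to \<open>v\<close>, and 0 while none of length at most \<open>d\<close> is known.  Budgets never decrease, so
  updating in place is harmless.
\<close>

definition c_relax :: com where
  "c_relax =
     For vR vD (For vW vN (For vV vN (When (Adj (V vW) (V vV))
       (When (Minus (Minus (Near (V vU) (V vW)) (N 1)) (Near (V vU) (V vV)))
         (Put aDM (Plus (Idx aROW (V vU)) (V vV)) (Minus (Near (V vU) (V vW)) (N 1)))))))"

definition c_dist :: com where
  "c_dist =
     For vU vN (
       For vV vN (Put aDM (Plus (Idx aROW (V vU)) (V vV)) (N 0)) ;;
       Put aDM (Plus (Idx aROW (V vU)) (V vU)) (Plus (V vD) (N 1)) ;;
       c_relax)"

text \<open>\<open>k\<close> rounds suffice, since every round that does not reach closure marks a further agent.\<close>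

definition c_flood :: com where
  "c_flood =
     For vI vK (Put aMARK (V vI) (N 0)) ;; Put aMARK (N 0) (N 1) ;;
     For vR vK (For vI vK (For vJ vK (When (Idx aMARK (V vI))
       (When (Near (Idx aNEW (V vI)) (Idx aNEW (V vJ))) (Put aMARK (V vJ) (N 1))))))"

text \<open>The instance after numbering: vertices are numbers below \<open>n\<close>, and a
  configuration is the list of the agents' vertices. The program is verified in this form;
  \<open>encoding\<close> links it to graphs.\<close>

locale problem =
  fixes B n k d l :: nat and adj :: "nat \<Rightarrow> nat \<Rightarrow> bool" and s0 t0 :: "nat list"
  assumes nB: "n \<le> B" and kB: "k \<le> B" and dB: "d \<le> B"
    and s0: "length s0 = k" "set s0 \<subseteq> {..<n}" and t0: "length t0 = k"
begin

text \<open>Loops are included so that \<open>A ^^ j\<close> means distance at most \<open>j\<close>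
  and not a walk of length exactly \<open>j\<close>.\<close>

definition A :: "(nat \<times> nat) set" where
  "A = {(u, v). u < n \<and> v < n \<and> (u = v \<or> adj u v)}"

definition near :: "nat \<Rightarrow> nat \<Rightarrow> bool" where
  "near u v \<longleftrightarrow> (u, v) \<in> A ^^ d"

lemma A_mono:
  assumes "(u, v) \<in> A ^^ i" "i \<le> j" "u < n"
  shows "(u, v) \<in> A ^^ j"
proof -
  have "(u, u) \<in> A ^^ (j - i)"
  proof (induction "j - i" arbitrary: j)
    case (Suc m)
    then have "(u, u) \<in> A ^^ m" by (metis diff_Suc_1 diff_Suc_eq_diff_pred diff_commute)
    then have "(u, u) \<in> A ^^ Suc m" using assms(3) by (auto simp: A_def)
    then show ?case using Suc.hyps(2) by simp
  qed simp
  then have "(u, v) \<in> A ^^ ((j - i) + i)" using assms(1) by (auto simp: relpow_add)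
  then show ?thesis using assms(2) by simp
qed

lemma A_bound: "(u, v) \<in> A ^^ i \<Longrightarrow> u < n \<Longrightarrow> v < n"
  by (cases i) (auto simp: A_def)

definition ra :: "nat \<Rightarrow> nat" where
  "ra u = 4 + 2 * k + u * n"

text \<open>Row and column are quotient and remainder by \<open>n\<close>; thus the rows of the
  budget matrix are disjoint.\<close>

lemma ra_inj: "v < n \<Longrightarrow> v' < n \<Longrightarrow> ra u + v = ra u' + v' \<Longrightarrow> u = u' \<and> v = v'"
proof -
  assume a: "v < n" "v' < n" "ra u + v = ra u' + v'"
  then have e: "n * u + v = n * u' + v'" by (simp add: ra_def mult.commute)
  have "(n * u + v) div n = u" "(n * u' + v') div n = u'" using a by simp_all
  with e show ?thesis by auto
qed

definition inp :: "st \<Rightarrow> bool" where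
  "inp \<sigma> \<longleftrightarrow> ar \<sigma> aIN 0 = n \<and> ar \<sigma> aIN 1 = k \<and> ar \<sigma> aIN 2 = d \<and> ar \<sigma> aIN 3 = l \<and>
     (\<forall>i < k. ar \<sigma> aIN (4 + i) = s0 ! i) \<and> (\<forall>i < k. ar \<sigma> aIN (4 + k + i) = t0 ! i) \<and>
     (\<forall>u < n. \<forall>v < n. ar \<sigma> aIN (ra u + v) = (if adj u v then 1 else 0))"

definition env0 :: "st \<Rightarrow> bool" where
  "env0 \<sigma> \<longleftrightarrow> inp \<sigma> \<and> vr \<sigma> vN = n \<and> vr \<sigma> vK = k \<and> vr \<sigma> vD = d \<and> vr \<sigma> vL = l \<and>
     (\<forall>u < n. ar \<sigma> aROW u = ra u)"

text \<open>Of the budgets only their positivity is kept; it is all that the connectivity test looks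
  at.\<close>

definition env :: "st \<Rightarrow> bool" where
  "env \<sigma> \<longleftrightarrow> env0 \<sigma> \<and> (\<forall>u < n. \<forall>v < n. (ar \<sigma> aDM (ra u + v) = 0) = (\<not> near u v))"

lemma inp_cong: "ar \<tau> aIN = ar \<sigma> aIN \<Longrightarrow> inp \<sigma> \<Longrightarrow> inp \<tau>"
  by (simp add: inp_def)

lemma env0_frame: "frame X Y \<sigma> \<tau> \<Longrightarrow> X \<inter> {2, 3, 4, 5} = {} \<Longrightarrow> Y \<inter> {0, 2} = {} \<Longrightarrow> env0 \<sigma> \<Longrightarrow> env0 \<tau>"
  by (auto simp: env0_def inp_def frame_def)

lemma env_frame: "frame X Y \<sigma> \<tau> \<Longrightarrow> X \<inter> {2, 3, 4, 5} = {} \<Longrightarrow> Y \<inter> {0, 2, 3} = {} \<Longrightarrow> env \<sigma> \<Longrightarrow> env \<tau>"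
  by (auto simp: env_def env0_def inp_def frame_def)

lemma env0D:
  assumes "env0 \<sigma>"
  shows "vr \<sigma> 2 = n" "vr \<sigma> 3 = k" "vr \<sigma> 4 = d" "vr \<sigma> 5 = l" "u < n \<Longrightarrow> ar \<sigma> 2 u = ra u"
    "u < n \<Longrightarrow> v < n \<Longrightarrow> (0 < ar \<sigma> 0 (ra u + v)) = adj u v"
  using assms by (auto simp: env0_def inp_def)

lemma envD:
  assumes "env \<sigma>"
  shows "vr \<sigma> 2 = n" "vr \<sigma> 3 = k" "vr \<sigma> 4 = d" "vr \<sigma> 5 = l" "u < n \<Longrightarrow> ar \<sigma> 2 u = ra u"
    "u < n \<Longrightarrow> v < n \<Longrightarrow> (0 < ar \<sigma> 0 (ra u + v)) = adj u v"
    "u < n \<Longrightarrow> v < n \<Longrightarrow> (0 < ar \<sigma> 3 (ra u + v)) = near u v"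
    "i < k \<Longrightarrow> ar \<sigma> 0 (4 + i) = s0 ! i" "i < k \<Longrightarrow> ar \<sigma> 0 (4 + k + i) = t0 ! i"
proof -
  have 0: "env0 \<sigma>" and nr: "u < n \<Longrightarrow> v < n \<Longrightarrow> (ar \<sigma> 3 (ra u + v) = 0) = (\<not> near u v)"
    using assms by (simp_all only: env_def)
  then have "inp \<sigma>" by (simp only: env0_def)
  then show "i < k \<Longrightarrow> ar \<sigma> 0 (4 + i) = s0 ! i" "i < k \<Longrightarrow> ar \<sigma> 0 (4 + k + i) = t0 ! i"
    by (simp_all only: inp_def)
  show "(0 < ar \<sigma> 3 (ra u + v)) = near u v" if "u < n" "v < n"
    using nr[OF that] by auto
qed (use assms env0D[of \<sigma>] in \<open>simp_all only: env_def\<close>)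

lemma init_correct:
  assumes "inp \<sigma>"
  shows "runs B c_init \<sigma> (\<lambda>\<tau>. inp \<tau> \<and> vr \<tau> vN = n \<and> vr \<tau> vK = k \<and> vr \<tau> vD = d \<and> vr \<tau> vL = l \<and>
     vr \<tau> vROW = ra 0)"
proof (rule runs_exec')
  have i: "ar \<sigma> 0 0 = n" "ar \<sigma> 0 1 = k" "ar \<sigma> 0 2 = d" "ar \<sigma> 0 3 = l"
    using assms by (simp_all add: inp_def)
  show "exec c_init \<sigma> = setv vROW (4 + (k + k)) (setv vL l (setv vD d (setv vK k (setv vN n \<sigma>))))"
    unfolding c_init_def by (simp only: exec.simps aval.simps setv_sel i fun_upd_same fun_upd_other)
qed (use inp_cong[OF _ assms] in \<open>simp_all add: c_init_def ra_def\<close>)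

lemma rows_correct:
  assumes "inp \<sigma>" "vr \<sigma> vN = n" "vr \<sigma> vK = k" "vr \<sigma> vD = d" "vr \<sigma> vL = l" "vr \<sigma> vROW = ra 0"
  shows "runs B c_rows \<sigma> env0"
  unfolding c_rows_def
proof (rule runs_For[where I = "\<lambda>i \<tau>. vr \<tau> vROW = ra i \<and> (\<forall>u < i. ar \<tau> aROW u = ra u)"], goal_cases)
  case (6 i \<tau>)
  have "vr \<tau> vN = n" using 6(4) assms by (simp add: frame_def)
  then show ?case
    by (intro runs_exec) (use 6(2,3) in \<open>auto simp: ra_def less_Suc_eq\<close>)
next
  case (7 \<tau>)
  then show ?case
    using inp_cong[OF _ assms(1), of \<tau>] assms(2-) unfolding env0_def by (simp add: frame_def)
qed (use nB assms in simp_all)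

text \<open>\<open>S\<close> is soundness: a positive budget is witnessed by a walk.
  \<open>C r\<close> is completeness for walks of at most \<open>r\<close> steps and holds after
  \<open>r\<close> rounds; at \<open>r = d\<close> it gives every near vertex a budget of at least
  1. The last clause, that other addresses are untouched, protects the rows finished before.\<close>

lemma relax_correct:
  assumes "env0 \<sigma>" "vr \<sigma> vU = u" "u < n"
    and "\<And>v. v < n \<Longrightarrow> ar \<sigma> aDM (ra u + v) = (if v = u then d + 1 else 0)"
  shows "runs B c_relax \<sigma> (\<lambda>\<tau>. (\<forall>v < n. (ar \<tau> aDM (ra u + v) = 0) = (\<not> near u v)) \<and>
     (\<forall>a. (\<forall>v < n. a \<noteq> ra u + v) \<longrightarrow> ar \<tau> aDM a = ar \<sigma> aDM a))"
proof -
  define b where "b \<tau> v = ar \<tau> aDM (ra u + v)" for \<tau> :: st and v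
  define S where "S \<tau> \<longleftrightarrow> (\<forall>v < n. b \<tau> v \<le> d + 1 \<and> (0 < b \<tau> v \<longrightarrow> (u, v) \<in> A ^^ (d + 1 - b \<tau> v))) \<and>
     (\<forall>a. (\<forall>v < n. a \<noteq> ra u + v) \<longrightarrow> ar \<tau> aDM a = ar \<sigma> aDM a)" for \<tau> :: st
  define C where "C r \<tau> \<longleftrightarrow> (\<forall>j \<le> r. \<forall>v. (u, v) \<in> A ^^ j \<longrightarrow> d + 1 - j \<le> b \<tau> v)" for r \<tau>
  have [simp]: "b (setv x c \<tau>) = b \<tau>" "S (setv x c \<tau>) = S \<tau>" "C r (setv x c \<tau>) = C r \<tau>" for x c \<tau> r
    by (simp_all add: b_def S_def C_def fun_eq_iff)
  have e0: "env0 \<tau>" "vr \<tau> vU = u" if "frame X Y \<sigma> \<tau>" "X \<inter> {2, 3, 4, 5, 6} = {}" "Y \<inter> {0, 2} = {}" for X Y \<tau>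
    using that env0_frame[OF that(1) _ _ assms(1)] assms(2) by (auto simp: frame_def)
  have S0: "S \<sigma>" "C 0 \<sigma>"
    using assms(3,4) by (auto simp: S_def C_def b_def)
  show ?thesis
    unfolding c_relax_def
  proof (rule runs_For[where I = "\<lambda>r \<tau>. S \<tau> \<and> C r \<tau>"], goal_cases)
    case (6 r \<tau>)
    \<comment> \<open>Budgets at the start of the round. Those read later in the round may be
      larger, which only helps, so comparing with \<open>b0\<close> suffices.\<close>
    define b0 where "b0 = b \<tau>"
    let ?I = "\<lambda>w \<tau>'. S \<tau>' \<and> (\<forall>v < n. b0 v \<le> b \<tau>' v) \<and> (\<forall>w' < w. \<forall>v < n. adj w' v \<longrightarrow> b0 w' - 1 \<le> b \<tau>' v)"
    from e0[OF 6(4)] have t: "env0 \<tau>" "vr \<tau> vU = u" by simp_all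
    show ?case
    proof (rule runs_For[where I = ?I], goal_cases)
      case W: (6 w \<tau>1)
      have w: "w < n" using W(1) env0D(1)[OF t(1)] by simp
      have t1: "env0 \<tau>1" "vr \<tau>1 vU = u" using env0_frame[OF W(4) _ _ t(1)] t(2) W(4) by (auto simp: frame_def)
      show ?case
      proof (rule runs_For[where I = "\<lambda>v \<tau>'. ?I w \<tau>' \<and> (\<forall>v' < v. adj w v' \<longrightarrow> b0 w - 1 \<le> b \<tau>' v')"], goal_cases)
        case V: (6 v \<tau>2)
        have v: "v < n" using V(1) env0D(1)[OF t1(1)] by simp
        have t2: "env0 \<tau>2" "vr \<tau>2 vU = u" "vr \<tau>2 vW = w"
          using env0_frame[OF V(4) _ _ t1(1)] t1(2) W(3) V(4) by (auto simp: frame_def)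
        have tv: "vr \<tau>2 vV = v" by (rule V(3))
        have row: "ar \<tau>2 aROW u = ra u" "ar \<tau>2 aROW w = ra w" using env0D(5)[OF t2(1)] assms(3) w by auto
        have adj: "(0 < ar \<tau>2 aIN (ra w + v)) = adj w v" using env0D(6)[OF t2(1) w v] .
        let ?c = "When (Adj (V vW) (V vV)) (When (Minus (Minus (Near (V vU) (V vW)) (N 1)) (Near (V vU) (V vV)))
         (Put aDM (Plus (Idx aROW (V vU)) (V vV)) (Minus (Near (V vU) (V vW)) (N 1))))"
        show ?case
        proof (cases "adj w v \<and> b \<tau>2 v < b \<tau>2 w - 1")
          case True
          define \<tau>3 where "\<tau>3 = seta aDM (ra u + v) (b \<tau>2 w - 1) \<tau>2"
          have ex: "exec ?c \<tau>2 = \<tau>3"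
            using True adj by (auto simp: t2 tv row b_def \<tau>3_def)
          have b3: "b \<tau>3 v' = (if v' = v then b \<tau>2 w - 1 else b \<tau>2 v')" for v'
            by (simp add: \<tau>3_def b_def)
          have S2: "S \<tau>2" and B2: "\<And>v'. v' < n \<Longrightarrow> b0 v' \<le> b \<tau>2 v'" using V(2) by auto
          have "S \<tau>3"
            unfolding S_def
          proof (intro conjI allI impI)
            fix v' assume v': "v' < n"
            show "b \<tau>3 v' \<le> d + 1" using S2 v' w by (fastforce simp: S_def b3)
            assume "0 < b \<tau>3 v'"
            show "(u, v') \<in> A ^^ (d + 1 - b \<tau>3 v')"
            proof (cases "v' = v")
              case T: True
              have "(u, w) \<in> A ^^ (d + 1 - b \<tau>2 w)" using S2 w True by (auto simp: S_def)
              moreover have "(w, v) \<in> A" using w v True by (simp add: A_def)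
              ultimately have "(u, v) \<in> A ^^ Suc (d + 1 - b \<tau>2 w)" by auto
              \<comment> \<open>Truncation is harmless, as
                \<open>2 \<le> b \<tau>2 w \<le> d + 1\<close>; the lower bound comes from the test
                just passed.\<close>
              moreover have "Suc (d + 1 - b \<tau>2 w) = d + 1 - (b \<tau>2 w - 1)"
                using S2 w True by (auto simp: S_def)
              ultimately have "(u, v) \<in> A ^^ (d + 1 - (b \<tau>2 w - 1))" by metis
              then show ?thesis using T by (simp add: b3)
            qed (use S2 v' \<open>0 < b \<tau>3 v'\<close> in \<open>auto simp: S_def b3\<close>)
          next
            fix a assume "\<forall>v < n. a \<noteq> ra u + v"
            then show "ar \<tau>3 aDM a = ar \<sigma> aDM a" using S2 v by (simp add: S_def \<tau>3_def)
          qed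
          moreover have mono: "b \<tau>2 v' \<le> b \<tau>3 v'" for v' using True by (simp add: b3)
          have "b0 w - 1 \<le> b \<tau>3 v" using diff_le_mono[OF B2[OF w], of 1] by (simp add: b3)
          then have "\<forall>v' < Suc v. adj w v' \<longrightarrow> b0 w - 1 \<le> b \<tau>3 v'"
            using V(2) mono less_Suc_eq le_trans by metis
          moreover have "\<forall>v < n. b0 v \<le> b \<tau>3 v"
            using B2 mono le_trans by blast
          moreover have "\<forall>w' < w. \<forall>v < n. adj w' v \<longrightarrow> b0 w' - 1 \<le> b \<tau>3 v"
            using V(2) mono le_trans by blast
          ultimately show ?thesis
            by (intro runs_exec'[OF ex]) simp_all
        next
          case False
          define \<tau>3 where "\<tau>3 = setv vSKIP 0 \<tau>2"
          have ex: "exec ?c \<tau>2 = \<tau>3"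
            using False adj by (auto simp: t2 tv row b_def \<tau>3_def)
          have "b0 w - 1 \<le> b \<tau>2 w - 1" using V(2) w by (intro diff_le_mono) blast
          then have "adj w v \<longrightarrow> b0 w - 1 \<le> b \<tau>2 v" using False by linarith
          then have "\<forall>v' < Suc v. adj w v' \<longrightarrow> b0 w - 1 \<le> b \<tau>2 v'"
            using V(2) less_Suc_eq by metis
          then show ?thesis
            using V(2) by (intro runs_exec'[OF ex]) (simp_all add: \<tau>3_def)
        qed
      next
        case V: (7 \<tau>2)
        then show ?case using env0D(1)[OF t1(1)] by (auto simp: less_Suc_eq)
      qed (use W(2) nB env0D(1)[OF t1(1)] in simp_all)
    next
      case W: (7 \<tau>1)
      have "C (Suc r) \<tau>1"
        unfolding C_def
      proof (intro allI impI)
        fix j v assume j: "j \<le> Suc r" "(u, v) \<in> A ^^ j"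
        have v: "v < n" using A_bound[OF j(2) assms(3)] .
        show "d + 1 - j \<le> b \<tau>1 v"
        proof (cases "j \<le> r")
          case True
          then have "d + 1 - j \<le> b0 v" using 6(2) j(2) by (auto simp: C_def b0_def)
          then show ?thesis using W(1) v by (auto intro: order_trans)
        next
          case False
          then have "j = Suc r" using j(1) by simp
          with j(2) obtain w where w: "(u, w) \<in> A ^^ r" "(w, v) \<in> A" by auto
          have b0w: "d + 1 - r \<le> b0 w" using 6(2) w(1) by (auto simp: C_def b0_def)
          show ?thesis
          \<comment> \<open>The last step may be one of the loops added in \<open>A\<close>;
            monotonicity of the budgets settles that case.\<close>
          proof (cases "w = v")
            case True
            then show ?thesis using b0w W(1) v \<open>j = Suc r\<close> by fastforce
          next
            case F: False
            with w(2) have "adj w v" "w < n" by (auto simp: A_def)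
            then have "b0 w - 1 \<le> b \<tau>1 v" using W(1) v env0D(1)[OF t(1)] by auto
            then show ?thesis using b0w \<open>j = Suc r\<close> by simp
          qed
        qed
      qed
      then show ?case using W(1) by simp
    qed (use 6(2) nB env0D(1)[OF t(1)] in \<open>simp_all add: b0_def\<close>)
  next
    case (7 \<tau>)
    have SC: "S \<tau>" "C d \<tau>" using 7(1) env0D(3)[OF assms(1)] by simp_all
    have "(b \<tau> v = 0) = (\<not> near u v)" if v: "v < n" for v
    proof
      assume z: "b \<tau> v = 0"
      show "\<not> near u v"
        using SC(2)[unfolded C_def, rule_format, of d v] z unfolding near_def by auto
    next
      assume nn: "\<not> near u v"
      show "b \<tau> v = 0"
      proof (rule ccontr)
        assume "b \<tau> v \<noteq> 0"
        then have "(u, v) \<in> A ^^ (d + 1 - b \<tau> v)" using SC(1) v by (auto simp: S_def)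
        then have "(u, v) \<in> A ^^ d" by (rule A_mono) (use \<open>b \<tau> v \<noteq> 0\<close> assms(3) in auto)
        with nn show False by (simp add: near_def)
      qed
    qed
    then show ?case using SC(1) by (auto simp: S_def b_def)
  qed (use S0 dB env0D(3)[OF assms(1)] in simp_all)
qed

lemma dist_correct:
  assumes "env0 \<sigma>"
  shows "runs B c_dist \<sigma> env"
  unfolding c_dist_def
proof (rule runs_For[where I = "\<lambda>i \<tau>. \<forall>u < i. \<forall>v < n. (ar \<tau> aDM (ra u + v) = 0) = (\<not> near u v)"], goal_cases)
  case (6 u \<tau>)
  have u: "u < n" using 6(1) env0D(1)[OF assms] by simp
  have t: "env0 \<tau>" by (rule env0_frame[OF 6(4) _ _ assms]) (auto simp: c_relax_def)
  have "runs B (For vV vN (Put aDM (Plus (Idx aROW (V vU)) (V vV)) (N 0))) \<tau>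
      (\<lambda>\<tau>1. (\<forall>v < n. ar \<tau>1 aDM (ra u + v) = 0) \<and> (\<forall>a. (\<forall>v < n. a \<noteq> ra u + v) \<longrightarrow> ar \<tau>1 aDM a = ar \<tau> aDM a))"
  proof (rule runs_For[where I = "\<lambda>v \<tau>1. (\<forall>v' < v. ar \<tau>1 aDM (ra u + v') = 0) \<and>
      (\<forall>a. (\<forall>v < n. a \<noteq> ra u + v) \<longrightarrow> ar \<tau>1 aDM a = ar \<tau> aDM a)"], goal_cases)
    case V: (6 v \<tau>1)
    have "env0 \<tau>1" using env0_frame[OF V(4) _ _ t] by simp
    then have "ar \<tau>1 aROW u = ra u" "v < n" using env0D(1,5) u V(1) env0D(1)[OF t] by auto
    moreover have "vr \<tau>1 vU = u" using V(4) 6(3) by (simp add: frame_def)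
    ultimately show ?case
      by (intro runs_exec) (use V(2,3) in \<open>auto simp: less_Suc_eq\<close>)
  qed (use nB env0D(1)[OF t] in simp_all)
  note fill = this
  show ?case
  proof (rule runs_Seq'[OF fill], rule runs_Seq, rule runs_Put, goal_cases)
    case (1 \<tau>1)
    note f1 = 1(1)
    have t1: "env0 \<tau>1" "vr \<tau>1 vU = u" using env0_frame[OF 1(2) _ _ t] 1(2) 6(3) by (simp_all add: frame_def)
    let ?t = "seta aDM (aval (Plus (Idx aROW (V vU)) (V vU)) \<tau>1) (aval (Plus (V vD) (N 1)) \<tau>1) \<tau>1"
    have ta: "?t = seta aDM (ra u + u) (d + 1) \<tau>1" using t1 u env0D(3,5)[OF t1(1)] by simp
    have t2: "env0 ?t" "vr ?t vU = u" using t1 by (simp_all add: env0_def inp_def)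
    show ?case
    proof (rule runs_conseq[OF relax_correct[OF t2 u]], goal_cases)
      case (1 v)
      then show ?case using f1 unfolding ta by simp
    next
      case (2 \<tau>2)
      show ?case
      proof (intro allI impI)
        fix u' v assume u': "u' < Suc u" "v < n"
        show "(ar (setv vU (Suc u) \<tau>2) aDM (ra u' + v) = 0) = (\<not> near u' v)"
        proof (cases "u' = u")
          case True
          then show ?thesis using 2(1) u'(2) by simp
        next
          case False
          \<comment> \<open>Row \<open>u'\<close> was finished earlier and shares no address with
            row \<open>u\<close>.\<close>
          have *: "\<forall>v' < n. ra u' + v \<noteq> ra u + v'" using ra_inj[OF u'(2)] False by blast
          then have "ar \<tau>2 aDM (ra u' + v) = ar ?t aDM (ra u' + v)" using 2(1) by blast
          also have "\<dots> = ar \<tau>1 aDM (ra u' + v)"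
            unfolding ta using * u by simp
          also have "\<dots> = ar \<tau> aDM (ra u' + v)" using f1 * by blast
          finally show ?thesis using 6(2) u' False by simp
        qed
      qed
    qed
  qed
next
  case (7 \<tau>)
  have "env0 \<tau>" by (rule env0_frame[OF 7(2) _ _ assms]) (auto simp: c_relax_def)
  then show ?case using 7(1) env0D(1)[OF assms] by (simp add: env_def)
qed (use nB env0D(1)[OF assms] in \<open>simp_all add: c_relax_def\<close>)

end


section \<open>Enumerating moves\<close>

text \<open>
  The bits of \<open>g\<close> select, for each agent, a set of neighbours of its current vertex; the agent moves
  to the last one selected and stays if there is none.  Hence every \<open>g\<close> encodes a legal choice.
\<close>

definition c_decode :: com where
  "c_decode =
     Assign vX (V vG) ;;
     For vI vK (
       Put aNEW (V vI) (Idx aCUR (V vI)) ;;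
       For vV vN (When (Adj (Idx aCUR (V vI)) (V vV)) (
         When (Minus (V vX) (Plus (Hlf (V vX)) (Hlf (V vX)))) (Put aNEW (V vI) (V vV)) ;;
         Assign vX (Hlf (V vX)))))"

text \<open>There is one bit per neighbour of each agent's vertex, so one doubling for each gives
  the number of patterns.\<close>

definition c_count :: com where
  "c_count =
     Assign vGG (N 1) ;;
     For vI vK (For vV vN (When (Adj (Idx aCUR (V vI)) (V vV)) (Assign vGG (Plus (V vGG) (V vGG)))))"

definition c_pairs :: com where
  "c_pairs =
     For vI vK (For vJ vK (Unless (Eq (V vI) (V vJ)) (
       When (Eq (Idx aNEW (V vI)) (Idx aNEW (V vJ))) (Assign vOK (N 0)) ;;
       When (Eq (Idx aNEW (V vI)) (Idx aCUR (V vJ)))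
         (When (Eq (Idx aNEW (V vJ)) (Idx aCUR (V vI))) (Assign vOK (N 0))))))"

definition c_marked :: com where
  "c_marked = For vI vK (Unless (Idx aMARK (V vI)) (Assign vOK (N 0)))"

text \<open>\<open>e\<close> may mention the agent counter \<open>vI\<close>; it is evaluated anew
  for every agent and so stands for a whole tuple.\<close>

definition c_match :: "aexp \<Rightarrow> com" where
  "c_match e =
     Assign vEQ (N 1) ;;
     For vI vK (Unless (Eq (Idx aQ (Plus (Idx aQO (V vQ)) (V vI))) e) (Assign vEQ (N 0)))"

definition c_dup :: com where
  "c_dup = For vQ vLEN (c_match (Idx aNEW (V vI)) ;; When (V vEQ) (Assign vOK (N 0)))"

definition c_append :: com where
  "c_append =
     Put aQO (V vLEN) (V vFP) ;;
     For vI vK (Put aQ (Plus (V vFP) (V vI)) (Idx aNEW (V vI))) ;;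
     Assign vFP (Plus (V vFP) (V vK)) ;; Assign vLEN (Plus (V vLEN) (N 1))"

context problem
begin

text \<open>The invariant says that the marks lie within reach of agent 0 and, after
  \<open>r\<close> rounds, are closed under \<open>E\<close> or number more than \<open>r\<close>.
  There are at most \<open>k\<close> of them, so \<open>k\<close> rounds leave a closed set, and a
  closed set containing 0 is all that is reachable. For \<open>k = 0\<close> the mark at index 0
  belongs to no agent.\<close>

lemma flood_correct:
  assumes "env \<sigma>" "\<And>i. i < k \<Longrightarrow> ar \<sigma> aNEW i < n"
  defines "E \<equiv> {(i, j). i < k \<and> j < k \<and> near (ar \<sigma> aNEW i) (ar \<sigma> aNEW j)}"
  shows "runs B c_flood \<sigma> (\<lambda>\<tau>. \<forall>i < k. (0 < ar \<tau> aMARK i) = ((0, i) \<in> E\<^sup>*))"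
proof -
  define M where "M \<tau> = {i. i < k \<and> 0 < ar \<tau> aMARK i}" for \<tau> :: st
  have M_setv [simp]: "M (setv x c \<tau>) = M \<tau>" for x c \<tau>
    by (simp add: M_def)
  have M_fin: "finite (M \<tau>)" "M \<tau> \<subseteq> {..<k}" for \<tau>
    by (auto simp: M_def)
  have e: "env \<tau>" "ar \<tau> aNEW = ar \<sigma> aNEW" if "frame X Y \<sigma> \<tau>" "X \<inter> {2, 3, 4, 5} = {}" "Y \<inter> {0, 2, 3, 7} = {}" for X Y \<tau>
    using that env_frame[OF that(1) _ _ assms(1)] by (auto simp: frame_def)
  let ?init = "For vI vK (Put aMARK (V vI) (N 0))"
  have init: "runs B ?init \<sigma> (\<lambda>\<tau>. \<forall>i < k. ar \<tau> aMARK i = 0)"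
    by (rule runs_For[where I = "\<lambda>j \<tau>. \<forall>i < j. ar \<tau> aMARK i = 0"])
      (use envD(2)[OF assms(1)] kB in \<open>auto intro!: runs_Put simp: less_Suc_eq\<close>)
  show ?thesis
    unfolding c_flood_def
  proof (rule runs_Seq'[OF init], rule runs_Seq, rule runs_Put, goal_cases)
    case (1 \<tau>0)
    let ?s = "seta aMARK (aval (N 0) \<tau>0) (aval (N 1) \<tau>0) \<tau>0"
    have Ms: "M ?s = (if 0 < k then {0} else {})"
      using 1(1) by (auto simp: M_def)
    have es: "env ?s" "ar ?s aNEW = ar \<sigma> aNEW"
    proof -
      have "frame {10} {1} \<sigma> ?s" using 1(2) by (auto simp: frame_def)
      from e[OF this] show "env ?s" "ar ?s aNEW = ar \<sigma> aNEW" by simp_all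
    qed
    let ?J = "\<lambda>\<tau>. M \<tau> \<subseteq> E\<^sup>* `` {0} \<and> (0 < k \<longrightarrow> 0 \<in> M \<tau>)"
    show ?case
    proof (rule runs_For[where I = "\<lambda>r \<tau>. ?J \<tau> \<and> (0 < k \<longrightarrow> E `` M \<tau> \<subseteq> M \<tau> \<or> r < card (M \<tau>))"], goal_cases)
      case (6 r \<tau>)
      define M0 where "M0 = M \<tau>"
      have t: "env \<tau>" "ar \<tau> aNEW = ar \<sigma> aNEW"
        using env_frame[OF 6(4) _ _ es(1)] 6(4) es(2) by (auto simp: frame_def)
      let ?I = "\<lambda>i \<tau>'. ?J \<tau>' \<and> M0 \<subseteq> M \<tau>' \<and> (\<forall>i' < i. i' \<in> M0 \<longrightarrow> E `` {i'} \<subseteq> M \<tau>')"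
      show ?case
      proof (rule runs_For[where I = ?I], goal_cases)
        case I: (6 i \<tau>1)
        have i: "i < k" using I(1) envD(2)[OF t(1)] by simp
        have t1: "env \<tau>1" "ar \<tau>1 aNEW = ar \<sigma> aNEW"
          using env_frame[OF I(4) _ _ t(1)] I(4) t(2) by (auto simp: frame_def)
        show ?case
        proof (rule runs_For[where I = "\<lambda>j \<tau>'. ?I i \<tau>' \<and> (i \<in> M0 \<longrightarrow> (\<forall>j' < j. (i, j') \<in> E \<longrightarrow> j' \<in> M \<tau>'))"], goal_cases)
          case J: (6 j \<tau>2)
          have j: "j < k" using J(1) envD(2)[OF t1(1)] by simp
          have t2: "env \<tau>2" "ar \<tau>2 aNEW = ar \<sigma> aNEW" "vr \<tau>2 vI = i"
            using env_frame[OF J(4) _ _ t1(1)] J(4) t1(2) I(3) by (auto simp: frame_def)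
          have nr: "(0 < ar \<tau>2 aDM (ar \<tau>2 aROW (ar \<tau>2 aNEW i) + ar \<tau>2 aNEW j)) = ((i, j) \<in> E)"
            using envD(5,7)[OF t2(1)] assms(2) i j by (simp add: t2(2) E_def)
          let ?c = "When (Idx aMARK (V vI)) (When (Near (Idx aNEW (V vI)) (Idx aNEW (V vJ))) (Put aMARK (V vJ) (N 1)))"
          show ?case
          proof (cases "i \<in> M \<tau>2 \<and> (i, j) \<in> E")
            case True
            define \<tau>3 where "\<tau>3 = seta aMARK j 1 \<tau>2"
            have ex: "exec ?c \<tau>2 = \<tau>3"
              using True nr by (simp add: t2(3) J(3) \<tau>3_def M_def)
            have M3: "M \<tau>3 = insert j (M \<tau>2)" using j by (auto simp: M_def \<tau>3_def)
            have "(0, j) \<in> E\<^sup>*" using J(2) True by (auto intro: rtrancl_into_rtrancl)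
            then show ?thesis
              by (intro runs_exec'[OF ex]) (use J(2) in \<open>auto simp: M3 less_Suc_eq\<close>)
          next
            case False
            define \<tau>3 where "\<tau>3 = setv vSKIP 0 \<tau>2"
            have ex: "exec ?c \<tau>2 = \<tau>3"
              using False nr i by (auto simp: t2(3) J(3) \<tau>3_def M_def)
            show ?thesis
              by (intro runs_exec'[OF ex]) (use J(2) False in \<open>auto simp: \<tau>3_def less_Suc_eq\<close>)
          qed
        next
          case J: (7 \<tau>2)
          have "E `` {i} \<subseteq> M \<tau>2" if "i \<in> M0"
            using J(1) that envD(2)[OF t1(1)] by (auto simp: E_def)
          then show ?case using J(1) by (auto simp: less_Suc_eq)
        qed (use I(2) kB envD(2)[OF t1(1)] in simp_all)
      next
        case I: (7 \<tau>1)
        have E0: "E `` M0 \<subseteq> M \<tau>1"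
          using I(1) envD(2)[OF t(1)] M_fin(2)[of \<tau>] unfolding M0_def by fastforce
        have "E `` M \<tau>1 \<subseteq> M \<tau>1 \<or> Suc r < card (M \<tau>1)" if "0 < k"
        proof (cases "M \<tau>1 = M0")
          case True
          then show ?thesis using E0 by simp
        next
          case False
          then have lt: "M0 \<subset> M \<tau>1" using I(1) by blast
          have "card M0 < card (M \<tau>1)" using lt M_fin by (intro psubset_card_mono)
          \<comment> \<open>Had the marks been closed at the start of the round, they would contain
            everything reachable and could not have grown.\<close>
          moreover have "r < card M0"
          proof (rule ccontr)
            assume "\<not> r < card M0"
            then have cl: "E `` M0 \<subseteq> M0" using 6(2) that by (auto simp: M0_def)
            have "E\<^sup>* `` {0} \<subseteq> M0"
            proof
              fix j assume "j \<in> E\<^sup>* `` {0}"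
              then have "(0, j) \<in> E\<^sup>*" by simp
              then show "j \<in> M0"
                by (induction rule: rtrancl_induct) (use cl 6(2) that in \<open>auto simp: M0_def\<close>)
            qed
            then show False using lt I(1) by blast
          qed
          ultimately show ?thesis by simp
        qed
        then show ?case using I(1) by auto
      qed (use 6(2) kB envD(2)[OF t(1)] in \<open>simp_all add: M0_def\<close>)
    next
      case (7 \<tau>)
      have k: "vr ?s vK = k" using envD(2)[OF es(1)] .
      have cl: "E `` M \<tau> \<subseteq> M \<tau>" if "0 < k"
        using 7(1) that card_mono[OF _ M_fin(2), of \<tau>] unfolding k by auto
      show ?case
      proof (intro allI impI)
        fix i assume i: "i < k"
        have "E\<^sup>* `` {0} \<subseteq> M \<tau>"
        proof
          fix j assume "j \<in> E\<^sup>* `` {0}"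
          then have "(0, j) \<in> E\<^sup>*" by simp
          then show "j \<in> M \<tau>"
            by (induction rule: rtrancl_induct) (use cl 7(1) i in auto)
        qed
        then have "M \<tau> = E\<^sup>* `` {0}" using 7(1) by blast
        then show "(0 < ar \<tau> aMARK i) = ((0, i) \<in> E\<^sup>*)" using i by (auto simp: M_def)
      qed
    qed (use kB envD(2)[OF es(1)] Ms in auto)
  qed
qed

text \<open>
  \<open>out cs k g\<close> is the configuration that \<open>g\<close> selects from \<open>cs\<close>, together with the unused bits, and
  \<open>go cs k\<close> is the number of bit patterns; \<open>inn\<close> and \<open>gi\<close> are the same for a single agent.
\<close>

fun inn :: "nat \<Rightarrow> nat \<Rightarrow> nat \<Rightarrow> nat \<times> nat" where
  "inn c 0 x = (c, x)"
| "inn c (Suc v) x =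
     (let (w, y) = inn c v x in if adj c v then (if odd y then v else w, y div 2) else (w, y))"

fun out :: "nat list \<Rightarrow> nat \<Rightarrow> nat \<Rightarrow> nat list \<times> nat" where
  "out cs 0 x = ([], x)"
| "out cs (Suc i) x = (let (ws, y) = out cs i x; (w, z) = inn (cs ! i) n y in (ws @ [w], z))"

fun gi :: "nat \<Rightarrow> nat \<Rightarrow> nat" where
  "gi c 0 = 1"
| "gi c (Suc v) = (if adj c v then 2 * gi c v else gi c v)"

fun go :: "nat list \<Rightarrow> nat \<Rightarrow> nat" where
  "go cs 0 = 1"
| "go cs (Suc i) = go cs i * gi (cs ! i) n"

lemma inn_range: "fst (inn c m x) = c \<or> (adj c (fst (inn c m x)) \<and> fst (inn c m x) < m)"
  by (induction m) (auto simp: Let_def split: prod.split)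

text \<open>As the last selected neighbour wins, it suffices to set the bit of \<open>w\<close> and
  no later one. Quantifying over \<open>y\<close> says that exactly the low bits are consumed and
  the rest is passed on, which lets the patterns of successive agents be stacked.\<close>

lemma inn_surj:
  "w = c \<or> (adj c w \<and> w < m) \<Longrightarrow> \<exists>b < gi c m. \<forall>y. inn c m (b + gi c m * y) = (w, y)"
proof (induction m arbitrary: w)
  case 0
  then show ?case by simp
next
  case (Suc m)
  show ?case
  proof (cases "adj c m")
    case False
    then have "w = c \<or> (adj c w \<and> w < m)" using Suc.prems by (auto simp: less_Suc_eq)
    from Suc.IH[OF this] False show ?thesis by auto
  next
    case True
    show ?thesis
    proof (cases "w = m")
      case w: True
      \<comment> \<open>Take a pattern for staying and add the new top bit \<open>gi c m\<close>,
        which selects \<open>m\<close> last.\<close>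
      from Suc.IH[of c] obtain b where b: "b < gi c m" "\<And>y. inn c m (b + gi c m * y) = (c, y)" by auto
      have "inn c (Suc m) (b + gi c m + gi c (Suc m) * y) = (w, y)" for y
      proof -
        have "b + gi c m + gi c (Suc m) * y = b + gi c m * (2 * y + 1)" using True by (simp add: algebra_simps)
        then show ?thesis using True w unfolding inn.simps by (simp only: b(2)) simp
      qed
      moreover have "b + gi c m < gi c (Suc m)" using b(1) True by simp
      ultimately show ?thesis by blast
    next
      case False
      then have "w = c \<or> (adj c w \<and> w < m)" using Suc.prems by (auto simp: less_Suc_eq)
      from Suc.IH[OF this] obtain b where b: "b < gi c m" "\<And>y. inn c m (b + gi c m * y) = (w, y)" by auto
      have "inn c (Suc m) (b + gi c (Suc m) * y) = (w, y)" for y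
      proof -
        have "b + gi c (Suc m) * y = b + gi c m * (2 * y)" using True by (simp add: algebra_simps)
        then show ?thesis using True unfolding inn.simps by (simp only: b(2)) simp
      qed
      moreover have "b < gi c (Suc m)" using b(1) True by simp
      ultimately show ?thesis by blast
    qed
  qed
qed

lemma length_out [simp]: "length (fst (out cs i x)) = i"
  by (induction i) (auto simp: Let_def split: prod.split)

lemma out_range:
  "j < i \<Longrightarrow> fst (out cs i x) ! j = cs ! j \<or> (adj (cs ! j) (fst (out cs i x) ! j) \<and> fst (out cs i x) ! j < n)"
proof (induction i)
  case (Suc i)
  obtain ws y where o: "out cs i x = (ws, y)" by fastforce
  obtain w z where iw: "inn (cs ! i) n y = (w, z)" by fastforce
  have l: "length ws = i" using length_out[of cs i x] by (simp add: o)
  have w: "w = cs ! i \<or> (adj (cs ! i) w \<and> w < n)" using inn_range[of "cs ! i" n y] by (simp add: iw)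
  show ?case
  proof (cases "j = i")
    case True
    then show ?thesis using w l by (simp add: o iw nth_append)
  next
    case False
    then have "j < i" using Suc.prems by simp
    with Suc.IH[OF this] show ?thesis using l by (simp add: o iw nth_append)
  qed
qed simp

text \<open>Patterns are put together as in a mixed radix system: the one for agent \<open>i\<close>
  is shifted by the weight \<open>go cs i\<close> of all earlier agents.\<close>

lemma out_surj:
  "length ws = i \<Longrightarrow> (\<forall>j < i. ws ! j = cs ! j \<or> (adj (cs ! j) (ws ! j) \<and> ws ! j < n)) \<Longrightarrow>
     \<exists>b < go cs i. \<forall>y. out cs i (b + go cs i * y) = (ws, y)"
proof (induction i arbitrary: ws)
  case 0
  then show ?case by simp
next
  case (Suc i)
  then obtain ws' w where ws: "ws = ws' @ [w]" "length ws' = i" by (metis length_Suc_conv_rev)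
  have "\<forall>j < i. ws' ! j = cs ! j \<or> (adj (cs ! j) (ws' ! j) \<and> ws' ! j < n)"
    using Suc.prems(2) ws by (metis less_SucI nth_append)
  from Suc.IH[OF ws(2) this] obtain b where
    b: "b < go cs i" "\<And>y. out cs i (b + go cs i * y) = (ws', y)" by blast
  have "w = cs ! i \<or> (adj (cs ! i) w \<and> w < n)"
    using Suc.prems(2)[rule_format, of i] ws by (simp add: nth_append)
  from inn_surj[OF this] obtain b' where
    b': "b' < gi (cs ! i) n" "\<And>y. inn (cs ! i) n (b' + gi (cs ! i) n * y) = (w, y)" by blast
  let ?b = "b + go cs i * b'"
  have "out cs (Suc i) (?b + go cs (Suc i) * y) = (ws, y)" for y
  proof -
    have "?b + go cs (Suc i) * y = b + go cs i * (b' + gi (cs ! i) n * y)" by (simp add: algebra_simps)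
    then show ?thesis using ws(1) unfolding out.simps by (simp only: b(2) b'(2) Let_def prod.case)
  qed
  moreover have "?b < go cs (Suc i)"
  proof -
    have "go cs i * (b' + 1) \<le> go cs i * gi (cs ! i) n" using b'(1) by (intro mult_le_mono2) simp
    then show ?thesis using b(1) by simp
  qed
  ultimately show ?case by blast
qed

definition tup :: "(nat \<Rightarrow> nat) \<Rightarrow> nat list" where
  "tup f = map f [0..<k]"

lemma length_tup [simp]: "length (tup f) = k"
  by (simp add: tup_def)

lemma tup_nth [simp]: "i < k \<Longrightarrow> tup f ! i = f i"
  by (simp add: tup_def)

lemma decode_correct:
  assumes "env \<sigma>" "\<And>i. i < k \<Longrightarrow> ar \<sigma> aCUR i < n"
  shows "runs B c_decode \<sigma> (\<lambda>\<tau>. tup (ar \<tau> aNEW) = fst (out (tup (ar \<sigma> aCUR)) k (vr \<sigma> vG)))"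
  unfolding c_decode_def
proof (rule runs_Seq, rule runs_Assign)
  let ?s = "setv vX (aval (V vG) \<sigma>) \<sigma>"
  define cs where "cs = tup (ar \<sigma> aCUR)"
  have es: "env ?s" by (rule env_frame[OF _ _ _ assms(1), of "{14}" "{}"]) (auto simp: frame_def)
  let ?c = "Put aNEW (V vI) (Idx aCUR (V vI)) ;;
       For vV vN (When (Adj (Idx aCUR (V vI)) (V vV)) (
         When (Minus (V vX) (Plus (Hlf (V vX)) (Hlf (V vX)))) (Put aNEW (V vI) (V vV)) ;;
         Assign vX (Hlf (V vX))))"
  show "runs B (For vI vK ?c) ?s (\<lambda>\<tau>. tup (ar \<tau> aNEW) = fst (out cs k (vr \<sigma> vG)))"
  proof (rule runs_For[where I = "\<lambda>i \<tau>. (map (ar \<tau> aNEW) [0..<i], vr \<tau> vX) = out cs i (vr \<sigma> vG)"], goal_cases)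
    case (6 i \<tau>)
    have t: "env \<tau>" "ar \<tau> aCUR = ar \<sigma> aCUR"
      using env_frame[OF 6(4) _ _ es] 6(4) by (auto simp: frame_def)
    have i: "i < k" using 6(1) envD(2)[OF es] by simp
    have c: "ar \<sigma> aCUR i < n" "cs ! i = ar \<sigma> aCUR i" using assms(2) i by (simp_all add: cs_def)
    define x where "x = vr \<tau> vX"
    show ?case
    proof (rule runs_Seq, rule runs_Put,
        rule runs_For[where I = "\<lambda>v \<tau>'. (\<forall>j < i. ar \<tau>' aNEW j = ar \<tau> aNEW j) \<and> (ar \<tau>' aNEW i, vr \<tau>' vX) = inn (cs ! i) v x"], goal_cases)
      case V: (6 v \<tau>1)
      have t1: "env \<tau>1" "ar \<tau>1 aCUR = ar \<sigma> aCUR" "vr \<tau>1 vI = i"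
      proof -
        have fr: "frame {7, 14, 25} {7} \<tau> \<tau>1" using V(4) by (auto simp: frame_def)
        show "env \<tau>1" "ar \<tau>1 aCUR = ar \<sigma> aCUR" "vr \<tau>1 vI = i"
          using env_frame[OF fr _ _ t(1)] fr t(2) 6(3) by (auto simp: frame_def)
      qed
      have v: "v < n" using V(1) envD(1)[OF t(1)] by simp
      have ad: "(0 < ar \<tau>1 aIN (ra (ar \<sigma> aCUR i) + v)) = adj (cs ! i) v"
        using envD(6)[OF t1(1) c(1) v] c(2) by simp
      have row: "ar \<tau>1 aROW (ar \<sigma> aCUR i) = ra (ar \<sigma> aCUR i)" using envD(5)[OF t1(1) c(1)] .
      \<comment> \<open>Subtracting the doubled half is the machine's parity test.\<close>
      have od: "(y - (y div 2 + y div 2) = 0) = even y" for y :: nat by presburger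
      have inn': "inn (cs ! i) v x = (ar \<tau>1 aNEW i, vr \<tau>1 vX)" using V(2) by simp
      show ?case
        by (intro runs_exec)
          (use V(2,3) ad od in \<open>auto simp: t1 row inn' simp del: diff_is_0_eq\<close>)
    next
      case V: (7 \<tau>1)
      have "vr (seta aNEW (aval (V vI) \<tau>) (aval (Idx aCUR (V vI)) \<tau>) \<tau>) vN = n" using envD(1)[OF t(1)] by simp
      with V(1) have I: "\<forall>j < i. ar \<tau>1 aNEW j = ar \<tau> aNEW j" "inn (cs ! i) n x = (ar \<tau>1 aNEW i, vr \<tau>1 vX)" by simp_all
      have "out cs i (vr \<sigma> vG) = (map (ar \<tau> aNEW) [0..<i], x)" using 6(2) by (simp add: x_def)
      moreover have "map (ar \<tau>1 aNEW) [0..<i] = map (ar \<tau> aNEW) [0..<i]" using I(1) by simp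
      ultimately show ?case using I(2) by simp
    qed (use nB envD(1)[OF t(1)] t(2) 6(3) c(2) in \<open>simp_all add: x_def\<close>)
  next
    case (7 \<tau>)
    have "vr ?s vK = k" using envD(2)[OF es] .
    with 7(1) have "out cs k (vr \<sigma> vG) = (map (ar \<tau> aNEW) [0..<k], vr \<tau> vX)" by simp
    then show ?case by (simp add: tup_def)
  qed (use kB envD(2)[OF es] in simp_all)
qed

lemma count_correct:
  assumes "env \<sigma>" "\<And>i. i < k \<Longrightarrow> ar \<sigma> aCUR i < n"
  shows "runs B c_count \<sigma> (\<lambda>\<tau>. vr \<tau> vGG = go (tup (ar \<sigma> aCUR)) k)"
  unfolding c_count_def
proof (rule runs_Seq, rule runs_Assign)
  let ?s = "setv vGG (aval (N 1) \<sigma>) \<sigma>"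
  define cs where "cs = tup (ar \<sigma> aCUR)"
  have es: "env ?s" by (rule env_frame[OF _ _ _ assms(1), of "{13}" "{}"]) (auto simp: frame_def)
  let ?c = "For vV vN (When (Adj (Idx aCUR (V vI)) (V vV)) (Assign vGG (Plus (V vGG) (V vGG))))"
  show "runs B (For vI vK ?c) ?s (\<lambda>\<tau>. vr \<tau> vGG = go cs k)"
  proof (rule runs_For[where I = "\<lambda>i \<tau>. vr \<tau> vGG = go cs i"], goal_cases)
    case (6 i \<tau>)
    have t: "env \<tau>" "ar \<tau> aCUR = ar \<sigma> aCUR"
      using env_frame[OF 6(4) _ _ es] 6(4) by (auto simp: frame_def)
    have i: "i < k" using 6(1) envD(2)[OF es] by simp
    have c: "ar \<sigma> aCUR i < n" "cs ! i = ar \<sigma> aCUR i" using assms(2) i by (simp_all add: cs_def)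
    show ?case
    proof (rule runs_For[where I = "\<lambda>v \<tau>'. vr \<tau>' vGG = go cs i * gi (cs ! i) v"], goal_cases)
      case V: (6 v \<tau>1)
      have t1: "env \<tau>1" "ar \<tau>1 aCUR = ar \<sigma> aCUR" "vr \<tau>1 vI = i"
        using env_frame[OF V(4) _ _ t(1)] V(4) t(2) 6(3) by (auto simp: frame_def)
      have v: "v < n" using V(1) envD(1)[OF t(1)] by simp
      have ad: "(0 < ar \<tau>1 aIN (ra (ar \<sigma> aCUR i) + v)) = adj (cs ! i) v"
        using envD(6)[OF t1(1) c(1) v] c(2) by simp
      have row: "ar \<tau>1 aROW (ar \<sigma> aCUR i) = ra (ar \<sigma> aCUR i)" using envD(5)[OF t1(1) c(1)] .
      show ?case
        by (intro runs_exec) (use V(2,3) ad in \<open>auto simp: t1 row\<close>)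
    next
      case V: (7 \<tau>1)
      then show ?case using envD(1)[OF t(1)] by simp
    qed (use nB envD(1)[OF t(1)] 6(2) in simp_all)
  next
    case (7 \<tau>)
    then show ?case using envD(2)[OF es] by simp
  qed (use kB envD(2)[OF es] in simp_all)
qed

end


section \<open>Testing and storing configurations\<close>

text \<open>
  \<open>vOK\<close> starts out as \<open>k\<close> because the empty set of positions is not connected.
\<close>

definition c_trial :: com where
  "c_trial =
     c_decode ;; Assign vOK (V vK) ;; c_pairs ;; c_flood ;; c_marked ;; c_dup ;; When (V vOK) c_append"

definition c_expand :: com where
  "c_expand =
     Assign vP (Idx aQO (V vH)) ;;
     For vI vK (Put aCUR (V vI) (Idx aQ (Plus (V vP) (V vI)))) ;;
     c_count ;; For vG vGG c_trial"

definition c_start :: com where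
  "c_start =
     For vI vK (Put aQ (V vI) (Idx aIN (Plus (N 4) (V vI)))) ;;
     Put aQO (N 0) (N 0) ;; Assign vLEN (N 1) ;; Assign vFP (V vK) ;;
     Assign vT (N 0) ;; Assign vGO (V vL)"

text \<open>
  A round extends the queue from the configurations reachable in \<open>r\<close> steps to those reachable in
  \<open>r + 1\<close>; the search stops after \<open>l\<close> rounds or when a round finds nothing new.
\<close>

definition c_round :: com where
  "c_round =
     Assign vLEN0 (V vLEN) ;; For vH vLEN0 c_expand ;;
     Assign vT (Plus (V vT) (N 1)) ;;
     com.If (Minus (V vLEN) (V vLEN0)) (Assign vGO (Minus (V vL) (V vT))) (Assign vGO (N 0))"

definition c_final :: com where
  "c_final =
     Assign vANS (N 0) ;;
     For vQ vLEN (c_match (Idx aIN (Plus (Plus (N 4) (V vK)) (V vI))) ;; When (V vEQ) (Assign vANS (N 1)))"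

definition c_mapfcc :: com where
  "c_mapfcc = c_init ;; c_rows ;; c_dist ;; c_start ;; While (V vGO) c_round ;; c_final"

lemma mods [simp]:
  "mv c_decode = {7, 10, 14, 25}" "ma c_decode = {7}"
  "mv c_count = {7, 10, 13, 25}" "ma c_count = {}"
  "mv c_pairs = {10, 11, 15, 25}" "ma c_pairs = {}"
  "mv c_flood = {9, 10, 11, 25}" "ma c_flood = {1}"
  "mv c_marked = {10, 15, 25}" "ma c_marked = {}"
  "mv (c_match e) = {10, 22, 25}" "ma (c_match e) = {}"
  "mv c_dup = {10, 15, 21, 22, 25}" "ma c_dup = {}"
  "mv c_append = {10, 16, 19}" "ma c_append = {4, 5}"
  by (auto simp: c_decode_def c_count_def c_pairs_def c_flood_def c_marked_def c_match_def c_dup_def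
    c_append_def)

lemma mods' [simp]:
  "mv c_trial = {7, 9, 10, 11, 14, 15, 16, 19, 21, 22, 25}" "ma c_trial = {1, 4, 5, 7}"
  "mv c_expand = {7, 9, 10, 11, 12, 13, 14, 15, 16, 19, 20, 21, 22, 25}" "ma c_expand = {1, 4, 5, 6, 7}"
  "mv c_round = {7, 9, 10, 11, 12, 13, 14, 15, 16, 17, 18, 19, 20, 21, 22, 23, 25, 26}" "ma c_round = {1, 4, 5, 6, 7}"
  "mv c_start = {10, 16, 19, 23, 26}" "ma c_start = {4, 5}"
  by (auto simp: c_trial_def c_expand_def c_round_def c_start_def)

context problem
begin

text \<open>Reachability among agent indices rather than vertices, and from agent 0 only: this is
  what the marking computes.\<close>

definition conn :: "nat list \<Rightarrow> bool" where
  "conn c \<longleftrightarrow> (\<forall>i < k. (0, i) \<in> {(i, j). i < k \<and> j < k \<and> near (c ! i) (c ! j)}\<^sup>*)"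

definition clash_free :: "nat list \<Rightarrow> nat list \<Rightarrow> bool" where
  "clash_free c c' \<longleftrightarrow>
     (\<forall>i < k. \<forall>j < k. i \<noteq> j \<longrightarrow> c' ! i \<noteq> c' ! j \<and> \<not> (c' ! i = c ! j \<and> c' ! j = c ! i))"

text \<open>For \<open>k = 0\<close> the other conjuncts hold vacuously, but the empty set of
  positions is not connected; hence \<open>0 < k\<close>.\<close>

definition good :: "nat list \<Rightarrow> nat list \<Rightarrow> bool" where
  "good c c' \<longleftrightarrow> 0 < k \<and> clash_free c c' \<and> conn c'"

text \<open>
  Everything that can enter the queue.  The start configuration \<open>s0\<close> need not be connected.
\<close>

definition RS :: "nat list set" where
  "RS = insert s0 {c. length c = k \<and> set c \<subseteq> {..<n} \<and> 0 < k \<and> conn c}"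

definition stp :: "nat list \<Rightarrow> nat list \<Rightarrow> bool" where
  "stp c c' \<longleftrightarrow> length c' = k \<and> (\<forall>i < k. c' ! i < n \<and> (c' ! i = c ! i \<or> adj (c ! i) (c' ! i))) \<and> good c c'"

lemma RS_D: "c \<in> RS \<Longrightarrow> length c = k \<and> set c \<subseteq> {..<n}"
  using s0 by (auto simp: RS_def)

lemma RS_finite: "finite RS"
proof (rule finite_subset)
  show "RS \<subseteq> {c. set c \<subseteq> {..<n} \<and> length c = k}" using RS_D by auto
qed (simp add: finite_lists_length_eq)

lemma tup_eqI: "length c = k \<Longrightarrow> (\<And>i. i < k \<Longrightarrow> f i = c ! i) \<Longrightarrow> tup f = c"
  by (simp add: list_eq_iff_nth_eq)

lemma pairs_correct:
  assumes "env \<sigma>"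
  shows "runs B c_pairs \<sigma> (\<lambda>\<tau>. (0 < vr \<tau> vOK) =
     (0 < vr \<sigma> vOK \<and> clash_free (tup (ar \<sigma> aCUR)) (tup (ar \<sigma> aNEW))))"
proof -
  define P where "P i j \<longleftrightarrow> (i \<noteq> j \<longrightarrow> ar \<sigma> aNEW i \<noteq> ar \<sigma> aNEW j \<and>
    \<not> (ar \<sigma> aNEW i = ar \<sigma> aCUR j \<and> ar \<sigma> aNEW j = ar \<sigma> aCUR i))" for i j
  have cf: "clash_free (tup (ar \<sigma> aCUR)) (tup (ar \<sigma> aNEW)) \<longleftrightarrow> (\<forall>i < k. \<forall>j < k. P i j)"
    by (simp add: clash_free_def P_def)
  show ?thesis
    unfolding c_pairs_def cf
  proof (rule runs_For[where I = "\<lambda>i \<tau>. (0 < vr \<tau> vOK) = (0 < vr \<sigma> vOK \<and> (\<forall>i' < i. \<forall>j < k. P i' j))"], goal_cases)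
    case (6 i \<tau>)
    have t: "vr \<tau> vK = k" "ar \<tau> = ar \<sigma>"
      using 6(4) envD(2)[OF assms] by (auto simp: frame_def)
    show ?case
    proof (rule runs_For[where I = "\<lambda>j \<tau>'. (0 < vr \<tau>' vOK) = (0 < vr \<sigma> vOK \<and> (\<forall>i' < i. \<forall>j < k. P i' j) \<and> (\<forall>j' < j. P i j'))"], goal_cases)
      case J: (6 j \<tau>1)
      have t1: "ar \<tau>1 = ar \<sigma>" "vr \<tau>1 vI = i"
        using J(4) t 6(3) by (auto simp: frame_def)
      show ?case
        by (intro runs_exec)
          (use J(2,3) in \<open>auto simp: t1 P_def less_Suc_eq\<close>)
    next
      case J: (7 \<tau>1)
      then show ?case using t by (auto simp: less_Suc_eq)
    qed (use t kB 6(2) in simp_all)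
  next
    case (7 \<tau>)
    then show ?case using envD(2)[OF assms] by simp
  qed (use envD(2)[OF assms] kB in simp_all)
qed

lemma marked_correct:
  assumes "env \<sigma>"
  shows "runs B c_marked \<sigma> (\<lambda>\<tau>. (0 < vr \<tau> vOK) = (0 < vr \<sigma> vOK \<and> (\<forall>i < k. 0 < ar \<sigma> aMARK i)))"
  unfolding c_marked_def
proof (rule runs_For[where I = "\<lambda>i \<tau>. (0 < vr \<tau> vOK) = (0 < vr \<sigma> vOK \<and> (\<forall>i' < i. 0 < ar \<sigma> aMARK i'))"], goal_cases)
  case (6 i \<tau>)
  then have "ar \<tau> = ar \<sigma>" by (auto simp: frame_def)
  then show ?case
    by (intro runs_exec) (use 6(2,3) in \<open>auto simp: less_Suc_eq\<close>)
next
  case (7 \<tau>)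
  then show ?case using envD(2)[OF assms] by simp
qed (use envD(2)[OF assms] kB in simp_all)

definition qt :: "st \<Rightarrow> nat \<Rightarrow> nat list" where
  "qt \<tau> q = tup (\<lambda>i. ar \<tau> aQ (ar \<tau> aQO q + i))"

definition Qs :: "st \<Rightarrow> nat list set" where
  "Qs \<tau> = qt \<tau> ` {..<vr \<tau> vLEN}"

text \<open>Every entry ends below the free pointer \<open>vFP\<close>, so appending overwrites
  none. Distinct entries inside the finite set \<open>RS\<close> bound the queue length by
  \<open>card RS\<close>.\<close>

definition qinv :: "st \<Rightarrow> bool" where
  "qinv \<tau> \<longleftrightarrow> (\<forall>q < vr \<tau> vLEN. ar \<tau> aQO q + k \<le> vr \<tau> vFP) \<and> Qs \<tau> \<subseteq> RS \<and> inj_on (qt \<tau>) {..<vr \<tau> vLEN}"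

text \<open>Entries keep their places, so a loop counter over the queue stays meaningful while the
  queue grows.\<close>

definition extends :: "st \<Rightarrow> st \<Rightarrow> bool" where
  "extends \<sigma> \<tau> \<longleftrightarrow> vr \<sigma> vLEN \<le> vr \<tau> vLEN \<and> (\<forall>q < vr \<sigma> vLEN. qt \<tau> q = qt \<sigma> q)"

lemma qt_cong: "ar \<tau> 4 = ar \<sigma> 4 \<Longrightarrow> ar \<tau> 5 = ar \<sigma> 5 \<Longrightarrow> qt \<tau> = qt \<sigma>"
  by (simp add: qt_def fun_eq_iff)

lemma q_frame:
  assumes "frame X Y \<sigma> \<tau>" "X \<inter> {16, 19} = {}" "Y \<inter> {4, 5} = {}"
  shows "qt \<tau> = qt \<sigma>" "Qs \<tau> = Qs \<sigma>" "qinv \<tau> = qinv \<sigma>" "vr \<tau> 16 = vr \<sigma> 16" "vr \<tau> 19 = vr \<sigma> 19"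
proof -
  have a: "ar \<tau> 4 = ar \<sigma> 4" "ar \<tau> 5 = ar \<sigma> 5" and v: "vr \<tau> 16 = vr \<sigma> 16" "vr \<tau> 19 = vr \<sigma> 19"
    using assms by (auto simp: frame_def)
  show q: "qt \<tau> = qt \<sigma>" by (rule qt_cong[OF a])
  then show Q: "Qs \<tau> = Qs \<sigma>" by (simp add: Qs_def v)
  show "qinv \<tau> = qinv \<sigma>" by (simp add: qinv_def q Q v a)
  show "vr \<tau> 16 = vr \<sigma> 16" "vr \<tau> 19 = vr \<sigma> 19" by (fact v)+
qed

lemma qt_setv [simp]: "qt (setv x v \<tau>) = qt \<tau>"
  by (rule qt_cong) simp_all

lemma q_setv [simp]:
  "x \<noteq> 16 \<Longrightarrow> Qs (setv x v \<tau>) = Qs \<tau>"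
  "x \<noteq> 16 \<Longrightarrow> x \<noteq> 19 \<Longrightarrow> qinv (setv x v \<tau>) = qinv \<tau>"
  by (simp_all add: Qs_def qinv_def)

lemma extends_setv [simp]: "x \<noteq> 16 \<Longrightarrow> extends \<sigma> (setv x v \<tau>) = extends \<sigma> \<tau>"
  by (simp add: extends_def)

lemma extends_refl: "extends \<sigma> \<sigma>"
  by (simp add: extends_def)

lemma extends_trans: "extends \<sigma> \<tau> \<Longrightarrow> extends \<tau> \<upsilon> \<Longrightarrow> extends \<sigma> \<upsilon>"
  by (auto simp: extends_def)

lemma match_correct:
  assumes "env \<sigma>"
    and "\<And>i \<tau>. i < k \<Longrightarrow> vr \<tau> vI = i \<Longrightarrow> frame {10, 22, 25} {} \<sigma> \<tau> \<Longrightarrow> aval e \<tau> = x i"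
  shows "runs B (c_match e) \<sigma> (\<lambda>\<tau>. (0 < vr \<tau> vEQ) = (qt \<sigma> (vr \<sigma> vQ) = tup x))"
  unfolding c_match_def
proof (rule runs_Seq, rule runs_Assign, rule runs_For[where
    I = "\<lambda>i \<tau>. (0 < vr \<tau> vEQ) = (\<forall>j < i. ar \<sigma> aQ (ar \<sigma> aQO (vr \<sigma> vQ) + j) = x j)"], goal_cases)
  case (6 i \<tau>)
  have fr: "frame {10, 22, 25} {} \<sigma> \<tau>" using 6(4) by (auto simp: frame_def)
  have i: "i < k" using 6(1) envD(2)[OF assms(1)] by simp
  have t: "ar \<tau> = ar \<sigma>" "vr \<tau> vQ = vr \<sigma> vQ" using fr by (auto simp: frame_def)
  show ?case
    by (intro runs_exec)
      (use 6(2,3) in \<open>auto simp: t assms(2)[OF i 6(3) fr] less_Suc_eq\<close>)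
next
  case (7 \<tau>)
  then show ?case using envD(2)[OF assms(1)] by (simp add: qt_def list_eq_iff_nth_eq)
qed (use envD(2)[OF assms(1)] kB in simp_all)

lemma append_correct:
  assumes "env \<sigma>" "qinv \<sigma>" "tup (ar \<sigma> aNEW) \<in> RS" "tup (ar \<sigma> aNEW) \<notin> Qs \<sigma>"
  shows "runs B c_append \<sigma> (\<lambda>\<tau>. qinv \<tau> \<and> extends \<sigma> \<tau> \<and> Qs \<tau> = insert (tup (ar \<sigma> aNEW)) (Qs \<sigma>))"
  unfolding c_append_def
proof (rule runs_Seq, rule runs_Put, rule runs_Seq'[where P = "\<lambda>\<tau>. (\<forall>a < vr \<sigma> vFP. ar \<tau> aQ a = ar \<sigma> aQ a) \<and>
    (\<forall>i < k. ar \<tau> aQ (vr \<sigma> vFP + i) = ar \<sigma> aNEW i)"], goal_cases)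
  case 1
  let ?s = "seta aQO (aval (V vLEN) \<sigma>) (aval (V vFP) \<sigma>) \<sigma>"
  show ?case
  proof (rule runs_For[where I = "\<lambda>i \<tau>. (\<forall>a < vr \<sigma> vFP. ar \<tau> aQ a = ar \<sigma> aQ a) \<and>
      (\<forall>i' < i. ar \<tau> aQ (vr \<sigma> vFP + i') = ar \<sigma> aNEW i')"], goal_cases)
    case (6 i \<tau>)
    have t: "ar \<tau> aNEW = ar \<sigma> aNEW" "vr \<tau> vFP = vr \<sigma> vFP" using 6(4) by (auto simp: frame_def)
    show ?case
      by (intro runs_exec) (use 6(2,3) in \<open>auto simp: t less_Suc_eq\<close>)
  next
    case (7 \<tau>)
    then show ?case using envD(2)[OF assms(1)] by simp
  qed (use envD(2)[OF assms(1)] kB in simp_all)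
next
  case (2 \<tau>)
  have v: "vr \<tau> vFP = vr \<sigma> vFP" "vr \<tau> vLEN = vr \<sigma> vLEN" "vr \<tau> vK = k"
    and qo: "ar \<tau> aQO = (ar \<sigma> aQO)(vr \<sigma> vLEN := vr \<sigma> vFP)"
    using 2(2) envD(2)[OF assms(1)] by (auto simp: frame_def)
  define \<upsilon> where "\<upsilon> = setv vLEN (Suc (vr \<sigma> vLEN)) (setv vFP (vr \<sigma> vFP + k) \<tau>)"
  have ex: "exec (Assign vFP (Plus (V vFP) (V vK)) ;; Assign vLEN (Plus (V vLEN) (N 1))) \<tau> = \<upsilon>"
    by (simp add: \<upsilon>_def v)
  have old: "qt \<upsilon> q = qt \<sigma> q" if "q < vr \<sigma> vLEN" for q
  proof (rule tup_eqI[of "qt \<sigma> q" "\<lambda>i. ar \<upsilon> aQ (ar \<upsilon> aQO q + i)", folded qt_def])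
    fix i assume i: "i < k"
    have "ar \<sigma> aQO q + k \<le> vr \<sigma> vFP" using assms(2) that by (simp add: qinv_def)
    then have "ar \<sigma> aQO q + i < vr \<sigma> vFP" using i by simp
    then show "ar \<upsilon> aQ (ar \<upsilon> aQO q + i) = qt \<sigma> q ! i"
      using 2(1) that i by (simp add: \<upsilon>_def qo qt_def)
  qed (simp add: qt_def)
  have new: "qt \<upsilon> (vr \<sigma> vLEN) = tup (ar \<sigma> aNEW)"
    using 2(1) by (simp add: qt_def \<upsilon>_def qo list_eq_iff_nth_eq)
  have Q: "Qs \<upsilon> = insert (tup (ar \<sigma> aNEW)) (Qs \<sigma>)"
    using old new by (auto simp: Qs_def \<upsilon>_def[THEN arg_cong[of _ _ vr]] lessThan_Suc)
  have "inj_on (qt \<upsilon>) {..<vr \<sigma> vLEN}"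
    using assms(2) old by (auto simp: qinv_def inj_on_def)
  then have "inj_on (qt \<upsilon>) {..<vr \<upsilon> vLEN}"
    using assms(4) old new by (auto simp: \<upsilon>_def[THEN arg_cong[of _ _ vr]] lessThan_Suc Qs_def)
  moreover have "\<forall>q < vr \<upsilon> vLEN. ar \<upsilon> aQO q + k \<le> vr \<upsilon> vFP"
    using assms(2) by (auto simp: qinv_def \<upsilon>_def qo less_Suc_eq intro: le_trans)
  ultimately have "qinv \<upsilon>" using assms(2,3) Q by (simp add: qinv_def)
  moreover have "extends \<sigma> \<upsilon>" using old by (simp add: extends_def \<upsilon>_def[THEN arg_cong[of _ _ vr]])
  ultimately show ?case
    by (intro runs_exec'[OF ex]) (use Q in simp_all)
qed

end

text \<open>The queue length and the number of move patterns are the loop lengths that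
  \<open>n\<close>, \<open>k\<close> and \<open>d\<close> do not bound directly; the counting behind
  \<open>bounded_problemI\<close> supplies these two bounds.\<close>

locale bounded_problem = problem +
  assumes RSB: "card RS \<le> B"
    and goB: "\<And>c. length c = k \<Longrightarrow> set c \<subseteq> {..<n} \<Longrightarrow> go c k \<le> B"
begin

lemma qinv_len: "qinv \<tau> \<Longrightarrow> vr \<tau> vLEN \<le> B"
proof -
  assume q: "qinv \<tau>"
  then have "vr \<tau> vLEN = card (Qs \<tau>)" by (simp add: qinv_def Qs_def card_image)
  also have "\<dots> \<le> card RS" using q RS_finite by (intro card_mono) (auto simp: qinv_def)
  finally show ?thesis using RSB by simp
qed

lemma dup_correct:
  assumes "env \<sigma>" "qinv \<sigma>"
  shows "runs B c_dup \<sigma> (\<lambda>\<tau>. (0 < vr \<tau> vOK) = (0 < vr \<sigma> vOK \<and> tup (ar \<sigma> aNEW) \<notin> Qs \<sigma>))"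
  unfolding c_dup_def
proof (rule runs_For[where I = "\<lambda>q \<tau>. (0 < vr \<tau> vOK) = (0 < vr \<sigma> vOK \<and> (\<forall>q' < q. qt \<sigma> q' \<noteq> tup (ar \<sigma> aNEW)))"], goal_cases)
  case (6 q \<tau>)
  have t: "env \<tau>" using env_frame[OF 6(4) _ _ assms(1)] by simp
  have a: "ar \<tau> = ar \<sigma>" using 6(4) by (auto simp: frame_def)
  have qq: "qt \<tau> = qt \<sigma>" by (rule qt_cong) (simp_all add: a)
  show ?case
  proof (rule runs_Seq'[OF match_correct[OF t, of _ "ar \<sigma> aNEW"]], goal_cases)
    case (1 i \<tau>1)
    then show ?case using a by (simp add: frame_def)
  next
    case (2 \<tau>1)
    have "vr \<tau>1 vOK = vr \<tau> vOK" using 2(2) by (simp add: frame_def)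
    then show ?case
      by (intro runs_exec) (use 2(1) 6(2,3) in \<open>auto simp: qq less_Suc_eq\<close>)
  qed
next
  case (7 \<tau>)
  have "(tup (ar \<sigma> aNEW) \<in> Qs \<sigma>) = (\<exists>q' < vr \<sigma> vLEN. qt \<sigma> q' = tup (ar \<sigma> aNEW))"
    unfolding Qs_def by force
  with 7 show ?case by auto
qed (use qinv_len[OF assms(2)] in simp_all)

text \<open>The duplicate test leaves no trace in the resulting set, as a union absorbs repetitions;
  it serves the distinctness required by \<open>qinv\<close>.\<close>

lemma trial_correct:
  assumes "env \<sigma>" "qinv \<sigma>" "\<And>i. i < k \<Longrightarrow> ar \<sigma> aCUR i < n"
  defines "c \<equiv> tup (ar \<sigma> aCUR)"
  defines "c' \<equiv> fst (out c k (vr \<sigma> vG))"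
  shows "runs B c_trial \<sigma> (\<lambda>\<tau>. qinv \<tau> \<and> extends \<sigma> \<tau> \<and> Qs \<tau> = Qs \<sigma> \<union> (if good c c' then {c'} else {}))"
proof -
  have c'n: "c' ! i < n" if "i < k" for i
    using out_range[OF that, of c "vr \<sigma> vG"] assms(3)[OF that] that by (auto simp: c'_def c_def)
  have lc': "length c' = k" by (simp add: c'_def)
  show ?thesis
    unfolding c_trial_def
  proof (rule runs_Seq'[OF decode_correct[OF assms(1,3)]], goal_cases)
    case (2 \<tau>1)
    have new1: "tup (ar \<tau>1 aNEW) = c'" using 2(1) by (simp add: c'_def c_def)
    have f1: "frame {7, 10, 14, 25} {7} \<sigma> \<tau>1" using 2(2) by simp
    define \<tau>2 where "\<tau>2 = setv vOK k \<tau>1"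
    have a2: "aval (V vK) \<tau>1 = k" using f1 envD(2)[OF assms(1)] by (simp add: frame_def)
    have f2: "frame {7, 10, 14, 15, 25} {7} \<sigma> \<tau>2" using f1 by (auto simp: frame_def \<tau>2_def)
    have e2: "env \<tau>2" using env_frame[OF f2 _ _ assms(1)] by simp
    have c2: "tup (ar \<tau>2 aCUR) = c" "tup (ar \<tau>2 aNEW) = c'" "vr \<tau>2 vOK = k"
      using f2 new1 by (simp_all add: frame_def c_def \<tau>2_def)
    show ?case
    proof (rule runs_Seq, rule runs_Assign, unfold a2, fold \<tau>2_def, rule runs_Seq'[OF pairs_correct[OF e2]], goal_cases)
      case (1 \<tau>3)
      have f3: "frame {10, 11, 15, 25} {} \<tau>2 \<tau>3" using 1(2) by simp
      have e3: "env \<tau>3" using env_frame[OF f3 _ _ e2] by simp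
      have n3: "tup (ar \<tau>3 aNEW) = c'" using f3 c2 by (simp add: frame_def)
      have ok3: "(0 < vr \<tau>3 vOK) = (0 < k \<and> clash_free c c')" using 1(1) c2 by simp
      have nth3: "ar \<tau>3 aNEW i = c' ! i" if "i < k" for i using n3 that by (metis tup_nth)
      have lt3: "ar \<tau>3 aNEW i < n" if "i < k" for i using nth3[OF that] c'n[OF that] by simp
      show ?case
      proof (rule runs_Seq'[OF flood_correct[OF e3 lt3]], goal_cases)
        case (2 \<tau>4)
        have f4: "frame {9, 10, 11, 25} {1} \<tau>3 \<tau>4" using 2(2) by simp
        have e4: "env \<tau>4" using env_frame[OF f4 _ _ e3] by simp
        have n4: "tup (ar \<tau>4 aNEW) = c'" "vr \<tau>4 vOK = vr \<tau>3 vOK" using f4 n3 by (simp_all add: frame_def)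
        have "{(i, j). i < k \<and> j < k \<and> near (ar \<tau>3 aNEW i) (ar \<tau>3 aNEW j)} =
            {(i, j). i < k \<and> j < k \<and> near (c' ! i) (c' ! j)}"
          using nth3 by auto
        with 2(1) have m4: "(\<forall>i < k. 0 < ar \<tau>4 aMARK i) = conn c'" by (simp add: conn_def)
        show ?case
        proof (rule runs_Seq'[OF marked_correct[OF e4]], goal_cases)
          case (1 \<tau>5)
          have f5: "frame {10, 15, 25} {} \<tau>4 \<tau>5" using 1(2) by simp
          have e5: "env \<tau>5" using env_frame[OF f5 _ _ e4] by simp
          have n5: "tup (ar \<tau>5 aNEW) = c'" using f5 n4 by (simp add: frame_def)
          have ok5: "(0 < vr \<tau>5 vOK) = good c c'" using 1(1) m4 n4 ok3 by (simp add: good_def)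
          have q5: "qt \<tau>5 = qt \<sigma>" "Qs \<tau>5 = Qs \<sigma>" "qinv \<tau>5 = qinv \<sigma>" "vr \<tau>5 16 = vr \<sigma> 16"
            using q_frame[OF f5] q_frame[OF f4] q_frame[OF f3] q_frame[OF f2] by simp_all
          have qi5: "qinv \<tau>5" using q5(3) assms(2) by simp
          show ?case
          proof (rule runs_Seq'[OF dup_correct[OF e5 qi5]], goal_cases)
            case (1 \<tau>6)
            have f6: "frame {10, 15, 21, 22, 25} {} \<tau>5 \<tau>6" using 1(2) by simp
            have e6: "env \<tau>6" using env_frame[OF f6 _ _ e5] by simp
            have q6: "qt \<tau>6 = qt \<sigma>" "Qs \<tau>6 = Qs \<sigma>" "qinv \<tau>6" "vr \<tau>6 16 = vr \<sigma> 16"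
              using q_frame[OF f6] q5 qi5 by simp_all
            have n6: "tup (ar \<tau>6 aNEW) = c'" using f6 n5 by (simp add: frame_def)
            have ok6: "(0 < vr \<tau>6 vOK) = (good c c' \<and> c' \<notin> Qs \<sigma>)" using 1(1) n5 q5(2) ok5 by simp
            have ext6: "extends \<sigma> \<tau>6" by (simp add: extends_def q6)
            show ?case
            proof (rule runs_If, goal_cases)
              case 1
              then have g: "good c c'" "c' \<notin> Qs \<sigma>" using ok6 by auto
              have "c' \<in> RS" using g(1) lc' c'n by (auto simp: RS_def good_def in_set_conv_nth)
              show ?case
                by (rule runs_conseq[OF append_correct[OF e6 q6(3)]])
                  (use g \<open>c' \<in> RS\<close> n6 q6 extends_trans[OF ext6] in auto)
            next
              case 2
              then have "\<not> good c c' \<or> c' \<in> Qs \<sigma>" using ok6 by auto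
              then show ?case
                by (intro runs_Assign) (use q6 ext6 in auto)
            qed
          qed
        qed
      qed
    qed
  qed
qed

end


section \<open>Breadth-first search\<close>

context problem
begin

text \<open>\<open>out_surj\<close> at \<open>y = 0\<close> supplies a pattern for each legal move,
  \<open>out_range\<close> shows that every pattern is legal; so the loop over \<open>g\<close>
  misses no successor.\<close>

lemma stp_iff_out:
  assumes "length c = k" "set c \<subseteq> {..<n}"
  shows "stp c c' \<longleftrightarrow> (\<exists>g < go c k. c' = fst (out c k g) \<and> good c c')"
proof
  assume s: "stp c c'"
  then have "length c' = k" "\<forall>j < k. c' ! j = c ! j \<or> (adj (c ! j) (c' ! j) \<and> c' ! j < n)"
    by (auto simp: stp_def)
  from out_surj[OF this] obtain b where "b < go c k" "\<And>y. out c k (b + go c k * y) = (c', y)" by blast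
  from this(1) this(2)[of 0] show "\<exists>g < go c k. c' = fst (out c k g) \<and> good c c'"
    using s by (intro exI[of _ b]) (simp add: stp_def)
next
  assume "\<exists>g < go c k. c' = fst (out c k g) \<and> good c c'"
  then obtain g where g: "c' = fst (out c k g)" "good c c'" by blast
  have "c' ! i < n \<and> (c' ! i = c ! i \<or> adj (c ! i) (c' ! i))" if "i < k" for i
  proof -
    have "c ! i < n" using assms that by (auto simp: subset_iff)
    then show ?thesis using out_range[OF that, of c g] g(1) by auto
  qed
  then show "stp c c'" using g by (simp add: stp_def)
qed

text \<open>The levels are cumulative, since the makespan may be anything up to the bound.\<close>

fun reach :: "nat \<Rightarrow> nat list set" where
  "reach 0 = {s0}"
| "reach (Suc r) = reach r \<union> {c'. \<exists>c \<in> reach r. stp c c'}"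

text \<open>This licenses stopping at the first round without a discovery.\<close>

lemma reach_fixed: "reach (Suc r) = reach r \<Longrightarrow> reach (r + j) = reach r"
proof (induction j)
  case (Suc j)
  then have "reach (r + Suc j) = reach r \<union> {c'. \<exists>c \<in> reach r. stp c c'}" by simp
  then show ?case using Suc.prems by simp
qed simp

lemma Qs_mem:
  assumes "qinv \<sigma>" "q < vr \<sigma> vLEN"
  shows "length (qt \<sigma> q) = k" "set (qt \<sigma> q) \<subseteq> {..<n}"
  using assms RS_D[of "qt \<sigma> q"] by (auto simp: qinv_def Qs_def)

end

context bounded_problem
begin

lemma expand_correct:
  assumes "env \<sigma>" "qinv \<sigma>" "vr \<sigma> vH < vr \<sigma> vLEN"
  shows "runs B c_expand \<sigma> (\<lambda>\<tau>. qinv \<tau> \<and> extends \<sigma> \<tau> \<and> Qs \<tau> = Qs \<sigma> \<union> {c'. stp (qt \<sigma> (vr \<sigma> vH)) c'})"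
proof -
  define c where "c = qt \<sigma> (vr \<sigma> vH)"
  note cn = Qs_mem[OF assms(2,3), folded c_def]
  show ?thesis
    unfolding c_expand_def c_def[symmetric]
  proof (rule runs_Seq, rule runs_Assign, rule runs_Seq'[where P = "\<lambda>\<tau>. tup (ar \<tau> aCUR) = c"], goal_cases)
    case 1
    let ?s = "setv vP (aval (Idx aQO (V vH)) \<sigma>) \<sigma>"
    have k: "vr ?s vK = k" using envD(2)[OF assms(1)] by simp
    show ?case
    proof (rule runs_For[where I = "\<lambda>i \<tau>. \<forall>i' < i. ar \<tau> aCUR i' = ar \<sigma> aQ (ar \<sigma> aQO (vr \<sigma> vH) + i')"], goal_cases)
      case (6 i \<tau>)
      have "ar \<tau> aQ = ar \<sigma> aQ" "vr \<tau> vP = ar \<sigma> aQO (vr \<sigma> vH)" using 6(4) by (auto simp: frame_def)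
      then show ?case by (intro runs_exec) (use 6(2,3) in \<open>auto simp: less_Suc_eq\<close>)
    next
      case (7 \<tau>)
      then show ?case unfolding k by (intro tup_eqI) (auto simp: cn c_def qt_def)
    qed (use k kB in simp_all)
  next
    case (2 \<tau>1)
    have f1: "frame {10, 20} {6} \<sigma> \<tau>1" using 2(2) by (auto simp: frame_def)
    have e1: "env \<tau>1" using env_frame[OF f1 _ _ assms(1)] by simp
    have lt1: "ar \<tau>1 aCUR i < n" if "i < k" for i
    proof -
      have "ar \<tau>1 aCUR i = c ! i" using 2(1) that by (metis tup_nth)
      then show ?thesis using cn that by (auto simp: subset_iff)
    qed
    show ?case
    proof (rule runs_Seq'[OF count_correct[OF e1 lt1]], goal_cases)
      case (2 \<tau>2)
      note ct = \<open>tup (ar \<tau>1 aCUR) = c\<close>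
      have f2: "frame {7, 10, 13, 25} {} \<tau>1 \<tau>2" using 2(2) by simp
      have e2: "env \<tau>2" using env_frame[OF f2 _ _ e1] by simp
      have gg: "vr \<tau>2 vGG = go c k" using 2(1) ct by simp
      have q2: "qt \<tau>2 = qt \<sigma>" "Qs \<tau>2 = Qs \<sigma>" "qinv \<tau>2" "vr \<tau>2 16 = vr \<sigma> 16"
        using q_frame[OF f2] q_frame[OF f1] assms(2) by simp_all
      have cur2: "ar \<tau>2 aCUR = ar \<tau>1 aCUR" using f2 by (simp add: frame_def)
      show ?case
      proof (rule runs_For[where I = "\<lambda>g \<tau>. qinv \<tau> \<and> extends \<sigma> \<tau> \<and>
          Qs \<tau> = Qs \<sigma> \<union> {c'. \<exists>g' < g. c' = fst (out c k g') \<and> good c c'}"], goal_cases)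
        case (6 g \<tau>)
        have e: "env \<tau>" using env_frame[OF 6(4) _ _ e2] by simp
        have cur: "ar \<tau> aCUR = ar \<tau>1 aCUR" using 6(4) cur2 by (simp add: frame_def)
        have lt: "ar \<tau> aCUR i < n" if "i < k" for i using lt1[OF that] cur by simp
        have q: "qinv \<tau>" "extends \<sigma> \<tau>" using 6(2) by simp_all
        show ?case
        proof (rule runs_conseq[OF trial_correct[OF e q(1) lt]], goal_cases)
          case (2 \<tau>')
          have "Qs \<tau>' = Qs \<sigma> \<union> {c'. \<exists>g' < Suc g. c' = fst (out c k g') \<and> good c c'}"
            using 2(1) 6(2,3) unfolding cur ct by (auto simp: less_Suc_eq)
          then show ?case using 2(1) extends_trans[OF q(2)] by simp
        qed
      next
        case (7 \<tau>)
        then show ?case using stp_iff_out[OF cn] gg by auto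
      qed (use q2 gg goB[OF cn] in \<open>simp_all add: extends_def\<close>)
    qed
  qed
qed

lemma start_correct:
  assumes "env \<sigma>"
  shows "runs B c_start \<sigma> (\<lambda>\<tau>. qinv \<tau> \<and> Qs \<tau> = {s0} \<and> vr \<tau> vLEN = 1 \<and> vr \<tau> vT = 0 \<and> vr \<tau> vGO = l)"
  unfolding c_start_def
proof (rule runs_Seq'[where P = "\<lambda>\<tau>. \<forall>i < k. ar \<tau> aQ i = s0 ! i"], goal_cases)
  case 1
  show ?case
  proof (rule runs_For[where I = "\<lambda>i \<tau>. \<forall>i' < i. ar \<tau> aQ i' = s0 ! i'"], goal_cases)
    case (6 i \<tau>)
    have "i < k" using 6(1) envD(2)[OF assms] by simp
    from envD(8)[OF assms this] have "ar \<tau> aIN (4 + i) = s0 ! i" using 6(4) by (simp add: frame_def)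
    then show ?case by (intro runs_exec) (use 6(2,3) in \<open>auto simp: less_Suc_eq\<close>)
  next
    case (7 \<tau>)
    then show ?case using envD(2)[OF assms] by simp
  qed (use envD(2)[OF assms] kB in simp_all)
next
  case (2 \<tau>)
  have v: "vr \<tau> vK = k" "vr \<tau> vL = l" using 2(2) envD(2,4)[OF assms] by (simp_all add: frame_def)
  define \<upsilon> where "\<upsilon> = setv vGO l (setv vT 0 (setv vFP k (setv vLEN 1 (seta aQO 0 0 \<tau>))))"
  have ex: "exec (Put aQO (N 0) (N 0) ;; Assign vLEN (N 1) ;; Assign vFP (V vK) ;;
     Assign vT (N 0) ;; Assign vGO (V vL)) \<tau> = \<upsilon>"
    by (simp add: \<upsilon>_def v)
  have w: "vr \<upsilon> vLEN = 1" "vr \<upsilon> vFP = k" "vr \<upsilon> vT = 0" "vr \<upsilon> vGO = l" "ar \<upsilon> aQO 0 = 0" "ar \<upsilon> aQ = ar \<tau> aQ"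
    by (simp_all add: \<upsilon>_def)
  have "qt \<upsilon> 0 = s0" unfolding qt_def w(5,6) by (rule tup_eqI) (use s0 2(1) in simp_all)
  then have Q: "Qs \<upsilon> = {s0}" by (simp add: Qs_def w lessThan_Suc)
  moreover have "qinv \<upsilon>" using Q w by (simp add: qinv_def RS_def lessThan_Suc)
  ultimately show ?case
    by (intro runs_exec'[OF ex]) (use w in simp_all)
qed

text \<open>Because \<open>vLEN0\<close> freezes the queue length, entries found during the round
  are not expanded before the next one; otherwise the queue could run ahead of
  \<open>reach (Suc r)\<close>.\<close>

lemma round_correct:
  assumes "env \<sigma>" "qinv \<sigma>" "Qs \<sigma> = reach r" "vr \<sigma> vT = r"
  shows "runs B c_round \<sigma> (\<lambda>\<tau>. qinv \<tau> \<and> extends \<sigma> \<tau> \<and> Qs \<tau> = reach (Suc r) \<and> vr \<tau> vT = Suc r \<and>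
     vr \<tau> vGO = (if vr \<sigma> vLEN < vr \<tau> vLEN then l - Suc r else 0))"
  unfolding c_round_def
proof (rule runs_Seq, rule runs_Assign, rule runs_Seq'[where P = "\<lambda>\<tau>. qinv \<tau> \<and> extends \<sigma> \<tau> \<and> Qs \<tau> = reach (Suc r)"], goal_cases)
  case 1
  let ?s = "setv vLEN0 (aval (V vLEN) \<sigma>) \<sigma>"
  have es: "env ?s" by (rule env_frame[OF _ _ _ assms(1), of "{17}" "{}"]) (auto simp: frame_def)
  show ?case
  proof (rule runs_For[where I = "\<lambda>h \<tau>. qinv \<tau> \<and> extends \<sigma> \<tau> \<and> Qs \<tau> = Qs \<sigma> \<union> {c'. \<exists>h' < h. stp (qt \<sigma> h') c'}"], goal_cases)
    case (6 h \<tau>)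
    have e: "env \<tau>" using env_frame[OF 6(4) _ _ es] by simp
    have q: "qinv \<tau>" "extends \<sigma> \<tau>" using 6(2) by simp_all
    have h: "h < vr \<sigma> vLEN" using 6(1) by simp
    have hl: "vr \<tau> vH < vr \<tau> vLEN" and qh: "qt \<tau> h = qt \<sigma> h"
      using q(2) h 6(3) by (auto simp: extends_def)
    show ?case
    proof (rule runs_conseq[OF expand_correct[OF e q(1) hl]], goal_cases)
      case (1 \<tau>')
      have "Qs \<tau>' = Qs \<sigma> \<union> {c'. \<exists>h' < Suc h. stp (qt \<sigma> h') c'}"
        using 1(1) 6(2,3) qh by (auto simp: less_Suc_eq)
      then show ?case using 1(1) extends_trans[OF q(2)] by simp
    qed
  next
    case (7 \<tau>)
    have "Qs \<sigma> = qt \<sigma> ` {..<vr \<sigma> vLEN}" by (simp add: Qs_def)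
    then have "reach (Suc r) = Qs \<sigma> \<union> {c'. \<exists>h' < vr \<sigma> vLEN. stp (qt \<sigma> h') c'}"
      using assms(3) by auto
    then show ?case using 7(1) by simp
  qed (use assms(2) qinv_len[OF assms(2)] in \<open>simp_all add: extends_refl\<close>)
next
  case (2 \<tau>)
  have v: "vr \<tau> vLEN0 = vr \<sigma> vLEN" "vr \<tau> vT = r" "vr \<tau> vL = l"
    using 2(2) assms(4) envD(4)[OF assms(1)] by (simp_all add: frame_def)
  define \<upsilon> where "\<upsilon> = setv vGO (if vr \<sigma> vLEN < vr \<tau> vLEN then l - Suc r else 0) (setv vT (Suc r) \<tau>)"
  have ex: "exec (Assign vT (Plus (V vT) (N 1)) ;;
     com.If (Minus (V vLEN) (V vLEN0)) (Assign vGO (Minus (V vL) (V vT))) (Assign vGO (N 0))) \<tau> = \<upsilon>"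
    by (auto simp: \<upsilon>_def v)
  show ?case
    by (intro runs_exec'[OF ex]) (use 2(1) in \<open>simp_all add: \<upsilon>_def\<close>)
qed

lemma final_correct:
  assumes "env \<sigma>" "qinv \<sigma>"
  shows "runs B c_final \<sigma> (\<lambda>\<tau>. vr \<tau> vANS = (if t0 \<in> Qs \<sigma> then 1 else 0))"
  unfolding c_final_def
proof (rule runs_Seq, rule runs_Assign, rule runs_For[where
    I = "\<lambda>q \<tau>. vr \<tau> vANS = (if \<exists>q' < q. qt \<sigma> q' = t0 then 1 else 0)"], goal_cases)
  case (6 q \<tau>)
  have f: "frame {0, 10, 21, 22, 25} {} \<sigma> \<tau>" using 6(4) by (auto simp: frame_def)
  have t: "env \<tau>" using env_frame[OF f _ _ assms(1)] by simp
  have qq: "qt \<tau> = qt \<sigma>" using q_frame(1)[OF f] by simp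
  have tt: "tup (\<lambda>i. t0 ! i) = t0" by (rule tup_eqI) (simp_all add: t0)
  show ?case
  proof (rule runs_Seq'[OF match_correct[OF t, of _ "\<lambda>i. t0 ! i"]], goal_cases)
    case (1 i \<tau>1)
    have "vr \<tau>1 vK = k" "ar \<tau>1 aIN = ar \<tau> aIN" using 1(3) envD(2)[OF t] by (simp_all add: frame_def)
    then show ?case using envD(9)[OF t 1(1)] 1(2) by simp
  next
    case (2 \<tau>1)
    have "vr \<tau>1 vANS = vr \<tau> vANS" using 2(2) by (simp add: frame_def)
    then show ?case
      by (intro runs_exec) (use 2(1) 6(2,3) in \<open>auto simp: qq tt less_Suc_eq\<close>)
  qed
next
  case (7 \<tau>)
  have "(t0 \<in> Qs \<sigma>) = (\<exists>q' < vr \<sigma> vLEN. qt \<sigma> q' = t0)" unfolding Qs_def by force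
  with 7(1) show ?case by simp
qed (use qinv_len[OF assms(2)] in simp_all)

text \<open>The makespan bound may be exponential in the input length, so the number of remaining
  rounds is useless as a measure. Instead, every round after which the loop continues adds an entry,
  and the queue never exceeds \<open>B\<close>. The extra 1 lets the final round decrease the
  measure as well, which then drops to 0.\<close>

lemma loop_correct:
  assumes "env \<sigma>" "qinv \<sigma>" "Qs \<sigma> = {s0}" "vr \<sigma> vLEN = 1" "vr \<sigma> vT = 0" "vr \<sigma> vGO = l"
  shows "runs B (While (V vGO) c_round) \<sigma> (\<lambda>\<tau>. qinv \<tau> \<and> Qs \<tau> = reach l)"
proof (rule runs_While[where m = "\<lambda>\<tau>. if vr \<tau> vGO = 0 then 0 else B - vr \<tau> vLEN + 1" and
    I = "\<lambda>\<tau>. env \<tau> \<and> qinv \<tau> \<and> 1 \<le> vr \<tau> vLEN \<and> vr \<tau> vT \<le> l \<and> Qs \<tau> = reach (vr \<tau> vT) \<and>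
      (0 < vr \<tau> vGO \<longrightarrow> vr \<tau> vT < l) \<and> (vr \<tau> vGO = 0 \<longrightarrow> reach l = reach (vr \<tau> vT))"], goal_cases)
  case 2
  then show ?case using qinv_len[OF assms(2)] assms(4) by simp
next
  case (3 \<tau>)
  define r where "r = vr \<tau> vT"
  have t: "env \<tau>" "qinv \<tau>" "Qs \<tau> = reach r" "vr \<tau> vT = r" and r: "r < l" and go: "0 < vr \<tau> vGO" "1 \<le> vr \<tau> vLEN"
    using 3 by (auto simp: r_def)
  show ?case
  proof (rule runs_conseq[OF round_correct[OF t]], goal_cases)
    case (1 \<tau>')
    have e: "env \<tau>'" using env_frame[OF 1(2) _ _ t(1)] by simp
    have len: "vr \<tau> vLEN \<le> vr \<tau>' vLEN" "vr \<tau>' vLEN \<le> B"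
      using 1(1) qinv_len by (auto simp: extends_def)
    \<comment> \<open>The flag is cleared either because the bound is reached or because the round
      found nothing; in the latter case the levels are constant from \<open>r\<close> on.\<close>
    have "reach l = reach (Suc r)" if "vr \<tau>' vGO = 0"
    proof (cases "l = Suc r")
      case False
      then have "vr \<tau>' vLEN = vr \<tau> vLEN" using 1(1) that r len(1) by (auto split: if_splits)
      then have "Qs \<tau>' = Qs \<tau>" using 1(1) by (auto simp: Qs_def extends_def)
      then have fx: "reach (Suc r) = reach r" using 1(1) t(3) by simp
      show ?thesis using reach_fixed[OF fx, of "l - r"] fx r by simp
    qed simp
    then show ?case using 1(1) e len go r by (auto split: if_splits)
  qed
next
  case (4 \<tau>)
  then show ?case by simp
qed (use assms in simp_all)

theorem mapfcc_correct:
  assumes "inp \<sigma>"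
  shows "runs B c_mapfcc \<sigma> (\<lambda>\<tau>. vr \<tau> 0 = (if t0 \<in> reach l then 1 else 0))"
  unfolding c_mapfcc_def
proof (rule runs_Seq'[OF init_correct[OF assms]], goal_cases)
  case (1 \<tau>1)
  show ?case
  proof (rule runs_Seq'[OF rows_correct], goal_cases)
    case (7 \<tau>2)
    show ?case
    proof (rule runs_Seq'[OF dist_correct[OF 7(1)]], goal_cases)
      case (1 \<tau>3)
      show ?case
      proof (rule runs_Seq'[OF start_correct[OF 1(1)]], goal_cases)
        case (1 \<tau>4)
        have e4: "env \<tau>4" using env_frame[OF 1(2) _ _ \<open>env \<tau>3\<close>] by simp
        show ?case
        proof (rule runs_Seq'[OF loop_correct[OF e4]], goal_cases)
          case (6 \<tau>5)
          have e5: "env \<tau>5" using env_frame[OF 6(2) _ _ e4] by simp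
          show ?case
            by (rule runs_conseq[OF final_correct[OF e5]]) (use 6(1) in simp_all)
        qed (use 1(1) in simp_all)
      qed
    qed
  qed (use 1(1) in simp_all)
qed

end

lemma wfc_mapfcc: "wfc c_mapfcc"
  by (simp add: c_mapfcc_def c_init_def c_rows_def c_dist_def c_relax_def c_start_def c_round_def
      c_expand_def c_trial_def c_final_def c_match_def c_count_def c_decode_def c_pairs_def c_flood_def
      c_marked_def c_dup_def c_append_def Eq_def)


section \<open>Counting configurations\<close>

text \<open>Five doublings multiply by 32, and the number so obtained counts the doublings of 1. The
  parameter part of the time bound is given this shape because additions suffice to compute
  it.\<close>

definition c_bound :: "nat \<Rightarrow> com" where
  "c_bound D =
     Assign 3 (N D) ;;
     For 4 1 (Assign 3 (Plus (V 3) (V 3)) ;; Assign 3 (Plus (V 3) (V 3)) ;; Assign 3 (Plus (V 3) (V 3)) ;;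
       Assign 3 (Plus (V 3) (V 3)) ;; Assign 3 (Plus (V 3) (V 3))) ;;
     Assign 5 (N 1) ;; For 4 3 (Assign 5 (Plus (V 5) (V 5))) ;; Assign 0 (V 5)"

lemma bound_computable: "computable (\<lambda>p. 2 ^ (D * 32 ^ p))"
proof (rule com_computable)
  show "wfc (c_bound D)" by (simp add: c_bound_def)
next
  fix p and \<sigma> :: st assume p: "vr \<sigma> 1 = p"
  let ?B = "p + D * 32 ^ p"
  have "runs ?B (c_bound D) \<sigma> (\<lambda>\<tau>. vr \<tau> 0 = 2 ^ (D * 32 ^ p))"
    unfolding c_bound_def
  proof (rule runs_Seq, rule runs_Assign, rule runs_Seq'[where P = "\<lambda>\<tau>. vr \<tau> 3 = D * 32 ^ p"], goal_cases)
    case 1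
    show ?case
    proof (rule runs_For[where I = "\<lambda>i \<tau>. vr \<tau> 3 = D * 32 ^ i"], goal_cases)
      case (6 i \<tau>)
      then show ?case by (intro runs_exec) simp_all
    qed (use p in simp_all)
  next
    case (2 \<tau>)
    show ?case
    proof (rule runs_Seq, rule runs_Assign, rule runs_Seq'[where P = "\<lambda>\<tau>. vr \<tau> 5 = 2 ^ (D * 32 ^ p)"], goal_cases)
      case 1
      show ?case
      proof (rule runs_For[where I = "\<lambda>i \<tau>. vr \<tau> 5 = 2 ^ i"], goal_cases)
        case (6 i \<tau>)
        then show ?case by (intro runs_exec) simp_all
      qed (use 2(1) in simp_all)
    next
      case (2 \<tau>')
      then show ?case by (intro runs_Assign) simp
    qed
  qed
  then show "\<exists>B. runs B (c_bound D) \<sigma> (\<lambda>\<tau>. vr \<tau> 0 = 2 ^ (D * 32 ^ p))" by blast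
qed

context problem
begin

lemma ball_finite: "finite ((A ^^ j) `` {u})" if "u < n" for u
  by (rule finite_subset[of _ "{..<n}"]) (use A_bound that in auto)

text \<open>Each vertex of a ball contributes itself and at most \<open>\<Delta>\<close> neighbours
  to the next one.\<close>

lemma ball_card:
  assumes deg: "\<And>u. u < n \<Longrightarrow> card {v. v < n \<and> adj u v} \<le> \<Delta>" and "u < n"
  shows "card ((A ^^ j) `` {u}) \<le> (\<Delta> + 1) ^ j"
proof (induction j)
  case (Suc j)
  have "(A ^^ Suc j) `` {u} = (\<Union>w \<in> (A ^^ j) `` {u}. A `` {w})" by auto
  then have "card ((A ^^ Suc j) `` {u}) \<le> (\<Sum>w \<in> (A ^^ j) `` {u}. card (A `` {w}))"
    using card_UN_le[OF ball_finite[OF assms(2), of j], of "\<lambda>w. A `` {w}"] by (simp only:)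
  also have "\<dots> \<le> (\<Sum>w \<in> (A ^^ j) `` {u}. \<Delta> + 1)"
  proof (rule sum_mono)
    fix w assume "w \<in> (A ^^ j) `` {u}"
    then have w: "w < n" using A_bound assms(2) by auto
    have "card (A `` {w}) \<le> card (insert w {v. v < n \<and> adj w v})"
      by (rule card_mono) (auto simp: A_def)
    also have "\<dots> \<le> card {v. v < n \<and> adj w v} + 1"
      by (simp add: card_insert_if)
    also have "\<dots> \<le> \<Delta> + 1" using deg[OF w] by simp
    finally show "card (A `` {w}) \<le> \<Delta> + 1" .
  qed
  also have "\<dots> = card ((A ^^ j) `` {u}) * (\<Delta> + 1)" by simp
  also have "\<dots> \<le> (\<Delta> + 1) ^ j * (\<Delta> + 1)" using Suc.IH by (rule mult_right_mono) simp
  finally show ?case by (simp add: mult.commute)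
qed simp

text \<open>
  A connected configuration stays within distance \<open>k * k * d\<close> of its first agent: this keeps the
  number of configurations linear in \<open>n\<close>.
\<close>

lemma conn_in_ball:
  assumes "length c = k" "set c \<subseteq> {..<n}" "0 < k" "conn c"
  shows "set c \<subseteq> (A ^^ (k * k * d)) `` {c ! 0}"
proof
  define E where "E = {(i, j). i < k \<and> j < k \<and> near (c ! i) (c ! j)}"
  have E: "E \<subseteq> {..<k} \<times> {..<k}" by (auto simp: E_def)
  then have fE: "finite E" by (rule finite_subset) simp
  have cE: "card E \<le> k * k" using card_mono[OF _ E] by simp
  have c0: "c ! 0 < n" using assms(1-3) by (auto simp: subset_iff)
  have pow: "(c ! 0, c ! i) \<in> A ^^ (m * d)" if "(0, i) \<in> E ^^ m" for m i
    using that
  proof (induction m arbitrary: i)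
    case (Suc m)
    then obtain j where j: "(0, j) \<in> E ^^ m" "(j, i) \<in> E" by auto
    have "(c ! j, c ! i) \<in> A ^^ d" using j(2) by (simp add: E_def near_def)
    with Suc.IH[OF j(1)] have "(c ! 0, c ! i) \<in> A ^^ (m * d + d)" by (auto simp: relpow_add)
    then show ?case by (simp add: add.commute)
  qed simp
  fix v assume "v \<in> set c"
  then obtain i where i: "i < k" "v = c ! i" using assms(1) by (auto simp: in_set_conv_nth)
  then have "(0, i) \<in> E\<^sup>*" using assms(4) by (simp add: conn_def E_def)
  \<comment> \<open>In a finite relation a path can be chosen no longer than the number of pairs,
    which is where \<open>k * k\<close> comes from.\<close>
  then obtain m where m: "m \<le> card E" "(0, i) \<in> E ^^ m"
    using rtrancl_finite_eq_relpow[OF fE] by auto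
  have "m * d \<le> k * k * d" using m(1) cE by (intro mult_right_mono) auto
  from A_mono[OF pow[OF m(2)] this c0] show "v \<in> (A ^^ (k * k * d)) `` {c ! 0}" using i by simp
qed

text \<open>Choose the vertex of the first agent, then all \<open>k\<close> entries from the ball
  around it; the summand 1 accounts for \<open>s0\<close>.\<close>

lemma RS_card:
  assumes deg: "\<And>u. u < n \<Longrightarrow> card {v. v < n \<and> adj u v} \<le> \<Delta>"
  shows "card RS \<le> 1 + n * ((\<Delta> + 1) ^ (k * k * d)) ^ k"
proof -
  define L where "L u = {c. set c \<subseteq> (A ^^ (k * k * d)) `` {u} \<and> length c = k}" for u
  have fL: "finite (L u)" and cL: "card (L u) \<le> ((\<Delta> + 1) ^ (k * k * d)) ^ k" if "u < n" for u
    using ball_finite[OF that] ball_card[OF deg that]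
    by (auto simp: L_def finite_lists_length_eq card_lists_length_eq intro: power_mono)
  have sub: "RS \<subseteq> insert s0 (\<Union>u \<in> {..<n}. L u)"
  proof
    fix c assume "c \<in> RS"
    then consider "c = s0" | "length c = k" "set c \<subseteq> {..<n}" "0 < k" "conn c" by (auto simp: RS_def)
    then show "c \<in> insert s0 (\<Union>u \<in> {..<n}. L u)"
    proof cases
      case 2
      from conn_in_ball[OF this] have "c \<in> L (c ! 0)" using 2 by (simp add: L_def)
      moreover have "c ! 0 < n" using 2 by (auto simp: subset_iff)
      ultimately show ?thesis by blast
    qed simp
  qed
  have fin: "finite (\<Union>u \<in> {..<n}. L u)" using fL by blast
  have "card RS \<le> card (insert s0 (\<Union>u \<in> {..<n}. L u))" using sub fin by (intro card_mono) auto
  also have "\<dots> \<le> 1 + card (\<Union>u \<in> {..<n}. L u)" using fin by (simp add: card_insert_if)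
  also have "card (\<Union>u \<in> {..<n}. L u) \<le> (\<Sum>u \<in> {..<n}. card (L u))" by (rule card_UN_le) simp
  also have "\<dots> \<le> (\<Sum>u \<in> {..<n}. ((\<Delta> + 1) ^ (k * k * d)) ^ k)" by (rule sum_mono) (use cL in simp)
  finally show ?thesis by simp
qed

lemma gi_eq: "gi c m = 2 ^ card {v. v < m \<and> adj c v}"
proof (induction m)
  case (Suc m)
  have "{v. v < Suc m \<and> adj c v} = (if adj c m then insert m {v. v < m \<and> adj c v} else {v. v < m \<and> adj c v})"
    by (auto simp: less_Suc_eq)
  then show ?case using Suc by simp
qed simp

lemma go_bound:
  assumes deg: "\<And>u. u < n \<Longrightarrow> card {v. v < n \<and> adj u v} \<le> \<Delta>"
    and "length c = k" "set c \<subseteq> {..<n}"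
  shows "i \<le> k \<Longrightarrow> go c i \<le> 2 ^ (i * \<Delta>)"
proof (induction i)
  case (Suc i)
  have "c ! i < n" using Suc.prems assms(2,3) by (auto simp: subset_iff)
  then have "gi (c ! i) n \<le> 2 ^ \<Delta>" unfolding gi_eq using deg by (intro power_increasing) auto
  then have "go c i * gi (c ! i) n \<le> 2 ^ (i * \<Delta>) * 2 ^ \<Delta>" using Suc by (intro mult_mono) auto
  then show ?case by (simp add: power_add mult.commute)
qed simp

end

text \<open>All loop bounds, the number of configurations included, are at most \<open>(s + 1) \<cdot> 2^(p^5 + p^2)\<close>.\<close>

lemma bounded_problemI:
  fixes n k d \<Delta> p s :: nat
  assumes "length s0 = k" "set s0 \<subseteq> {..<n}" "length t0 = k"
    and deg: "\<And>u. u < n \<Longrightarrow> card {v. v < n \<and> adj u v} \<le> \<Delta>"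
    and p: "k \<le> p" "d \<le> p" "\<Delta> \<le> p" and s: "n \<le> s"
  shows "bounded_problem ((s + 1) * 2 ^ (p ^ 5 + p ^ 2)) n k d adj s0 t0"
proof -
  let ?B = "(s + 1) * 2 ^ (p ^ 5 + p ^ 2)"
  have one: "1 \<le> (2 :: nat) ^ (p ^ 5 + p ^ 2)" by simp
  have pB: "p \<le> ?B"
  proof -
    have "p \<le> p ^ 2" by (cases p) (auto simp: power2_eq_square)
    also have "\<dots> \<le> 2 ^ p ^ 2" by (rule less_imp_le, rule less_exp)
    also have "\<dots> \<le> 2 ^ (p ^ 5 + p ^ 2)" by (rule power_increasing) auto
    finally show ?thesis by simp
  qed
  have nB: "n \<le> ?B"
  proof -
    have "n * 1 \<le> (s + 1) * 2 ^ (p ^ 5 + p ^ 2)" using s one by (intro mult_mono) auto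
    then show ?thesis by simp
  qed
  \<comment> \<open>The 0 stands in for the makespan bound, which neither \<open>RS\<close> nor
    \<open>go\<close> mentions.\<close>
  interpret problem ?B n k d 0 adj s0 t0
    by unfold_locales (use assms pB nB in auto)
  \<comment> \<open>Four factors \<open>p\<close> bound \<open>k * k * d * k\<close>, the fifth
    comes from \<open>\<Delta> + 1 \<le> 2 ^ p\<close>.\<close>
  have "((\<Delta> + 1) ^ (k * k * d)) ^ k \<le> 2 ^ p ^ 5"
  proof -
    have "\<Delta> + 1 \<le> 2 ^ \<Delta>" by (simp add: Suc_leI)
    also have "\<dots> \<le> 2 ^ p" using p by (intro power_increasing) auto
    finally have "(\<Delta> + 1) ^ (k * k * d * k) \<le> (2 ^ p) ^ (k * k * d * k)" by (rule power_mono) simp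
    also have "\<dots> \<le> (2 ^ p) ^ (p * p * p * p)"
      by (intro power_increasing mult_mono p) auto
    also have "\<dots> = 2 ^ p ^ 5" by (simp add: power_mult[symmetric] power_numeral_reduce algebra_simps)
    finally show ?thesis by (simp add: power_mult)
  qed
  also have "\<dots> \<le> 2 ^ (p ^ 5 + p ^ 2)" by (rule power_increasing) auto
  finally have "n * ((\<Delta> + 1) ^ (k * k * d)) ^ k \<le> s * 2 ^ (p ^ 5 + p ^ 2)"
    using s by (intro mult_mono) auto
  then have RSB: "card RS \<le> ?B" using RS_card[OF deg] one unfolding distrib_right mult_1 by linarith
  have "go c k \<le> ?B" if "length c = k" "set c \<subseteq> {..<n}" for c
  proof -
    have "go c k \<le> 2 ^ (k * \<Delta>)" using go_bound[OF deg that] by simp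
    also have "\<dots> \<le> 2 ^ p ^ 2" using p by (intro power_increasing) (auto simp: power2_eq_square intro: mult_mono)
    also have "\<dots> \<le> 2 ^ (p ^ 5 + p ^ 2)" by (rule power_increasing) auto
    finally show ?thesis by simp
  qed
  with RSB show ?thesis by unfold_locales
qed

text \<open>Parameter and size are separated by
  \<open>(s + 1) * 2 ^ X + 1 \<le> (s + 2) * 2 ^ X\<close>, whose power \<open>D\<close> splits into
  a polynomial in \<open>s\<close> and \<open>2 ^ (X * D)\<close>. Since
  \<open>p ^ i \<le> 2 ^ (p * i)\<close>, both summands of \<open>X\<close> are at most
  \<open>32 ^ p\<close>. The summand \<open>12 * s + 40\<close> is the cost of loading the
  input.\<close>

lemma time_bound:
  fixes C D p s :: nat
  shows "12 * s + 40 + C * ((s + 1) * 2 ^ (p ^ 5 + p ^ 2) + 1) ^ D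
    \<le> 2 ^ (2 * D * 32 ^ p) * poly ([:40, 12:] + smult C ([:2, 1:] ^ D)) s"
proof -
  let ?X = "p ^ 5 + p ^ 2"
  have p2: "p ^ i \<le> 2 ^ (p * i)" for i
    using power_mono[OF less_imp_le[OF less_exp[of p]], of i] by (simp add: power_mult)
  have "p ^ 2 \<le> 2 ^ (p * 2)" by (rule p2)
  also have "\<dots> \<le> 2 ^ (p * 5)" by (rule power_increasing) auto
  finally have "?X \<le> 2 * 2 ^ (p * 5)" using p2[of 5] by simp
  also have "(2 :: nat) ^ (p * 5) = (2 ^ 5) ^ p" by (metis power_mult mult.commute)
  also have "(2 :: nat) ^ 5 = 32" by simp
  finally have X: "?X * D \<le> 2 * D * 32 ^ p" using mult_right_mono[of ?X "2 * 32 ^ p" D] by (simp add: ac_simps)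
  have "(s + 1) * 2 ^ ?X + 1 \<le> (s + 2) * 2 ^ ?X" by simp
  then have "((s + 1) * 2 ^ ?X + 1) ^ D \<le> ((s + 2) * 2 ^ ?X) ^ D" by (rule power_mono) simp
  also have "\<dots> = (s + 2) ^ D * 2 ^ (?X * D)" by (simp only: power_mult_distrib power_mult)
  also have "\<dots> \<le> (s + 2) ^ D * 2 ^ (2 * D * 32 ^ p)" using X by (intro mult_left_mono power_increasing) auto
  finally have "C * ((s + 1) * 2 ^ ?X + 1) ^ D \<le> C * ((s + 2) ^ D * 2 ^ (2 * D * 32 ^ p))"
    by (rule mult_left_mono) simp
  moreover have "(12 * s + 40) * 1 \<le> (12 * s + 40) * 2 ^ (2 * D * 32 ^ p)" by (rule mult_left_mono) auto
  ultimately have "12 * s + 40 + C * ((s + 1) * 2 ^ ?X + 1) ^ D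
      \<le> (12 * s + 40) * 2 ^ (2 * D * 32 ^ p) + C * ((s + 2) ^ D * 2 ^ (2 * D * 32 ^ p))"
    by (simp only: mult_1_right add_mono)
  also have "\<dots> = 2 ^ (2 * D * 32 ^ p) * (12 * s + 40 + C * (s + 2) ^ D)"
    by (simp only: distrib_left distrib_right ac_simps)
  also have "12 * s + 40 + C * (s + 2) ^ D = poly ([:40, 12:] + smult C ([:2, 1:] ^ D)) s"
    by (simp add: poly_power algebra_simps)
  finally show ?thesis .
qed


section \<open>Correspondence with the graph problem\<close>

lemma position_less: "x \<in> set xs \<Longrightarrow> position xs x < length xs"
  by (induction xs) (auto simp: position_def)

lemma nth_position: "x \<in> set xs \<Longrightarrow> xs ! position xs x = x"
  using nth_length_takeWhile[of "\<lambda>y. y \<noteq> x" xs] position_less[of x xs] by (simp add: position_def)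

lemma position_nth: "distinct xs \<Longrightarrow> i < length xs \<Longrightarrow> position xs (xs ! i) = i"
  by (metis distinct_conv_nth nth_mem nth_position position_less)

lemma position_inj: "x \<in> set xs \<Longrightarrow> y \<in> set xs \<Longrightarrow> position xs x = position xs y \<longleftrightarrow> x = y"
  by (metis nth_position)

lemma concat_map_map_nth:
  "u < length xs \<Longrightarrow> v < length ys \<Longrightarrow>
    concat (map (\<lambda>x. map (f x) ys) xs) ! (u * length ys + v) = f (xs ! u) (ys ! v)"
proof (induction xs arbitrary: u)
  case (Cons x xs)
  show ?case
  proof (cases u)
    case (Suc w)
    then have "concat (map (\<lambda>x. map (f x) ys) (x # xs)) ! (u * length ys + v) =
        concat (map (\<lambda>x. map (f x) ys) xs) ! (w * length ys + v)"
      by (simp add: nth_append add.assoc)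
    then show ?thesis using Cons.IH[of w] Cons.prems Suc by simp
  qed (use Cons.prems in \<open>simp add: nth_append\<close>)
qed simp

text \<open>The distance is an infimum in \<open>ereal\<close>. Walk lengths are integers, so if all
  exceed \<open>d\<close>, the infimum is at least \<open>d + 1\<close>; this also covers vertices
  joined by no walk.\<close>

lemma graph_dist_le_iff:
  assumes "pair_wf_digraph G"
  shows "graph_dist G x y \<le> ereal (real d) \<longleftrightarrow>
    (\<exists>p. pre_digraph.awalk (with_proj G) x p y \<and> length p \<le> d)"
proof -
  interpret pair_wf_digraph G by fact
  have cost: "awalk_cost (\<lambda>_. 1) p = real (length p)" for p :: "('a \<times> 'a) list"
    by (induction p) auto
  show ?thesis
    unfolding graph_dist_def \<mu>_def cost
  proof
    assume le: "(INF p \<in> {p. awalk x p y}. ereal (real (length p))) \<le> ereal (real d)"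
    show "\<exists>p. awalk x p y \<and> length p \<le> d"
    proof (rule ccontr)
      assume no: "\<not> ?thesis"
      have "ereal (real (d + 1)) \<le> (INF p \<in> {p. awalk x p y}. ereal (real (length p)))"
      proof (rule INF_greatest)
        fix p assume "p \<in> {p. awalk x p y}"
        with no have "d + 1 \<le> length p" by auto
        then show "ereal (real (d + 1)) \<le> ereal (real (length p))" by (simp only: ereal_less_eq of_nat_le_iff)
      qed
      from order_trans[OF this le] show False by simp
    qed
  next
    assume "\<exists>p. awalk x p y \<and> length p \<le> d"
    then obtain p where "awalk x p y" "length p \<le> d" by blast
    then show "(INF p \<in> {p. awalk x p y}. ereal (real (length p))) \<le> ereal (real d)"
      by (intro INF_lower2[of p]) auto
  qed
qed

text \<open>\<open>connected\<close> is strong connectivity of the symmetric closure, and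
  \<open>strongly_connected\<close> excludes the empty set. Reachability relative to
  \<open>W\<close>, started inside \<open>W\<close>, is the plain reflexive transitive closure
  because \<open>R\<close> never leaves \<open>W\<close>.\<close>

lemma d_connected_iff:
  "d_connected G d W \<longleftrightarrow> W \<noteq> {} \<and> (\<forall>x \<in> W. \<forall>y \<in> W. (x, y) \<in>
     {(x, y). x \<in> W \<and> y \<in> W \<and> ((x, y) \<in> parcs (comm_graph G d) \<or> (y, x) \<in> parcs (comm_graph G d))}\<^sup>*)"
proof -
  define R where "R = {(x, y). x \<in> W \<and> y \<in> W \<and> ((x, y) \<in> parcs (comm_graph G d) \<or> (y, x) \<in> parcs (comm_graph G d))}"
  let ?H = "mk_symmetric (with_proj (comm_graph G d) \<restriction> W)"
  have "parcs ?H = R"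
    by (auto simp: parcs_mk_symmetric R_def)
  then have "x \<rightarrow>\<^sup>*\<^bsub>with_proj ?H\<^esub> y \<longleftrightarrow> (x, y) \<in> rtrancl_on W R" for x y
    by (simp add: reachable_def)
  moreover have "(x, y) \<in> rtrancl_on W R \<longleftrightarrow> (x, y) \<in> R\<^sup>*" if "x \<in> W" for x y
  proof
    assume "(x, y) \<in> rtrancl_on W R"
    then show "(x, y) \<in> R\<^sup>*"
      by (induction rule: rtrancl_on_induct) (auto intro: rtrancl_into_rtrancl)
  next
    assume "(x, y) \<in> R\<^sup>*"
    then show "(x, y) \<in> rtrancl_on W R"
    proof (induction rule: rtrancl_induct)
      case (step y z)
      then have "z \<in> W" by (simp add: R_def)
      with step show ?case by (blast intro: rtrancl_on_into_rtrancl_on)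
    qed (simp add: that)
  qed
  ultimately show ?thesis
    unfolding d_connected_def connected_def strongly_connected_def R_def[symmetric] by simp
qed

text \<open>\<open>vs\<close> and \<open>as\<close> are a numbering that witnesses
  \<open>mapfcc_encodes\<close>; \<open>s\<close> will be the input size.\<close>

locale encoding =
  fixes I :: "('v, 'a) mapfcc" and vs :: "'v list" and as :: "'a list" and s :: nat
  assumes inst: "mapfcc_instance I"
    and vs: "distinct vs" "set vs = pverts (graph I)" and as: "distinct as" "set as = agents I"
    and s: "length vs \<le> s"
begin

definition adj :: "nat \<Rightarrow> nat \<Rightarrow> bool" where
  "adj u v \<longleftrightarrow> (vs ! u, vs ! v) \<in> parcs (graph I)"

definition code :: "('a \<Rightarrow> 'v) \<Rightarrow> nat list" where
  "code c = map (\<lambda>a. position vs (c a)) as"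

abbreviation "n \<equiv> length vs"
abbreviation "k \<equiv> length as"
abbreviation "d \<equiv> comm_range I"
abbreviation "p \<equiv> mapfcc_parameter I"

lemma as_mem: "i < k \<Longrightarrow> as ! i \<in> agents I"
  using as(2) nth_mem by blast

lemma G: "pair_graph (graph I)"
  using inst by (simp add: mapfcc_instance_def)

lemma wf: "pair_wf_digraph (graph I)"
proof -
  interpret pair_graph "graph I" by (rule G)
  show ?thesis by unfold_locales
qed

lemma start: "start I ` agents I \<subseteq> pverts (graph I)" "inj_on (start I) (agents I)"
  and target: "target I ` agents I \<subseteq> pverts (graph I)"
  using inst by (simp_all add: mapfcc_instance_def)

lemma length_code [simp]: "length (code c) = k"
  by (simp add: code_def)

lemma code_nth:
  assumes "c ` agents I \<subseteq> pverts (graph I)" "i < k"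
  shows "code c ! i < n" "vs ! (code c ! i) = c (as ! i)"
proof -
  have "c (as ! i) \<in> set vs" using assms as_mem vs(2) by auto
  then show "code c ! i < n" "vs ! (code c ! i) = c (as ! i)"
    using assms(2) by (simp_all add: code_def position_less nth_position)
qed

lemma set_code: "c ` agents I \<subseteq> pverts (graph I) \<Longrightarrow> set (code c) \<subseteq> {..<n}"
  using code_nth(1)[of c] by (auto simp: in_set_conv_nth)

lemma degree:
  assumes "u < n"
  shows "card {v. v < n \<and> adj u v} \<le> max_degree (graph I)"
proof -
  interpret pair_graph "graph I" by (rule G)
  have "card {v. v < n \<and> adj u v} = card ((\<lambda>v. (vs ! u, vs ! v)) ` {v. v < n \<and> adj u v})"
    using vs(1) by (intro card_image[symmetric]) (auto simp: inj_on_def nth_eq_iff_index_eq)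
  also have "\<dots> \<le> out_degree (with_proj (graph I)) (vs ! u)"
    unfolding out_degree_def
    by (rule card_mono[OF finite_out_arcs]) (auto simp: adj_def out_arcs_def)
  also have "\<dots> \<le> max_degree (graph I)"
    unfolding max_degree_def
  proof (rule Max_ge)
    show "out_degree (with_proj (graph I)) (vs ! u) \<in> insert 0 (out_degree (with_proj (graph I)) ` pverts (graph I))"
      using assms vs(2) by (metis imageI insertI2 nth_mem)
  qed (simp add: pair_finite_verts)
  finally show ?thesis .
qed

sublocale bounded_problem "(s + 1) * 2 ^ (p ^ 5 + p ^ 2)" n k d "makespan_bound I" adj "code (start I)" "code (target I)"
proof -
  have "k = card (agents I)" using as by (metis distinct_card)
  then show "bounded_problem ((s + 1) * 2 ^ (p ^ 5 + p ^ 2)) n k d adj (code (start I)) (code (target I))"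
    by (intro bounded_problemI[where \<Delta> = "max_degree (graph I)"])
      (use set_code[OF start(1)] degree s in \<open>auto simp: mapfcc_parameter_def\<close>)
qed

lemma adj_sym: "adj u v \<Longrightarrow> adj v u"
proof -
  interpret pair_graph "graph I" by (rule G)
  have "sym (parcs (graph I))" using pair_sym_arcs by (simp add: symmetric_def)
  then show "adj u v \<Longrightarrow> adj v u" unfolding adj_def by (rule symD)
qed

lemma A_pow_sym: "(u, v) \<in> A ^^ j \<Longrightarrow> (v, u) \<in> A ^^ j"
proof (induction j arbitrary: v)
  case (Suc j)
  then obtain w where "(u, w) \<in> A ^^ j" "(w, v) \<in> A" by auto
  then have "(w, u) \<in> A ^^ j" "(v, w) \<in> A" using Suc.IH adj_sym by (auto simp: A_def)
  then show ?case by (rule relpow_Suc_I2[rotated])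
qed simp

lemma near_sym: "near u v \<Longrightarrow> near v u"
  unfolding near_def by (rule A_pow_sym)

text \<open>A walk shorter than \<open>j\<close> is padded with the loops of \<open>A\<close>;
  conversely, loop steps are dropped, which only shortens the walk.\<close>

lemma walk_iff_A_pow:
  assumes "u < n" "v < n"
  shows "(\<exists>q. pre_digraph.awalk (with_proj (graph I)) (vs ! u) q (vs ! v) \<and> length q \<le> j) \<longleftrightarrow> (u, v) \<in> A ^^ j"
proof -
  interpret pair_wf_digraph "graph I" by (rule wf)
  show ?thesis
  proof
    assume "\<exists>q. awalk (vs ! u) q (vs ! v) \<and> length q \<le> j"
    then obtain q where q: "awalk (vs ! u) q (vs ! v)" "length q \<le> j" by blast
    have "(u, v) \<in> A ^^ length q"
      using q(1) assms(1)
    proof (induction q arbitrary: u)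
      case Nil
      then have "u = v" using vs(1) assms(2) by (simp add: awalk_Nil_iff nth_eq_iff_index_eq)
      then show ?case by simp
    next
      case (Cons e q)
      then have e: "e \<in> parcs (graph I)" "vs ! u = fst e" "awalk (snd e) q (vs ! v)"
        by (auto simp: awalk_Cons_iff)
      have "snd e \<in> set vs" using arc_snd_in_verts[OF e(1)] vs(2) by simp
      then obtain w where w: "w < n" "snd e = vs ! w" by (metis in_set_conv_nth)
      have "(u, w) \<in> A" using e(1,2) w Cons.prems(2) by (cases e) (auto simp: A_def adj_def)
      moreover have "(w, v) \<in> A ^^ length q" using Cons.IH[of w] e(3) w by simp
      ultimately show ?case by (simp only: list.size relpow_Suc_I2 add_0_right add_Suc_right)
    qed
    from A_mono[OF this q(2) assms(1)] show "(u, v) \<in> A ^^ j" .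
  next
    assume "(u, v) \<in> A ^^ j"
    then show "\<exists>q. awalk (vs ! u) q (vs ! v) \<and> length q \<le> j"
      using assms(1)
    proof (induction j arbitrary: u)
      case 0
      then have "u = v" by simp
      moreover have "vs ! v \<in> pverts (graph I)" using nth_mem[OF assms(2)] unfolding vs(2) .
      ultimately show ?case by (intro exI[of _ "[]"]) (simp add: awalk_Nil_iff)
    next
      case (Suc j)
      from relpow_Suc_D2[OF Suc.prems(1)] obtain w where w: "(u, w) \<in> A" "(w, v) \<in> A ^^ j" by blast
      then have "w < n" by (simp add: A_def)
      from Suc.IH[OF w(2) this] obtain q where q: "awalk (vs ! w) q (vs ! v)" "length q \<le> j" by blast
      show ?case
      proof (cases "u = w")
        case True
        then show ?thesis using q by (intro exI[of _ q]) simp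
      next
        case False
        then have "(vs ! u, vs ! w) \<in> parcs (graph I)" using w(1) by (simp add: A_def adj_def)
        then show ?thesis using q by (intro exI[of _ "(vs ! u, vs ! w) # q"]) (simp add: awalk_Cons_iff)
      qed
    qed
  qed
qed

lemma near_iff: "u < n \<Longrightarrow> v < n \<Longrightarrow> near u v \<longleftrightarrow> graph_dist (graph I) (vs ! u) (vs ! v) \<le> ereal (real d)"
  unfolding near_def graph_dist_le_iff[OF wf] by (rule walk_iff_A_pow[symmetric])

lemma near_refl: "u < n \<Longrightarrow> near u u"
  unfolding near_def by (rule A_mono[of u u 0]) auto

text \<open>\<open>E\<close> relates agents, \<open>R\<close> their vertices, and agents may share a
  vertex since \<open>c\<close> may fail to be injective. \<open>comm_graph\<close> has no loops, so
  a shared vertex is handled by the trivial path on one side and by \<open>near_refl\<close> on the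
  other. Starting from agent 0 suffices by symmetry.\<close>

lemma conn_iff:
  assumes "c ` agents I \<subseteq> pverts (graph I)" "0 < k"
  shows "conn (code c) \<longleftrightarrow> d_connected (graph I) d (c ` agents I)"
proof -
  define W where "W = c ` agents I"
  define R where "R = {(x, y). x \<in> W \<and> y \<in> W \<and>
    ((x, y) \<in> parcs (comm_graph (graph I) d) \<or> (y, x) \<in> parcs (comm_graph (graph I) d))}"
  define E where "E = {(i, j). i < k \<and> j < k \<and> near (code c ! i) (code c ! j)}"
  define f where "f i = c (as ! i)" for i
  note cn = code_nth[OF assms(1)]
  have W: "W = f ` {..<k}"
    unfolding W_def as(2)[symmetric] f_def set_conv_nth by auto
  have pv: "f i \<in> pverts (graph I)" if "i < k" for i
    using that assms(1) as_mem by (auto simp: f_def)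
  have nr: "near (code c ! i) (code c ! j) \<longleftrightarrow> graph_dist (graph I) (f i) (f j) \<le> ereal (real d)"
    if "i < k" "j < k" for i j
    using near_iff[OF cn(1)[OF that(1)] cn(1)[OF that(2)]] cn(2)[OF that(1)] cn(2)[OF that(2)] by (simp add: f_def)
  have R_E: "(f i, f j) \<in> R \<Longrightarrow> (i, j) \<in> E" if "i < k" "j < k" for i j
    using nr[OF that] nr[OF that(2,1)] near_sym that by (auto simp: R_def E_def comm_graph_def)
  have E_R: "(f i, f j) \<in> R\<^sup>*" if "(i, j) \<in> E" for i j
  proof (cases "f i = f j")
    case False
    then have "(f i, f j) \<in> R" using that nr pv W by (auto simp: R_def E_def comm_graph_def)
    then show ?thesis by blast
  qed simp
  have lift: "(f i, f j) \<in> R\<^sup>*" if "(i, j) \<in> E\<^sup>*" for i j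
    using that by (induction rule: rtrancl_induct) (auto intro: rtrancl_trans E_R)
  have Esym: "sym (E\<^sup>*)"
    by (rule sym_rtrancl) (auto simp: E_def near_sym intro: symI)
  show ?thesis
    unfolding d_connected_iff W_def[symmetric] R_def[symmetric]
  proof
    assume "conn (code c)"
    then have 0: "(0, i) \<in> E\<^sup>*" if "i < k" for i using that by (simp add: conn_def E_def)
    have "(f i, f j) \<in> R\<^sup>*" if "i < k" "j < k" for i j
      using lift[OF rtrancl_trans[OF symD[OF Esym 0[OF that(1)]] 0[OF that(2)]]] .
    then show "W \<noteq> {} \<and> (\<forall>x \<in> W. \<forall>y \<in> W. (x, y) \<in> R\<^sup>*)" using assms(2) by (auto simp: W)
  next
    assume r: "W \<noteq> {} \<and> (\<forall>x \<in> W. \<forall>y \<in> W. (x, y) \<in> R\<^sup>*)"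
    have path: "\<exists>j < k. y = f j \<and> (0, j) \<in> E\<^sup>*" if "(f 0, y) \<in> R\<^sup>*" for y
      using that
    proof (induction rule: rtrancl_induct)
      case base
      then show ?case using assms(2) by blast
    next
      case (step y z)
      then obtain j where j: "j < k" "y = f j" "(0, j) \<in> E\<^sup>*" by blast
      from step.hyps(2) obtain i where i: "i < k" "z = f i" by (auto simp: R_def W)
      have "(j, i) \<in> E" using R_E[OF j(1) i(1)] step.hyps(2) j(2) i(2) by simp
      then show ?case using i j(3) by (blast intro: rtrancl_into_rtrancl)
    qed
    have "(0, i) \<in> E\<^sup>*" if i: "i < k" for i
    proof -
      have "(f 0, f i) \<in> R\<^sup>*" using r i assms(2) by (auto simp: W)
      from path[OF this] obtain j where j: "j < k" "f i = f j" "(0, j) \<in> E\<^sup>*" by blast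
      \<comment> \<open>The path found ends at an agent \<open>j\<close> on the same vertex as
        \<open>i\<close>, perhaps not at \<open>i\<close> itself; one more step closes the
        gap.\<close>
      have "code c ! j = code c ! i"
        using j(2) i j(1) by (simp add: code_def f_def)
      then have "(j, i) \<in> E" using i j(1) near_refl[OF cn(1)[OF i]] by (simp add: E_def)
      with j(3) show ?thesis by (rule rtrancl_into_rtrancl)
    qed
    then show "conn (code c)" by (simp add: conn_def E_def)
  qed
qed

section \<open>Solutions as paths of configurations\<close>

definition fstep :: "('a \<Rightarrow> 'v) \<Rightarrow> ('a \<Rightarrow> 'v) \<Rightarrow> bool" where
  "fstep c c' \<longleftrightarrow> c' ` agents I \<subseteq> pverts (graph I) \<and>
     (\<forall>a \<in> agents I. c' a = c a \<or> (c a, c' a) \<in> parcs (graph I)) \<and> inj_on c' (agents I) \<and>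
     \<not> (\<exists>a \<in> agents I. \<exists>b \<in> agents I. a \<noteq> b \<and> c' a = c b \<and> c' b = c a) \<and>
     d_connected (graph I) d (c' ` agents I)"

lemma feasible_iff:
  "feasible_solution I m c \<longleftrightarrow> (\<forall>a \<in> agents I. c 0 a = start I a) \<and>
     (\<forall>i < m. fstep (c i) (c (Suc i))) \<and> (\<forall>a \<in> agents I. c m a = target I a)"
proof -
  have shift: "(\<forall>i \<in> {1..m}. P i) \<longleftrightarrow> (\<forall>i < m. P (Suc i))" for P :: "nat \<Rightarrow> bool"
    unfolding image_Suc_lessThan[symmetric] by auto
  show ?thesis
    unfolding feasible_solution_def fstep_def shift diff_Suc_1
    by (simp only: all_conj_distrib imp_conjR conj_assoc)
qed

lemma stp_iff:
  assumes c: "c ` agents I \<subseteq> pverts (graph I)" and c': "c' ` agents I \<subseteq> pverts (graph I)" and k: "0 < k"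
  shows "stp (code c) (code c') \<longleftrightarrow> fstep c c'"
proof -
  have ball: "(\<forall>a \<in> agents I. P a) \<longleftrightarrow> (\<forall>i < k. P (as ! i))" for P
    unfolding as(2)[symmetric] by (simp add: all_set_conv_all_nth)
  have mem: "c (as ! i) \<in> set vs" "c' (as ! i) \<in> set vs" if "i < k" for i
    using that c c' as_mem vs(2) by auto
  have dis: "as ! i = as ! j \<longleftrightarrow> i = j" if "i < k" "j < k" for i j
    using that as(1) by (simp add: nth_eq_iff_index_eq)
  have eq: "code c' ! i = code c ! j \<longleftrightarrow> c' (as ! i) = c (as ! j)" "code c' ! i = code c' ! j \<longleftrightarrow> c' (as ! i) = c' (as ! j)"
    if "i < k" "j < k" for i j
    using that position_inj[OF mem(2)[OF that(1)] mem(1)[OF that(2)]]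
      position_inj[OF mem(2)[OF that(1)] mem(2)[OF that(2)]] by (simp_all add: code_def)
  have "stp (code c) (code c') \<longleftrightarrow>
      (\<forall>i < k. c' (as ! i) = c (as ! i) \<or> (c (as ! i), c' (as ! i)) \<in> parcs (graph I)) \<and>
      clash_free (code c) (code c') \<and> conn (code c')"
    using code_nth[OF c] code_nth[OF c'] eq(1) k by (auto simp: stp_def good_def adj_def)
  moreover have "clash_free (code c) (code c') \<longleftrightarrow> inj_on c' (agents I) \<and>
      \<not> (\<exists>a \<in> agents I. \<exists>b \<in> agents I. a \<noteq> b \<and> c' a = c b \<and> c' b = c a)"
  proof -
    have "inj_on c' (agents I) \<and> \<not> (\<exists>a \<in> agents I. \<exists>b \<in> agents I. a \<noteq> b \<and> c' a = c b \<and> c' b = c a) \<longleftrightarrow>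
        (\<forall>a \<in> agents I. \<forall>b \<in> agents I. a \<noteq> b \<longrightarrow> c' a \<noteq> c' b \<and> \<not> (c' a = c b \<and> c' b = c a))"
      by (auto simp: inj_on_def)
    also have "\<dots> \<longleftrightarrow> clash_free (code c) (code c')"
      unfolding ball clash_free_def using dis eq by auto
    finally show ?thesis by simp
  qed
  ultimately show ?thesis
    using conn_iff[OF c' k] c' by (simp add: fstep_def ball)
qed

lemma reach_mono: "i \<le> j \<Longrightarrow> reach i \<subseteq> reach j"
  by (induction rule: dec_induct) auto

lemma reach_path:
  "c \<in> reach r \<Longrightarrow> \<exists>m \<le> r. \<exists>cs. cs 0 = code (start I) \<and> cs m = c \<and> (\<forall>i < m. stp (cs i) (cs (Suc i)))"
proof (induction r arbitrary: c)
  case 0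
  then show ?case by (intro exI[of _ 0]) auto
next
  case (Suc r)
  show ?case
  proof (cases "c \<in> reach r")
    case True
    then show ?thesis using Suc.IH[of c] le_SucI by blast
  next
    case False
    then obtain c0 where c0: "c0 \<in> reach r" "stp c0 c" using Suc.prems by auto
    from Suc.IH[OF c0(1)] obtain m cs where
      m: "m \<le> r" "cs 0 = code (start I)" "cs m = c0" "\<forall>i < m. stp (cs i) (cs (Suc i))" by blast
    show ?thesis
      by (rule exI[of _ "Suc m"], intro conjI exI[of _ "cs(Suc m := c)"])
        (use m c0(2) in \<open>auto simp: less_Suc_eq\<close>)
  qed
qed

text \<open>With agents, solutions and chains of \<open>stp\<close> translate into each other step
  by step. Without agents no step is possible, but none is needed: the empty sequence is a solution
  and both codes are the empty list.\<close>

lemma yes_iff: "mapfcc_yes I \<longleftrightarrow> code (target I) \<in> reach (makespan_bound I)"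
proof (cases "0 < k")
  case False
  then have "agents I = {}" using as(2) by auto
  then have "feasible_solution I 0 (\<lambda>_. start I)" by (simp add: feasible_iff)
  then have "mapfcc_yes I" unfolding mapfcc_yes_def by blast
  moreover have "code (target I) = code (start I)" using False by (metis length_code length_0_conv neq0_conv)
  then have "code (target I) \<in> reach 0" by simp
  ultimately show ?thesis using reach_mono[of 0 "makespan_bound I"] by blast
next
  case k: True
  show ?thesis
  proof
    assume "mapfcc_yes I"
    then obtain m c where m: "m \<le> makespan_bound I" and f: "feasible_solution I m c"
      by (auto simp: mapfcc_yes_def)
    note f = f[unfolded feasible_iff]
    have "c i ` agents I \<subseteq> pverts (graph I) \<and> code (c i) \<in> reach i" if "i \<le> m" for i
      using that
    proof (induction i)
      case 0
      have "code (c 0) = code (start I)" using f as(2) by (simp add: code_def)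
      moreover have "c 0 ` agents I = start I ` agents I" using f by (intro image_cong) auto
      ultimately show ?case using start(1) by simp
    next
      case (Suc i)
      then have IH: "c i ` agents I \<subseteq> pverts (graph I)" "code (c i) \<in> reach i" by auto
      have fs: "fstep (c i) (c (Suc i))" using f Suc.prems by simp
      then have p': "c (Suc i) ` agents I \<subseteq> pverts (graph I)" by (simp add: fstep_def)
      from fs have "stp (code (c i)) (code (c (Suc i)))" using stp_iff[OF IH(1) p' k] by simp
      then show ?case using IH(2) p' by auto
    qed
    then have "code (c m) \<in> reach m" by blast
    moreover have "code (c m) = code (target I)" using f as(2) by (simp add: code_def)
    ultimately show "code (target I) \<in> reach (makespan_bound I)" using reach_mono[OF m] by auto
  next
    assume "code (target I) \<in> reach (makespan_bound I)"
    from reach_path[OF this] obtain m cs where m: "m \<le> makespan_bound I"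
      and cs: "cs 0 = code (start I)" "cs m = code (target I)" "\<And>i. i < m \<Longrightarrow> stp (cs i) (cs (Suc i))" by blast
    have csn: "length (cs i) = k \<and> set (cs i) \<subseteq> {..<n}" if "i \<le> m" for i
    proof (cases i)
      case 0
      then show ?thesis using cs(1) set_code[OF start(1)] by simp
    next
      case (Suc j)
      then have "stp (cs j) (cs i)" using cs(3)[of j] that by simp
      then show ?thesis by (auto simp: stp_def in_set_conv_nth)
    qed
    define c where "c i a = vs ! (cs i ! position as a)" for i a
    have pos: "position as (as ! j) = j" if "j < k" for j using position_nth[OF as(1) that] .
    have cv: "c i ` agents I \<subseteq> pverts (graph I)" if "i \<le> m" for i
    proof
      fix x assume "x \<in> c i ` agents I"
      then obtain a where a: "a \<in> set as" "x = vs ! (cs i ! position as a)" using as(2) by (auto simp: c_def)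
      have "cs i ! position as a \<in> set (cs i)" using csn[OF that] position_less[OF a(1)] by simp
      then have "cs i ! position as a < n" using csn[OF that] by auto
      from nth_mem[OF this] show "x \<in> pverts (graph I)" unfolding vs(2) a(2) .
    qed
    have cc: "code (c i) = cs i" if "i \<le> m" for i
    proof (rule nth_equalityI)
      show "length (code (c i)) = length (cs i)" using csn[OF that] by simp
      fix j assume "j < length (code (c i))"
      then have j: "j < k" by simp
      then have "cs i ! j \<in> set (cs i)" using csn[OF that] by simp
      then have "cs i ! j < n" using csn[OF that] by auto
      then show "code (c i) ! j = cs i ! j"
        using j by (simp add: code_def c_def pos position_nth[OF vs(1)])
    qed
    \<comment> \<open>A code determines a map only on \<open>agents I\<close>, so start and target
      are recovered agent by agent.\<close>
    have ag: "c i a = x a" if "i \<le> m" "cs i = code x" "a \<in> agents I" "x ` agents I \<subseteq> pverts (graph I)" for i a x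
    proof -
      have a: "position as a < k" "as ! position as a = a"
        using that(3) as(2) by (auto simp: position_less nth_position)
      show ?thesis using code_nth(2)[OF that(4) a(1)] that(2) a(2) by (simp add: c_def)
    qed
    have "feasible_solution I m c"
      unfolding feasible_iff
    proof (intro conjI allI impI ballI)
      fix i assume "i < m"
      then show "fstep (c i) (c (Suc i))"
        using stp_iff[OF cv[of i] cv[of "Suc i"] k] cs(3) cc by simp
    qed (use ag[OF _ cs(1) _ start(1)] ag[OF _ cs(2) _ target] in auto)
    then show "mapfcc_yes I" using m by (auto simp: mapfcc_yes_def)
  qed
qed

lemma inp_encoding:
  assumes xs: "xs = [n, k, d, makespan_bound I] @ map (\<lambda>a. position vs (start I a)) as @
             map (\<lambda>a. position vs (target I a)) as @
             concat (map (\<lambda>u. map (\<lambda>v. if (u, v) \<in> parcs (graph I) then 1 else 0) vs) vs)"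
    and \<sigma>: "\<And>i. i < length xs \<Longrightarrow> ar \<sigma> 0 i = xs ! i"
  shows "inp \<sigma>"
proof -
  let ?M = "concat (map (\<lambda>u. map (\<lambda>v. if (u, v) \<in> parcs (graph I) then 1 else 0 :: nat) vs) vs)"
  have lM: "length ?M = n * n" by (simp add: length_concat comp_def sum_list_triv)
  have xs': "xs = n # k # d # makespan_bound I # (code (start I) @ code (target I) @ ?M)"
    using xs by (simp add: code_def)
  have l: "length xs = 4 + 2 * k + n * n" unfolding xs' by (simp add: lM)
  have h: "xs ! 0 = n" "xs ! 1 = k" "xs ! 2 = d" "xs ! 3 = makespan_bound I"
    by (simp_all add: xs')
  have t: "xs ! (4 + j) = (code (start I) @ code (target I) @ ?M) ! j" for j
    by (simp add: xs')
  have st: "xs ! (4 + i) = code (start I) ! i" if "i < k" for i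
    unfolding t using that by (simp add: nth_append)
  have tg: "xs ! (4 + k + i) = code (target I) ! i" if "i < k" for i
    unfolding add.assoc t using that by (simp add: nth_append)
  have mt: "xs ! (ra u + v) = (if adj u v then 1 else 0)" "ra u + v < length xs" if "u < n" "v < n" for u v
  proof -
    have "u * n + v < n * n"
    proof -
      have "u * n + v < Suc u * n" using that(2) by simp
      also have "\<dots> \<le> n * n" using that(1) by (intro mult_right_mono) auto
      finally show ?thesis .
    qed
    then show "ra u + v < length xs" by (simp add: l ra_def)
    have "ra u + v = 4 + (2 * k + (u * n + v))" by (simp add: ra_def)
    then have "xs ! (ra u + v) = (code (start I) @ code (target I) @ ?M) ! (2 * k + (u * n + v))"
      by (simp only: t)
    also have "\<dots> = ?M ! (u * n + v)" by (simp add: nth_append)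
    also have "\<dots> = (if adj u v then 1 else 0)" 
      unfolding adj_def by (rule concat_map_map_nth[OF that])
    finally show "xs ! (ra u + v) = (if adj u v then 1 else 0)" .
  qed
  show ?thesis
    unfolding inp_def using h st tg mt \<sigma> by (simp add: l)
qed

end

theorem theorem2:
  shows "fixed_parameter_tractable
    (mapfcc_instance :: ('v, 'a) mapfcc \<Rightarrow> bool) mapfcc_encodes mapfcc_yes mapfcc_parameter"
proof -
  obtain C D where tb: "\<And>B. tb B c_mapfcc \<le> C * (B + 1) ^ D" using tb_poly by blast
  show ?thesis
    unfolding fixed_parameter_tractable_def
  proof (rule exI[of _ "prelude @ ccom 46 c_mapfcc"], rule exI[of _ "\<lambda>p. 2 ^ (2 * D * 32 ^ p)"],
      rule exI[of _ "[:40, 12:] + smult C ([:2, 1:] ^ D)"], intro conjI allI impI)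
    show "computable (\<lambda>p. 2 ^ (2 * D * 32 ^ p))" by (rule bound_computable)
  next
    fix I :: "('v, 'a) mapfcc" and xs
    assume I: "mapfcc_instance I \<and> mapfcc_encodes I xs"
    then obtain vs as where e: "distinct vs" "set vs = pverts (graph I)" "distinct as" "set as = agents I"
      and xs: "xs = [length vs, length as, comm_range I, makespan_bound I] @
             map (\<lambda>a. position vs (start I a)) as @ map (\<lambda>a. position vs (target I a)) as @
             concat (map (\<lambda>u. map (\<lambda>v. if (u, v) \<in> parcs (graph I) then 1 else 0) vs) vs)"
      unfolding mapfcc_encodes_def by blast
    define s where "s = input_size xs"
    have len: "length xs \<le> s"
      unfolding s_def input_size_def by (induction xs) auto
    \<comment> \<open>The word holding the number of vertices has only logarithmic size. It is the
      matrix, with one symbol or more per entry, that makes this number at most the input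
      size.\<close>
    have "length vs \<le> length vs * length vs" by (cases vs) auto
    also have "\<dots> \<le> length xs" unfolding xs by (simp add: length_concat comp_def sum_list_triv)
    finally have n: "length vs \<le> s" using len by simp
    interpret encoding I vs as s
      by unfold_locales (rule conjunct1[OF I] e n)+
    have ne: "xs \<noteq> []" by (simp add: xs)
    let ?B = "(s + 1) * 2 ^ (mapfcc_parameter I ^ 5 + (mapfcc_parameter I)\<^sup>2)"
    have "runs ?B c_mapfcc \<sigma> (\<lambda>\<tau>. vr \<tau> 0 = (if mapfcc_yes I then 1 else 0))"
      if "\<And>i. i < length xs \<Longrightarrow> ar \<sigma> 0 i = xs ! i" for \<sigma>
      unfolding yes_iff by (rule mapfcc_correct[OF inp_encoding[OF xs that]])
    from com_ram_outputs[OF wfc_mapfcc ne this] obtain t where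
      t: "t \<le> 12 * length xs + 40 + tb ?B c_mapfcc"
        "ram_outputs (prelude @ ccom 46 c_mapfcc) xs t (if mapfcc_yes I then 1 else 0)" by blast
    have "t \<le> 12 * s + 40 + C * (?B + 1) ^ D" using t(1) len tb[of ?B] by linarith
    also have "\<dots> \<le> 2 ^ (2 * D * 32 ^ mapfcc_parameter I) * poly ([:40, 12:] + smult C ([:2, 1:] ^ D)) s"
      by (rule time_bound)
    finally show "\<exists>t \<le> 2 ^ (2 * D * 32 ^ mapfcc_parameter I) *
          poly ([:40, 12:] + smult C ([:2, 1:] ^ D)) (input_size xs).
        ram_outputs (prelude @ ccom 46 c_mapfcc) xs t (if mapfcc_yes I then 1 else 0)"
      using t(2) unfolding s_def by blast
  qed
qed

end
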